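(* Let $d\in\{2,3\}$, $\Omega=\mathbb T^{d-1}\times(0,1)$ and $A>0$. For any $0<C<2$, there exists a weak (distributional) solution $v$ to the Euler equation $(\mathrm{EE})$ in $\Omega$ with initial value $Ae_1$ such that for any time $0<T<1/(2A)$: $$\|v(T)-Ae_1\|_{L^2(\Omega)}^2=CA^3T.$$
   Context: $\mathbb T=[0,1]_{\mathrm{per}}$ and $e_1$ is the first coordinate vector. $(\mathrm{EE})$ is the incompressible Euler system with impermeability boundary condition, $$\partial_t v+v\cdot\nabla v+\nabla P=0,\qquad\operatorname{div}v=0\quad\text{in }(0,T)\times\Omega,\qquad v\cdot n=0\ \text{for }x_d=0\text{ and }x_d=1,$$ where $n$ is the outer normal. *)

theory Defs
  imports "HOL-Analysis.Analysis"
begin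

type_synonym 'n rvec = "(real, 'n) vec"

text \<open>
  The dimension is \<open>d = CARD('n)\<close>, for a linearly ordered finite index type; its least and greatest
  elements index the coordinates \<open>x\<^sub>1\<close> and \<open>x\<^sub>d\<close>.
\<close>

definition first_ix :: "'n::{finite,linorder}" where
  "first_ix = Min UNIV"

definition last_ix :: "'n::{finite,linorder}" where
  "last_ix = Max UNIV"

definition e1 :: "('n::{finite,linorder}) rvec" where
  "e1 = axis first_ix 1"

text \<open>
  \<open>\<Omega> = \<T>\<^sup>d\<^sup>-\<^sup>1 \<times> (0,1)\<close> as a set of representatives: each point of the periodic channel occurs exactly
  once, so functions on \<open>\<Omega>\<close> are functions on this set, with the same Lebesgue measure. Smooth
  functions on the channel are instead functions on \<open>\<real>\<^sup>d\<close> that are 1-periodic in \<open>x\<^sub>1,\<dots>,x\<^sub>d\<^sub>-\<^sub>1\<close>.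
\<close>

definition Omega :: "(('n::{finite,linorder}) rvec) set" where
  "Omega = {x. (\<forall>i. i \<noteq> last_ix \<longrightarrow> 0 \<le> x $ i \<and> x $ i < 1) \<and> 0 < x $ last_ix \<and> x $ last_ix < 1}"

definition horiz_periodic :: "(('n::{finite,linorder}) rvec \<Rightarrow> 'b) \<Rightarrow> bool" where
  "horiz_periodic f \<longleftrightarrow> (\<forall>i x. i \<noteq> last_ix \<longrightarrow> f (x + axis i 1) = f x)"

definition in_L2 :: "(('n::{finite,linorder}) rvec \<Rightarrow> 'n rvec) \<Rightarrow> bool" where
  "in_L2 u \<longleftrightarrow> set_borel_measurable lborel Omega u \<and>
     set_integrable lborel Omega (\<lambda>x. (norm (u x))\<^sup>2)"

definition L2_norm :: "(('n::{finite,linorder}) rvec \<Rightarrow> 'n rvec) \<Rightarrow> real" where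
  "L2_norm u = sqrt (LINT x:Omega|lborel. (norm (u x))\<^sup>2)"

fun Ck :: "nat \<Rightarrow> ('a::real_normed_vector \<Rightarrow> 'b::real_normed_vector) \<Rightarrow> bool" where
  "Ck 0 f \<longleftrightarrow> continuous_on UNIV f"
| "Ck (Suc k) f \<longleftrightarrow> (\<forall>x. f differentiable (at x)) \<and>
     (\<forall>h. Ck k (\<lambda>x. frechet_derivative f (at x) h))"

definition smooth :: "('a::real_normed_vector \<Rightarrow> 'b::real_normed_vector) \<Rightarrow> bool" where
  "smooth f \<longleftrightarrow> (\<forall>k. Ck k f)"

text \<open>For smooth \<open>f\<close>: all derivatives of order at most \<open>k\<close> have norm at most \<open>B\<close>.\<close>

fun Ck_bounded :: "nat \<Rightarrow> real \<Rightarrow> ('a::real_normed_vector \<Rightarrow> 'b::real_normed_vector) \<Rightarrow> bool" where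
  "Ck_bounded 0 B f \<longleftrightarrow> (\<forall>x. norm (f x) \<le> B)"
| "Ck_bounded (Suc k) B f \<longleftrightarrow> (\<forall>x. norm (f x) \<le> B) \<and>
     (\<forall>h. norm h \<le> 1 \<longrightarrow> Ck_bounded k B (\<lambda>x. frechet_derivative f (at x) h))"

text \<open>
  The smooth functions on \<open>(0,T) \<times> \<Omega>\<close> with support in the compact set
  \<open>[\<delta>,T-\<delta>] \<times> \<T>\<^sup>d\<^sup>-\<^sup>1 \<times> [\<delta>,1-\<delta>]\<close>. Every compact subset of \<open>(0,T) \<times> \<Omega>\<close> lies in such a set, so the union
  over \<open>\<delta> > 0\<close> is the space of compactly supported smooth functions on \<open>(0,T) \<times> \<Omega>\<close>.
\<close>

definition test_fns_on ::
    "real \<Rightarrow> real \<Rightarrow> (real \<times> ('n::{finite,linorder}) rvec \<Rightarrow> 'b::real_normed_vector) set" where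
  "test_fns_on T \<delta> = {\<phi>. smooth \<phi> \<and> (\<forall>t. horiz_periodic (\<lambda>x. \<phi> (t, x))) \<and>
     (\<forall>t x. \<phi> (t, x) \<noteq> 0 \<longrightarrow> \<delta> \<le> t \<and> t \<le> T - \<delta> \<and> \<delta> \<le> x $ last_ix \<and> x $ last_ix \<le> 1 - \<delta>)}"

definition test_fns ::
    "real \<Rightarrow> (real \<times> ('n::{finite,linorder}) rvec \<Rightarrow> 'b::real_normed_vector) set" where
  "test_fns T = (\<Union>\<delta>\<in>{0<..}. test_fns_on T \<delta>)"

text \<open>Scalar distributions on \<open>(0,T) \<times> \<Omega>\<close>.\<close>

definition is_distribution ::
    "real \<Rightarrow> ((real \<times> ('n::{finite,linorder}) rvec \<Rightarrow> real) \<Rightarrow> real) \<Rightarrow> bool" where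
  "is_distribution T P \<longleftrightarrow>
     (\<forall>\<phi>\<in>test_fns T. \<forall>\<psi>\<in>test_fns T. \<forall>a b.
        P (\<lambda>z. a * \<phi> z + b * \<psi> z) = a * P \<phi> + b * P \<psi>) \<and>
     (\<forall>\<delta>>0. \<exists>k M. \<forall>\<phi>\<in>test_fns_on T \<delta>. \<forall>B. Ck_bounded k B \<phi> \<longrightarrow> \<bar>P \<phi>\<bar> \<le> M * B)"

definition time_deriv ::
    "(real \<times> ('n::{finite,linorder}) rvec \<Rightarrow> 'n rvec) \<Rightarrow> real \<times> 'n rvec \<Rightarrow> 'n rvec" where
  "time_deriv \<phi> z = frechet_derivative \<phi> (at z) (1, 0)"

definition space_deriv ::
    "(real \<times> ('n::{finite,linorder}) rvec \<Rightarrow> 'n rvec) \<Rightarrow> real \<times> 'n rvec \<Rightarrow> 'n rvec \<Rightarrow> 'n rvec" where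
  "space_deriv \<phi> z w = frechet_derivative \<phi> (at z) (0, w)"

definition space_div ::
    "(real \<times> ('n::{finite,linorder}) rvec \<Rightarrow> 'n rvec) \<Rightarrow> real \<times> 'n rvec \<Rightarrow> real" where
  "space_div \<phi> z = (\<Sum>i\<in>UNIV. space_deriv \<phi> z (axis i 1) $ i)"

text \<open>
  \<open>\<partial>\<^sub>t v + div (v \<otimes> v) + \<nabla>P = 0\<close> in the sense of distributions on \<open>(0,T) \<times> \<Omega>\<close>; for divergence free \<open>v\<close>
  this is the meaning of \<open>\<partial>\<^sub>t v + v \<cdot> \<nabla>v + \<nabla>P = 0\<close>. The contraction of \<open>v \<otimes> v\<close> with \<open>\<nabla>\<phi>\<close> is the inner
  product of \<open>v\<close> with the derivative of \<open>\<phi>\<close> in direction \<open>v\<close>.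
\<close>

definition momentum_equation ::
    "real \<Rightarrow> (real \<Rightarrow> ('n::{finite,linorder}) rvec \<Rightarrow> 'n rvec) \<Rightarrow>
     ((real \<times> 'n rvec \<Rightarrow> real) \<Rightarrow> real) \<Rightarrow> bool" where
  "momentum_equation T v P \<longleftrightarrow> (\<forall>\<phi>\<in>test_fns T.
     (LINT (t, x):{0<..<T} \<times> Omega|lborel.
        v t x \<bullet> time_deriv \<phi> (t, x) + v t x \<bullet> space_deriv \<phi> (t, x) (v t x))
     + P (space_div \<phi>) = 0)"

text \<open>The pairing \<open>\<integral> u \<cdot> \<nabla>\<psi>\<close> over \<open>\<Omega>\<close>.\<close>

definition grad_pairing ::
    "(('n::{finite,linorder}) rvec \<Rightarrow> 'n rvec) \<Rightarrow> ('n rvec \<Rightarrow> real) \<Rightarrow> real" where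
  "grad_pairing u \<psi> = (LINT x:Omega|lborel. frechet_derivative \<psi> (at x) (u x))"

definition div_free :: "(('n::{finite,linorder}) rvec \<Rightarrow> 'n rvec) \<Rightarrow> bool" where
  "div_free u \<longleftrightarrow> (\<forall>\<psi>. smooth \<psi> \<longrightarrow> horiz_periodic \<psi> \<longrightarrow>
     (\<exists>\<delta>>0. \<forall>x. \<psi> x \<noteq> 0 \<longrightarrow> \<delta> \<le> x $ last_ix \<and> x $ last_ix \<le> 1 - \<delta>) \<longrightarrow>
     grad_pairing u \<psi> = 0)"

text \<open>
  For a divergence free field \<open>u\<close> in \<open>L\<^sup>2(\<Omega>)\<close> the normal trace \<open>u \<cdot> n\<close> is the functional that sends
  the boundary values of \<open>\<psi>\<close> to \<open>\<integral> u \<cdot> \<nabla>\<psi>\<close>, by Green's formula. Here \<open>\<psi>\<close> is smooth up to the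
  boundary and need not vanish there.
\<close>

definition zero_normal_trace :: "(('n::{finite,linorder}) rvec \<Rightarrow> 'n rvec) \<Rightarrow> bool" where
  "zero_normal_trace u \<longleftrightarrow> (\<forall>\<psi>. smooth \<psi> \<longrightarrow> horiz_periodic \<psi> \<longrightarrow> grad_pairing u \<psi> = 0)"

definition weakly_continuous_L2 ::
    "real set \<Rightarrow> (real \<Rightarrow> ('n::{finite,linorder}) rvec \<Rightarrow> 'n rvec) \<Rightarrow> bool" where
  "weakly_continuous_L2 I v \<longleftrightarrow> (\<forall>t\<in>I. in_L2 (v t)) \<and>
     (\<forall>w. in_L2 w \<longrightarrow> continuous_on I (\<lambda>t. LINT x:Omega|lborel. v t x \<bullet> w x))"

text \<open>
  Weak (distributional) solution of the Euler system on \<open>(0,T) \<times> \<Omega>\<close> with initial value \<open>v\<^sub>0\<close>. Weak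
  continuity in time with values in \<open>L\<^sup>2(\<Omega>)\<close> gives the initial value and \<open>v(t)\<close>, for each single \<open>t\<close>,
  their meaning.
\<close>

definition euler_weak_solution ::
    "real \<Rightarrow> (('n::{finite,linorder}) rvec \<Rightarrow> 'n rvec) \<Rightarrow> (real \<Rightarrow> 'n rvec \<Rightarrow> 'n rvec) \<Rightarrow> bool" where
  "euler_weak_solution T v0 v \<longleftrightarrow>
     set_borel_measurable lborel ({0<..<T} \<times> Omega) (\<lambda>(t, x). v t x) \<and>
     (\<forall>S. 0 < S \<and> S < T \<longrightarrow>
        set_integrable lborel ({0<..<S} \<times> Omega) (\<lambda>(t, x). (norm (v t x))\<^sup>2)) \<and>
     weakly_continuous_L2 {0..<T} v \<and>
     (AE x in lborel. x \<in> Omega \<longrightarrow> v 0 x = v0 x) \<and>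
     (\<forall>t\<in>{0<..<T}. div_free (v t) \<and> zero_normal_trace (v t)) \<and>
     (\<exists>P. is_distribution T P \<and> momentum_equation T v P)"

end

theory Submission
  imports Defs
begin

text \<open>
  Convex integration with a positive Reynolds stress and without pressure. Put \<open>c = C A\<^sup>3\<close>. The constant
  flow \<open>w = A e\<^sub>1\<close> solves \<open>\<partial>\<^sub>t w + div (w \<otimes> w + R) = 0\<close> with \<open>R = (c t / 2) I\<close>, and its total energy, counted as
  \<open>\<integral> |w|\<^sup>2 + tr R\<close>, is \<open>A\<^sup>2 + c t\<close>. On a small space-time ball, where \<open>w\<close> and \<open>R\<close> are nearly constant, one adds
  to \<open>w\<close> a plane wave \<open>V\<close> of high frequency, transported by \<open>w\<close> and derived from a compactly supported
  potential. This replaces \<open>R\<close> by \<open>R - V \<otimes> V\<close> up to a small error, which stays positive definite if the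
  amplitude \<open>m\<close> of \<open>V\<close> satisfies \<open>m \<otimes> m < R\<close>; no averaging of \<open>V \<otimes> V\<close> is necessary. Filling the channel with such
  balls moves a fixed fraction of \<open>\<integral> tr R\<close> into \<open>\<integral> |w|\<^sup>2\<close> at each time, while the total energy and the mean of \<open>w\<close>
  do not change. Hence \<open>\<integral> tr R\<close> decays geometrically along the iteration, the flows converge strongly in
  \<open>L\<^sup>2\<close> at each time, and the limit solves the Euler equations with zero pressure and
  \<open>\<integral> |v - A e\<^sub>1|\<^sup>2 = c t\<close>. The energy grows; weak solutions need not dissipate it, so that nothing has to
  leave through the walls.
\<close>

section \<open>Integration by parts\<close>

text \<open>The stress (c t / 2) I degenerates at t = 0, so nothing is uniform down to the initial
  time: step k leaves times below L / (2 (k + 1)) untouched, each convergence constant depends on a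
  lower bound for t, and weak continuity at t = 0 comes from the identity for the deviation instead.
  The claim concerns every single time, so energies are integrals over time slices, and the packets
  must oscillate in space. Corrections live inside the open unit cell and are tested against
  arbitrary C1 functions, periodic or not; hence the walls and the torus matter for the constant
  flow only. New balls are chosen after V \<otimes> V has been subtracted from the stress: R stays
  continuous, however fast it oscillates, and is nearly constant on balls that are small enough. The
  cutoff is only C2, so V and U are merely continuous and the equations are used in tested form
  throughout. This is why integration by parts is set up for C1 functions, in the shape of an
  exchange of two derivatives (\<open>integral_swap_C1\<close>).\<close>

definition C1 :: "('a::euclidean_space \<Rightarrow> real) \<Rightarrow> ('a \<Rightarrow> 'a \<Rightarrow> real) \<Rightarrow> bool" where
  "C1 f f' \<longleftrightarrow> (\<forall>z. (f has_derivative f' z) (at z)) \<and> (\<forall>p. continuous_on UNIV (\<lambda>z. f' z p))"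

lemma C1_continuous: "C1 f f' \<Longrightarrow> continuous_on UNIV f"
  unfolding C1_def by (meson differentiable_imp_continuous_within differentiableI continuous_on_eq_continuous_within has_derivative_at_withinI)

lemma C1_continuous': "C1 f f' \<Longrightarrow> continuous_on UNIV (\<lambda>z. f' z p)"
  unfolding C1_def by auto

lemma C1_linear: "C1 f f' \<Longrightarrow> linear (f' z)"
  unfolding C1_def using has_derivative_linear by blast

lemma C1_mult:
  assumes "C1 f f'" "C1 g g'"
  shows "C1 (\<lambda>z. f z * g z) (\<lambda>z p. f z * g' z p + f' z p * g z)"
  using assms C1_continuous[OF assms(1)] C1_continuous[OF assms(2)] unfolding C1_def
  by (auto intro!: has_derivative_mult continuous_intros)

lemma continuous_shift:
  fixes f :: "'a::real_normed_vector \<Rightarrow> real"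
  assumes "continuous_on UNIV f" shows "continuous_on UNIV (\<lambda>z. f (z + c))"
  by (rule continuous_on_compose2[OF assms, of UNIV "\<lambda>z. z + c"]) (auto intro!: continuous_intros)

lemma C1_shift_diff:
  assumes "C1 g g'"
  shows "C1 (\<lambda>z. g (z + c) - g z) (\<lambda>z p. g' (z + c) p - g' z p)"
proof -
  have "((\<lambda>z. g (z + c)) has_derivative g' (z + c)) (at z)" for z
  proof -
    have "(g has_derivative g' (z + c)) (at (z + c))" using assms C1_def by blast
    moreover have "((\<lambda>z. z + c) has_derivative (\<lambda>h. h)) (at z)" by (auto intro!: derivative_eq_intros)
    ultimately show ?thesis using has_derivative_compose[of "\<lambda>z. z + c" "\<lambda>h. h" z UNIV g "g' (z + c)"]
      by simp
  qed
  moreover have "continuous_on UNIV (\<lambda>z. g' (z + c) p)" for p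
    by (rule continuous_shift[OF C1_continuous'[OF assms]])
  ultimately show ?thesis using assms unfolding C1_def
    by (auto intro!: continuous_intros has_derivative_diff)
qed

lemma C1_line:
  assumes "C1 f f'"
  shows "((\<lambda>s. f (z + s *\<^sub>R p)) has_real_derivative f' (z + s *\<^sub>R p) p) (at s)"
proof -
  have "(f has_derivative f' (z + s *\<^sub>R p)) (at (z + s *\<^sub>R p))" using assms C1_def by blast
  moreover have "((\<lambda>s. z + s *\<^sub>R p) has_derivative (\<lambda>h. h *\<^sub>R p)) (at s)"
    by (auto intro!: derivative_eq_intros)
  ultimately have "((\<lambda>s. f (z + s *\<^sub>R p)) has_derivative (\<lambda>h. f' (z + s *\<^sub>R p) (h *\<^sub>R p))) (at s)"
    using has_derivative_compose by blast
  moreover have "(\<lambda>h. f' (z + s *\<^sub>R p) (h *\<^sub>R p)) = (\<lambda>h. f' (z + s *\<^sub>R p) p * h)"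
    using linear_scale[OF C1_linear[OF assms]] by (auto simp: fun_eq_iff)
  ultimately show ?thesis by (simp add: has_field_derivative_def)
qed

lemma continuous_bounded_on_ball:
  fixes f :: "'a::euclidean_space \<Rightarrow> real"
  assumes "continuous_on UNIV f"
  obtains M where "M > 0" "\<And>z. norm z \<le> B \<Longrightarrow> \<bar>f z\<bar> \<le> M"
proof -
  have "compact (f ` cball 0 B)"
    using assms by (intro compact_continuous_image) (auto intro: continuous_on_subset)
  then obtain M where "\<forall>x\<in>f ` cball 0 B. norm x \<le> M"
    using compact_imp_bounded bounded_iff by metis
  then show ?thesis by (intro that[of "\<bar>M\<bar> + 1"]) force+
qed

text \<open>By the mean value theorem a quotient is a derivative at a point of the ball enlarged by
  \<open>norm p\<close>. The bound provides the majorant for dominated convergence below.\<close>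

lemma C1_quotient_bound:
  assumes "C1 f f'"
  obtains M where "M > 0"
    "\<And>z s. norm z \<le> B \<Longrightarrow> 0 < s \<Longrightarrow> s \<le> 1 \<Longrightarrow> \<bar>(f (z + s *\<^sub>R p) - f z) / s\<bar> \<le> M"
proof -
  obtain M where M: "M > 0" "\<And>z. norm z \<le> B + norm p \<Longrightarrow> \<bar>f' z p\<bar> \<le> M"
    using continuous_bounded_on_ball[OF C1_continuous'[OF assms, of p]] by metis
  show ?thesis
  proof (rule that[OF M(1)])
    fix z :: 'a and s :: real assume z: "norm z \<le> B" and s: "0 < s" "s \<le> 1"
    have "\<exists>\<sigma>. 0 < \<sigma> \<and> \<sigma> < s \<and> f (z + s *\<^sub>R p) - f (z + 0 *\<^sub>R p) = (s - 0) * f' (z + \<sigma> *\<^sub>R p) p"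
      using s by (intro MVT2) (auto intro!: C1_line[OF assms])
    then obtain \<sigma> where \<sigma>: "0 < \<sigma>" "\<sigma> < s" "f (z + s *\<^sub>R p) - f z = s * f' (z + \<sigma> *\<^sub>R p) p" by auto
    have "norm (z + \<sigma> *\<^sub>R p) \<le> norm z + \<sigma> * norm p"
      using norm_triangle_ineq[of z "\<sigma> *\<^sub>R p"] \<sigma> by simp
    also have "\<dots> \<le> B + 1 * norm p" using z \<sigma> s by (intro add_mono mult_right_mono) auto
    finally have "\<bar>f' (z + \<sigma> *\<^sub>R p) p\<bar> \<le> M" using M(2) by simp
    then show "\<bar>(f (z + s *\<^sub>R p) - f z) / s\<bar> \<le> M" using \<sigma> s by simp
  qed
qed

section \<open>Difference quotients under the integral sign\<close>

lemma integrable_bounded_support: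
  fixes f :: "'a::euclidean_space \<Rightarrow> real"
  assumes "f \<in> borel_measurable borel" "\<And>z. \<bar>f z\<bar> \<le> M" "\<And>z. norm z > B \<Longrightarrow> f z = 0"
  shows "integrable lborel f"
proof -
  have "integrable lborel (\<lambda>z. indicator (cball 0 B) z *\<^sub>R f z)"
  proof (rule integrableI_bounded_set_indicator[where B = M])
    show "emeasure lborel (cball (0::'a) B) < \<infinity>" by (metis emeasure_lborel_cball_finite)
  qed (use assms in auto)
  moreover have "(\<lambda>z. indicator (cball 0 B) z *\<^sub>R f z) = f"
    using assms(3) by (auto simp: fun_eq_iff indicator_def not_le)
  ultimately show ?thesis by simp
qed

lemma lborel_integral_abs_le:
  fixes f g :: "'a::euclidean_space \<Rightarrow> real"
  assumes "integrable lborel f" "integrable lborel g" "\<And>x. \<bar>f x\<bar> \<le> g x"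
  shows "\<bar>LINT x|lborel. f x\<bar> \<le> (LINT x|lborel. g x)"
  using assms by (intro order_trans[OF integral_abs_bound] integral_mono) auto

lemma integrable_continuous_support:
  fixes f :: "'a::euclidean_space \<Rightarrow> real"
  assumes "continuous_on UNIV f" "\<And>z. norm z > B \<Longrightarrow> f z = 0"
  shows "integrable lborel f"
proof -
  obtain M where M: "M > 0" "\<And>z. norm z \<le> B \<Longrightarrow> \<bar>f z\<bar> \<le> M"
    using continuous_bounded_on_ball[OF assms(1)] by metis
  show ?thesis
  proof (rule integrable_bounded_support[of f M B])
    show "f \<in> borel_measurable borel" using assms(1) by (rule borel_measurable_continuous_onI)
    show "\<bar>f z\<bar> \<le> M" for z using M assms(2)[of z] by (cases "norm z \<le> B") auto
  qed (use assms in auto)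
qed

lemma C1_quotient_seq:
  assumes f: "C1 f f'"
  shows "(\<lambda>n. (f (z + (1 / real (Suc n)) *\<^sub>R p) - f z) / (1 / real (Suc n))) \<longlonglongrightarrow> f' z p"
proof -
  have "((\<lambda>s. f (z + s *\<^sub>R p)) has_real_derivative f' (z + 0 *\<^sub>R p) p) (at 0)"
    by (rule C1_line[OF f])
  then have "((\<lambda>s. (f (z + s *\<^sub>R p) - f z) / s) \<longlongrightarrow> f' z p) (at 0)"
    by (simp add: has_field_derivative_iff)
  moreover have "filterlim (\<lambda>n. 1 / real (Suc n)) (at 0) sequentially"
    unfolding filterlim_at using LIMSEQ_inverse_real_of_nat
    by (auto simp: inverse_eq_divide)
  ultimately show "(\<lambda>n. (f (z + (1 / real (Suc n)) *\<^sub>R p) - f z) / (1 / real (Suc n))) \<longlonglongrightarrow> f' z p"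
    by (rule filterlim_compose)
qed

text \<open>Dominated convergence. The weight \<open>h\<close> need not be continuous, so that it
  can be the indicator of a domain as well as a derivative of a C1 function.\<close>

lemma integral_quotient_limit:
  assumes f: "C1 f f'" and h: "h \<in> borel_measurable borel" "\<And>z. \<bar>h z\<bar> \<le> H"
    "\<And>z. norm z > B \<Longrightarrow> h z = 0"
  shows "(\<lambda>n. LINT z|lborel. h z * ((f (z + (1 / real (Suc n)) *\<^sub>R p) - f z) / (1 / real (Suc n))))
     \<longlonglongrightarrow> (LINT z|lborel. h z * f' z p)"
proof -
  obtain M where M: "M > 0"
    "\<And>z s. norm z \<le> B \<Longrightarrow> 0 < s \<Longrightarrow> s \<le> 1 \<Longrightarrow> \<bar>(f (z + s *\<^sub>R p) - f z) / s\<bar> \<le> M"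
    using C1_quotient_bound[OF f] by metis
  have fm: "f \<in> borel_measurable borel" "(\<lambda>z. f' z p) \<in> borel_measurable borel"
    using C1_continuous[OF f] C1_continuous'[OF f] by (auto intro: borel_measurable_continuous_onI)
  have fm1: "(\<lambda>z. f (z + c)) \<in> borel_measurable borel" for c
    using fm(1) by measurable
  have H: "H \<ge> 0" using h(2)[of 0] by auto
  show ?thesis
  proof (rule integral_dominated_convergence[where w = "\<lambda>z. indicator (cball 0 B) z * (H * M)"])
    show "integrable lborel (\<lambda>z. indicator (cball (0::'a) B) z * (H * M))"
      by (intro integrable_bounded_support[where M = "H * M" and B = B])
        (use H M in \<open>auto simp: indicator_def\<close>)
    show "AE z in lborel. (\<lambda>n. h z * ((f (z + (1 / real (Suc n)) *\<^sub>R p) - f z) / (1 / real (Suc n))))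
       \<longlonglongrightarrow> h z * f' z p"
    proof (rule AE_I2)
      fix z
      show "(\<lambda>n. h z * ((f (z + (1 / real (Suc n)) *\<^sub>R p) - f z) / (1 / real (Suc n))))
         \<longlonglongrightarrow> h z * f' z p" by (intro tendsto_intros C1_quotient_seq[OF f])
    qed
    show "AE z in lborel. norm (h z * ((f (z + (1 / real (Suc n)) *\<^sub>R p) - f z) / (1 / real (Suc n))))
       \<le> indicator (cball 0 B) z * (H * M)" for n
    proof (rule AE_I2)
      fix z
      show "norm (h z * ((f (z + (1 / real (Suc n)) *\<^sub>R p) - f z) / (1 / real (Suc n))))
         \<le> indicator (cball 0 B) z * (H * M)"
      proof (cases "norm z \<le> B")
        case True
        have "\<bar>(f (z + (1 / real (Suc n)) *\<^sub>R p) - f z) / (1 / real (Suc n))\<bar> \<le> M"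
          using True by (intro M(2)) auto
        then have "\<bar>h z\<bar> * \<bar>(f (z + (1 / real (Suc n)) *\<^sub>R p) - f z) / (1 / real (Suc n))\<bar> \<le> H * M"
          using h(2)[of z] H by (intro mult_mono) auto
        then show ?thesis using True by (simp add: abs_mult)
      qed (use h(3) in auto)
    qed
  qed (use h fm fm1 in \<open>auto intro!: borel_measurable_times borel_measurable_diff borel_measurable_divide\<close>)
qed

lemma lborel_integral_translate:
  fixes f :: "'a::euclidean_space \<Rightarrow> real"
  assumes "f \<in> borel_measurable borel"
  shows "(LINT z|lborel. f (z + c)) = (LINT z|lborel. f z)"
proof -
  have "(LINT z|lborel. f z) = (LINT z|distr lborel borel ((+) c). f z)"
    by (simp add: lborel_distr_plus)
  also have "\<dots> = (LINT z|lborel. f (c + z))"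
    using assms by (subst integral_distr) auto
  finally show ?thesis by (simp add: add.commute)
qed

text \<open>Shift invariance makes every difference quotient integrate to zero, hence also the
  limit. Invariance is left as the hypothesis \<open>inv\<close>, because it has different sources:
  translation of the whole space, periodicity, or a domain unbounded in the direction
  \<open>p\<close>.\<close>

lemma integral_deriv_zero_set:
  assumes f: "C1 f f'" and S: "S \<in> sets borel"
    and B: "\<And>z s. z \<in> S \<Longrightarrow> norm z > B \<Longrightarrow> 0 \<le> s \<Longrightarrow> s \<le> 1 \<Longrightarrow> f (z + s *\<^sub>R p) = 0"
    and inv: "\<And>s. 0 < s \<Longrightarrow> s \<le> 1 \<Longrightarrow>
      (LINT z|lborel. indicator S z * f (z + s *\<^sub>R p)) = (LINT z|lborel. indicator S z * f z)"
  shows "(LINT z|lborel. indicator S z * f' z p) = 0"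
proof -
  let ?h = "\<lambda>z. indicator S z * indicator (cball 0 B) z :: real"
  have lim: "(\<lambda>n. LINT z|lborel. ?h z * ((f (z + (1 / real (Suc n)) *\<^sub>R p) - f z) / (1 / real (Suc n))))
     \<longlonglongrightarrow> (LINT z|lborel. ?h z * f' z p)"
    by (rule integral_quotient_limit[OF f, where H = 1 and B = B])
      (use S in \<open>auto simp: indicator_def\<close>)
  have fm: "(\<lambda>z. f (z + c)) \<in> borel_measurable borel" for c
    using borel_measurable_continuous_onI[OF C1_continuous[OF f]] by measurable
  have eq: "?h z * f (z + s *\<^sub>R p) = indicator S z * f (z + s *\<^sub>R p)" if "0 \<le> s" "s \<le> 1" for z s
    using B[of z s] that by (auto simp: indicator_def)
  have int: "integrable lborel (\<lambda>z. ?h z * f (z + s *\<^sub>R p))" for s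
  proof -
    have "continuous_on UNIV (\<lambda>z. f (z + s *\<^sub>R p))"
      by (rule continuous_shift[OF C1_continuous[OF f]])
    then obtain M where M: "M > 0" "\<And>z. norm z \<le> B \<Longrightarrow> \<bar>f (z + s *\<^sub>R p)\<bar> \<le> M"
      using continuous_bounded_on_ball by metis
    show ?thesis
      by (rule integrable_bounded_support[where M = M and B = B])
        (use S fm M in \<open>auto simp: indicator_def\<close>)
  qed
  have "(LINT z|lborel. ?h z * ((f (z + s *\<^sub>R p) - f z) / s)) = 0" if "0 < s" "s \<le> 1" for s
  proof -
    have "(LINT z|lborel. ?h z * ((f (z + s *\<^sub>R p) - f z) / s))
      = (LINT z|lborel. (?h z * f (z + s *\<^sub>R p) - ?h z * f (z + 0 *\<^sub>R p)) / s)"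
      by (intro Bochner_Integration.integral_cong) (auto simp: algebra_simps)
    also have "\<dots> = ((LINT z|lborel. ?h z * f (z + s *\<^sub>R p)) - (LINT z|lborel. ?h z * f (z + 0 *\<^sub>R p))) / s"
      using int by (subst integral_divide_zero) (simp only: Bochner_Integration.integral_diff[OF int int])
    also have "\<dots> = 0"
      using inv[OF that] that by (simp only: eq) simp
    finally show ?thesis .
  qed
  then have "(LINT z|lborel. ?h z * ((f (z + (1 / real (Suc n)) *\<^sub>R p) - f z) / (1 / real (Suc n)))) = 0" for n
    by (rule meta_mp) auto
  then have "(\<lambda>n. 0) \<longlonglongrightarrow> (LINT z|lborel. ?h z * f' z p)"
    using lim by (simp only:)
  then have 0: "(LINT z|lborel. ?h z * f' z p) = 0"
    using LIMSEQ_unique tendsto_const by blast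
  \<comment> \<open>Outside the ball \<open>?h\<close> removes the integrand, but there
    \<open>f\<close> vanishes along the whole segment, so the derivative is zero anyway.\<close>
  have "?h z * f' z p = indicator S z * f' z p" for z
  proof (cases "z \<in> S \<and> norm z > B")
    case True
    have "f (z + (1 / real (Suc n)) *\<^sub>R p) - f z = 0" for n
      using B[of z "1 / real (Suc n)"] B[of z 0] True by simp
    then have "f' z p = 0"
      using LIMSEQ_unique[OF C1_quotient_seq[OF f, of z p]] by simp
    then show ?thesis by simp
  qed (auto simp: indicator_def)
  then show ?thesis using 0 by (simp only:)
qed

lemma integral_deriv_zero:
  assumes f: "C1 f f'" and B: "\<And>z. norm z > B \<Longrightarrow> f z = 0"
  shows "(LINT z|lborel. f' z p) = 0"
proof -
  have fm: "f \<in> borel_measurable borel"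
    using borel_measurable_continuous_onI[OF C1_continuous[OF f]] .
  have "(LINT z|lborel. indicator UNIV z * f' z p) = 0"
  proof (rule integral_deriv_zero_set[OF f, of _ "B + norm p"])
    fix z :: 'a and s :: real assume "norm z > B + norm p" "0 \<le> s" "s \<le> 1"
    then have "norm z - s * norm p > B" using mult_right_mono[of s 1 "norm p"] by auto
    then have "norm (z + s *\<^sub>R p) > B"
      using norm_diff_ineq[of z "s *\<^sub>R p"] \<open>0 \<le> s\<close> by simp
    then show "f (z + s *\<^sub>R p) = 0" by (rule B)
  qed (use lborel_integral_translate[OF fm] in auto)
  then show ?thesis by simp
qed

lemma integral_by_parts_C1:
  assumes f: "C1 f f'" and g: "C1 g g'" and B: "\<And>z. norm z > B \<Longrightarrow> f z = 0"
  shows "(LINT z|lborel. f' z p * g z) = - (LINT z|lborel. f z * g' z p)"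
proof -
  have f': "f' z p = 0" if "norm z > B" for z
  proof -
    have "(f has_derivative f' z) (at z)" using f C1_def by blast
    moreover have "open {z::'a. norm z > B}" by (intro open_Collect_less continuous_intros)
    ultimately have "((\<lambda>z. 0) has_derivative f' z) (at z)"
      using has_derivative_transform_within_open[of f "f' z" z UNIV "{z. norm z > B}" "\<lambda>_. 0"] that B
      by auto
    then have "f' z = (\<lambda>_. 0)" using has_derivative_unique has_derivative_const by metis
    then show ?thesis by simp
  qed
  have i1: "integrable lborel (\<lambda>z. f' z p * g z)" and i2: "integrable lborel (\<lambda>z. f z * g' z p)"
    by (rule integrable_continuous_support[where B = B];
        use f' B C1_continuous[OF f] C1_continuous[OF g] C1_continuous'[OF f] C1_continuous'[OF g]
        in \<open>auto intro!: continuous_intros\<close>)+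
  have "(LINT z|lborel. f z * g' z p + f' z p * g z) = 0"
    by (rule integral_deriv_zero[OF C1_mult[OF f g], of B]) (use B in auto)
  then show ?thesis using i1 i2 by simp
qed

text \<open>If \<open>g\<close> were C2, both sides would be minus the integral of \<open>f\<close>
  times the mixed second derivative of \<open>g\<close>. For C1 functions a difference quotient in
  direction \<open>e\<close> takes the place of one derivative: integration by parts in direction
  \<open>q\<close>, then a translation that moves the quotient from \<open>g\<close> to
  \<open>f\<close>.\<close>

lemma integral_swap_C1:
  assumes f: "C1 f f'" and g: "C1 g g'" and B: "\<And>z. norm z > B \<Longrightarrow> f z = 0"
    and f'B: "\<And>z q. norm z > B \<Longrightarrow> f' z q = 0"
  shows "(LINT z|lborel. f' z q * g' z e) = (LINT z|lborel. f' z e * g' z q)"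
proof -
  let ?i = "\<lambda>n. 1 / real (Suc n)"
  have fm: "f \<in> borel_measurable borel" "(\<lambda>z. f' z q) \<in> borel_measurable borel"
      "(\<lambda>z. g' z q) \<in> borel_measurable borel"
    using C1_continuous[OF f] C1_continuous'[OF f] C1_continuous'[OF g]
    by (auto intro: borel_measurable_continuous_onI)
  obtain M1 where M1: "M1 > 0" "\<And>z. norm z \<le> B \<Longrightarrow> \<bar>f' z q\<bar> \<le> M1"
    using continuous_bounded_on_ball[OF C1_continuous'[OF f]] by metis
  let ?B = "B + norm e"
  obtain M2 where M2: "M2 > 0" "\<And>z. norm z \<le> ?B \<Longrightarrow> \<bar>g' z q\<bar> \<le> M2"
    using continuous_bounded_on_ball[OF C1_continuous'[OF g]] by metis
  have L1: "(\<lambda>n. LINT z|lborel. f' z q * ((g (z + ?i n *\<^sub>R e) - g z) / ?i n))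
     \<longlonglongrightarrow> (LINT z|lborel. f' z q * g' z e)"
    by (rule integral_quotient_limit[OF g, where H = M1 and B = B])
      (use fm M1 f'B in \<open>auto, metis abs_zero less_eq_real_def linorder_not_less\<close>)
  \<comment> \<open>\<open>g'\<close> need not be bounded on the whole space. The quotients of
    \<open>f\<close> vanish outside the enlarged ball, so the indicator changes nothing and gives a
    bounded weight.\<close>
  have L2: "(\<lambda>n. LINT z|lborel. (indicator (cball 0 ?B) z * g' z q) *
       ((f (z + ?i n *\<^sub>R (-e)) - f z) / ?i n))
     \<longlonglongrightarrow> (LINT z|lborel. (indicator (cball 0 ?B) z * g' z q) * f' z (-e))"
    by (rule integral_quotient_limit[OF f, where H = M2 and B = "?B"])
      (use fm M2 in \<open>auto simp: indicator_def\<close>)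
  have eq: "(LINT z|lborel. f' z q * ((g (z + ?i n *\<^sub>R e) - g z) / ?i n)) =
     - (LINT z|lborel. (indicator (cball 0 ?B) z * g' z q) * ((f (z + ?i n *\<^sub>R (-e)) - f z) / ?i n))" for n
  proof -
    define s where "s = ?i n"
    have s: "0 < s" "s \<le> 1" by (auto simp: s_def)
    have far: "f (z - s *\<^sub>R e) = 0" if "norm z > ?B" for z
    proof -
      have "norm (s *\<^sub>R e) \<le> norm e" using s mult_right_mono[of s 1 "norm e"] by auto
      then have "norm (z - s *\<^sub>R e) > B" using norm_triangle_ineq2[of z "s *\<^sub>R e"] that by simp
      then show ?thesis by (rule B)
    qed
    have cf: "continuous_on UNIV (\<lambda>z. f (z - s *\<^sub>R e))"
      using continuous_shift[OF C1_continuous[OF f], of "- s *\<^sub>R e"] by simp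
    have cg: "continuous_on UNIV (\<lambda>z. g' (z + s *\<^sub>R e) q)"
      by (rule continuous_shift[OF C1_continuous'[OF g]])
    have i1: "integrable lborel (\<lambda>z. f (z - s *\<^sub>R e) * g' z q)"
      by (rule integrable_continuous_support[where B = ?B])
        (use far cf C1_continuous'[OF g] in \<open>auto intro!: continuous_intros\<close>)
    have i2: "integrable lborel (\<lambda>z. f z * g' z q)"
      by (rule integrable_continuous_support[where B = B])
        (use B C1_continuous[OF f] C1_continuous'[OF g] in \<open>auto intro!: continuous_intros\<close>)
    have i3: "integrable lborel (\<lambda>z. f z * g' (z + s *\<^sub>R e) q)"
      by (rule integrable_continuous_support[where B = B])
        (use B C1_continuous[OF f] cg in \<open>auto intro!: continuous_intros\<close>)
    have "(LINT z|lborel. f' z q * ((g (z + s *\<^sub>R e) - g z) / s))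
        = (LINT z|lborel. f' z q * (g (z + s *\<^sub>R e) - g z)) / s"
      by (simp)
    also have "(LINT z|lborel. f' z q * (g (z + s *\<^sub>R e) - g z))
        = - (LINT z|lborel. f z * (g' (z + s *\<^sub>R e) q - g' z q))"
      by (rule integral_by_parts_C1[OF f C1_shift_diff[OF g] B])
    also have "(LINT z|lborel. f z * (g' (z + s *\<^sub>R e) q - g' z q))
       = (LINT z|lborel. f z * g' (z + s *\<^sub>R e) q) - (LINT z|lborel. f z * g' z q)"
      using i2 i3 by (simp add: right_diff_distrib)
    also have "(LINT z|lborel. f z * g' (z + s *\<^sub>R e) q) = (LINT z|lborel. f (z - s *\<^sub>R e) * g' z q)"
    proof -
      have "(\<lambda>z. f (z - s *\<^sub>R e) * g' z q) \<in> borel_measurable borel"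
        using cf C1_continuous'[OF g]
        by (intro borel_measurable_continuous_onI continuous_intros)
      from lborel_integral_translate[OF this, of "s *\<^sub>R e"] show ?thesis by simp
    qed
    also have "\<dots> - (LINT z|lborel. f z * g' z q) = (LINT z|lborel. f (z - s *\<^sub>R e) * g' z q - f z * g' z q)"
      using i1 i2 by simp
    also have "\<dots> = (LINT z|lborel. s * ((indicator (cball 0 ?B) z * g' z q) * ((f (z + s *\<^sub>R (-e)) - f z) / s)))"
    proof (intro Bochner_Integration.integral_cong refl)
      fix z
      show "f (z - s *\<^sub>R e) * g' z q - f z * g' z q =
         s * ((indicator (cball 0 ?B) z * g' z q) * ((f (z + s *\<^sub>R (-e)) - f z) / s))"
      proof (cases "norm z \<le> ?B")
        case False
        then have "f z = 0" using B[of z] norm_ge_zero[of e] by (auto simp: not_le simp del: norm_ge_zero)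
        then show ?thesis using far[of z] False by simp
      qed (use s in \<open>simp add: field_simps\<close>)
    qed
    also have "\<dots> = s * (LINT z|lborel. (indicator (cball 0 ?B) z * g' z q) * ((f (z + s *\<^sub>R (-e)) - f z) / s))"
      by (rule integral_mult_right_zero)
    finally have "(LINT z|lborel. f' z q * ((g (z + s *\<^sub>R e) - g z) / s)) =
       - (s * (LINT z|lborel. (indicator (cball 0 ?B) z * g' z q) * ((f (z + s *\<^sub>R (-e)) - f z) / s))) / s" .
    moreover have "- (s * x) / s = - x" for x using s by simp
    ultimately show ?thesis by (simp only: s_def)
  qed
  have "(LINT z|lborel. f' z q * g' z e)
     = - (LINT z|lborel. (indicator (cball 0 ?B) z * g' z q) * f' z (-e))"
    by (rule LIMSEQ_unique[OF L1]) (use tendsto_minus[OF L2] in \<open>simp only: eq\<close>)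
  also have "\<dots> = (LINT z|lborel. f' z e * g' z q)"
  proof -
    have "- ((indicator (cball 0 ?B) z * g' z q) * f' z (-e)) = f' z e * g' z q" for z
    proof (cases "norm z \<le> ?B")
      case False
      then have "f' z e = 0" using f'B[of z] norm_ge_zero[of e] by (auto simp: not_le simp del: norm_ge_zero)
      then show ?thesis using linear_neg[OF C1_linear[OF f]] by simp
    qed (use linear_neg[OF C1_linear[OF f]] in simp)
    then show ?thesis by (subst Bochner_Integration.integral_minus[symmetric]) simp
  qed
  finally show ?thesis .
qed

section \<open>Localized plane waves\<close>

text \<open>A power of a positive part replaces a smooth bump function, as finitely many derivatives
  suffice. At the corner the quotient is at most |h|^(k+1), which tends to zero.\<close>

lemma DERIV_pos_part_power:
  "((\<lambda>y::real. (max 0 y) ^ Suc (Suc k)) has_real_derivative real (Suc (Suc k)) * (max 0 y) ^ Suc k) (at y)"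
proof -
  consider "y > 0" | "y < 0" | "y = 0" by linarith
  then show ?thesis
  proof cases
    case 1
    have "((\<lambda>y::real. y ^ Suc (Suc k)) has_real_derivative real (Suc (Suc k)) * y ^ Suc k) (at y)"
      using DERIV_pow[of "Suc (Suc k)" y] by simp
    then have "((\<lambda>y::real. (max 0 y) ^ Suc (Suc k)) has_real_derivative real (Suc (Suc k)) * y ^ Suc k) (at y)"
      by (rule DERIV_cong_ev[THEN iffD1, rotated 3])
        (use eventually_nhds_in_open[of "{0<..}" y] 1 in \<open>auto elim!: eventually_mono simp: max_def\<close>)
    then show ?thesis using 1 by (simp add: max_def)
  next
    case 2
    have "((\<lambda>y::real. 0) has_real_derivative 0) (at y)" by simp
    then have "((\<lambda>y::real. (max 0 y) ^ Suc (Suc k)) has_real_derivative 0) (at y)"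
      by (rule DERIV_cong_ev[THEN iffD1, rotated 3])
        (use eventually_nhds_in_open[of "{..<0}" y] 2 in \<open>auto elim!: eventually_mono simp: max_def\<close>)
    then show ?thesis using 2 by (simp add: max_def)
  next
    case 3
    have "((\<lambda>h::real. (max 0 h) ^ Suc (Suc k) / h) \<longlongrightarrow> 0) (at 0)"
    proof (rule Lim_null_comparison)
      show "\<forall>\<^sub>F h in at 0. norm ((max 0 h) ^ Suc (Suc k) / h) \<le> \<bar>h::real\<bar> ^ Suc k"
        by (rule eventuallyI) (auto simp: max_def abs_mult power_abs intro!: mult_nonpos_nonneg)
      have "((\<lambda>h::real. \<bar>h\<bar> ^ Suc k) \<longlongrightarrow> \<bar>0\<bar> ^ Suc k) (at 0)" by (intro tendsto_intros)
      then show "((\<lambda>h::real. \<bar>h\<bar> ^ Suc k) \<longlongrightarrow> 0) (at 0)" by simp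
    qed
    then show ?thesis using 3 by (simp add: has_field_derivative_iff)
  qed
qed

section \<open>Cutoff functions and wave packets\<close>

definition cut_arg :: "'a::euclidean_space \<Rightarrow> real \<Rightarrow> 'a \<Rightarrow> real" where
  "cut_arg z0 r z = max 0 (1 - ((z - z0) \<bullet> (z - z0)) / r\<^sup>2)"

text \<open>The exponent 3 is the least for which a power of the positive part has two continuous
  derivatives, the number that the potential of a wave packet needs.\<close>

definition cutoff :: "'a::euclidean_space \<Rightarrow> real \<Rightarrow> 'a \<Rightarrow> real" where
  "cutoff z0 r z = cut_arg z0 r z ^ 3"

definition dcutoff :: "'a::euclidean_space \<Rightarrow> real \<Rightarrow> 'a \<Rightarrow> 'a \<Rightarrow> real" where
  "dcutoff z0 r z p = 3 * (cut_arg z0 r z)\<^sup>2 * (- 2 * ((z - z0) \<bullet> p) / r\<^sup>2)"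

definition ddcutoff :: "'a::euclidean_space \<Rightarrow> real \<Rightarrow> 'a \<Rightarrow> 'a \<Rightarrow> 'a \<Rightarrow> real" where
  "ddcutoff z0 r z p q = 6 * cut_arg z0 r z * (- 2 * ((z - z0) \<bullet> q) / r\<^sup>2) * (- 2 * ((z - z0) \<bullet> p) / r\<^sup>2)
     + 3 * (cut_arg z0 r z)\<^sup>2 * (- 2 * (q \<bullet> p) / r\<^sup>2)"

lemma continuous_cut_arg [continuous_intros]: "continuous_on S (cut_arg z0 r)"
  unfolding cut_arg_def by (cases "r = 0") (auto intro!: continuous_intros)

lemma cut_arg_01: "0 \<le> cut_arg z0 r z" "cut_arg z0 r z \<le> 1"
  by (auto simp: cut_arg_def)

lemma cutoff_01: "0 \<le> cutoff z0 r z" "cutoff z0 r z \<le> 1"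
  using cut_arg_01[of z0 r z] by (auto simp: cutoff_def power_le_one)

lemma cut_arg_outside:
  assumes "r > 0" "r \<le> dist z z0" shows "cut_arg z0 r z = 0"
proof -
  have "r\<^sup>2 \<le> (norm (z - z0))\<^sup>2" using assms by (intro power_mono) (auto simp: dist_norm)
  then have "1 \<le> ((z - z0) \<bullet> (z - z0)) / r\<^sup>2" using assms(1) by (simp add: power2_norm_eq_inner)
  then show ?thesis by (simp add: cut_arg_def)
qed

lemma cut_arg_power_derivative:
  "((\<lambda>z. cut_arg z0 r z ^ Suc (Suc k)) has_derivative
     (\<lambda>p. real (Suc (Suc k)) * cut_arg z0 r z ^ Suc k * (- 2 * ((z - z0) \<bullet> p) / r\<^sup>2))) (at z)"
proof -
  have "((\<lambda>z. 1 - ((z - z0) \<bullet> (z - z0)) / r\<^sup>2) has_derivative (\<lambda>p. - 2 * ((z - z0) \<bullet> p) / r\<^sup>2)) (at z)"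
    by (auto intro!: derivative_eq_intros simp: inner_commute divide_inverse algebra_simps)
  from has_derivative_compose[OF this
      DERIV_pos_part_power[unfolded has_field_derivative_def, of k "1 - ((z - z0) \<bullet> (z - z0)) / r\<^sup>2"]]
  show ?thesis unfolding cut_arg_def by simp
qed

lemma C1_cutoff: "C1 (cutoff z0 r) (dcutoff z0 r)"
  unfolding C1_def
proof (intro conjI allI)
  show "(cutoff z0 r has_derivative dcutoff z0 r z) (at z)" for z
    using cut_arg_power_derivative[of z0 r 1 z]
    unfolding cutoff_def[abs_def] dcutoff_def[abs_def] by (simp add: numeral_3_eq_3 power2_eq_square)
  show "continuous_on UNIV (\<lambda>z. dcutoff z0 r z p)" for p
    unfolding dcutoff_def divide_inverse by (intro continuous_intros)
qed

lemma C1_dcutoff: "C1 (\<lambda>z. dcutoff z0 r z p) (\<lambda>z. ddcutoff z0 r z p)"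
  unfolding C1_def
proof (intro conjI allI)
  fix z
  have "((\<lambda>z. (cut_arg z0 r z)\<^sup>2) has_derivative (\<lambda>q. 2 * cut_arg z0 r z * (- 2 * ((z - z0) \<bullet> q) / r\<^sup>2))) (at z)"
    using cut_arg_power_derivative[of z0 r 0 z] by (simp add: numeral_2_eq_2)
  moreover have "((\<lambda>z. - 2 * ((z - z0) \<bullet> p) / r\<^sup>2) has_derivative (\<lambda>q. - 2 * (q \<bullet> p) / r\<^sup>2)) (at z)"
    by (auto intro!: derivative_eq_intros simp: divide_inverse)
  ultimately have "((\<lambda>z. 3 * (cut_arg z0 r z)\<^sup>2 * (- 2 * ((z - z0) \<bullet> p) / r\<^sup>2)) has_derivative
     (\<lambda>q. 3 * (cut_arg z0 r z)\<^sup>2 * (- 2 * (q \<bullet> p) / r\<^sup>2) +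
       3 * (2 * cut_arg z0 r z * (- 2 * ((z - z0) \<bullet> q) / r\<^sup>2)) * (- 2 * ((z - z0) \<bullet> p) / r\<^sup>2))) (at z)"
    by (intro has_derivative_mult has_derivative_mult_right)
  then show "((\<lambda>z. dcutoff z0 r z p) has_derivative ddcutoff z0 r z p) (at z)"
    unfolding dcutoff_def ddcutoff_def[abs_def] by (simp add: add.commute mult.assoc)
  show "continuous_on UNIV (\<lambda>z. ddcutoff z0 r z p q)" for q
    unfolding ddcutoff_def divide_inverse by (intro continuous_intros)
qed

lemma cutoff_outside:
  assumes "r > 0" "r \<le> dist z z0"
  shows "cutoff z0 r z = 0" "dcutoff z0 r z p = 0" "ddcutoff z0 r z p q = 0"
  using cut_arg_outside[OF assms] by (auto simp: cutoff_def dcutoff_def ddcutoff_def)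

text \<open>First and second derivatives of \<open>- cutoff z0 r z * cos (N * (k \<bullet> z)) / N\<^sup>2\<close>, the potential of a wave packet.\<close>

definition dpkt :: "'a::euclidean_space \<Rightarrow> real \<Rightarrow> 'a \<Rightarrow> real \<Rightarrow> 'a \<Rightarrow> 'a \<Rightarrow> real" where
  "dpkt z0 r k N z p = - (dcutoff z0 r z p * cos (N * (k \<bullet> z))) / N\<^sup>2
     + cutoff z0 r z * ((k \<bullet> p) * sin (N * (k \<bullet> z))) / N"

definition hpkt :: "'a::euclidean_space \<Rightarrow> real \<Rightarrow> 'a \<Rightarrow> real \<Rightarrow> 'a \<Rightarrow> 'a \<Rightarrow> 'a \<Rightarrow> real" where
  "hpkt z0 r k N z p q = - (ddcutoff z0 r z p q * cos (N * (k \<bullet> z))) / N\<^sup>2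
     + (dcutoff z0 r z p * (k \<bullet> q) + dcutoff z0 r z q * (k \<bullet> p)) * sin (N * (k \<bullet> z)) / N
     + cutoff z0 r z * cos (N * (k \<bullet> z)) * ((k \<bullet> p) * (k \<bullet> q))"

lemma C1_trig:
  "C1 (\<lambda>z. cos (N * (k \<bullet> z))) (\<lambda>z p. - (N * (k \<bullet> p) * sin (N * (k \<bullet> z))))"
  "C1 (\<lambda>z. sin (N * (k \<bullet> z))) (\<lambda>z p. N * (k \<bullet> p) * cos (N * (k \<bullet> z)))"
  unfolding C1_def by (auto intro!: derivative_eq_intros continuous_intros simp: mult_ac)

lemma C1_add: "C1 f f' \<Longrightarrow> C1 g g' \<Longrightarrow> C1 (\<lambda>z. f z + g z) (\<lambda>z p. f' z p + g' z p)"
  unfolding C1_def by (auto intro!: has_derivative_add continuous_intros)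

lemma C1_cmult: "C1 f f' \<Longrightarrow> C1 (\<lambda>z. c * f z) (\<lambda>z p. c * f' z p)"
  unfolding C1_def by (auto intro!: has_derivative_mult_right continuous_intros)

lemma C1_cong: "C1 f f' \<Longrightarrow> (\<And>z. f z = g z) \<Longrightarrow> (\<And>z p. f' z p = g' z p) \<Longrightarrow> C1 g g'"
  by (metis (no_types, lifting) ext)

lemma C1_dpkt: "N \<noteq> 0 \<Longrightarrow> C1 (\<lambda>z. dpkt z0 r k N z p) (\<lambda>z. hpkt z0 r k N z p)"
  by (rule C1_cong[OF C1_add[OF C1_cmult[OF C1_mult[OF C1_dcutoff C1_trig(1)], of "- 1 / N\<^sup>2"]
      C1_cmult[OF C1_mult[OF C1_cutoff C1_trig(2)], of "(k \<bullet> p) / N"]]])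
    (auto simp: dpkt_def hpkt_def field_simps power2_eq_square)

lemma ddcutoff_commute: "ddcutoff z0 r z p q = ddcutoff z0 r z q p"
  by (simp add: ddcutoff_def inner_commute mult_ac)

lemma hpkt_commute: "hpkt z0 r k N z p q = hpkt z0 r k N z q p"
  by (simp add: hpkt_def ddcutoff_commute[of z0 r z p q] mult_ac add.commute)

lemma packet_outside:
  assumes "r > 0" "r \<le> dist z z0"
  shows "dpkt z0 r k N z p = 0" "hpkt z0 r k N z p q = 0"
  using cutoff_outside[OF assms] by (simp_all add: dpkt_def hpkt_def)

lemma continuous_outside_bounded:
  fixes f :: "'a::euclidean_space \<Rightarrow> real"
  assumes "continuous_on UNIV f" "\<And>z. r \<le> dist z z0 \<Longrightarrow> f z = 0"
  obtains M where "M > 0" "\<And>z. \<bar>f z\<bar> \<le> M"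
proof -
  obtain M where M: "M > 0" "\<And>z. norm z \<le> norm z0 + r \<Longrightarrow> \<bar>f z\<bar> \<le> M"
    using continuous_bounded_on_ball[OF assms(1)] by metis
  have "\<bar>f z\<bar> \<le> M" for z
  proof (cases "r \<le> dist z z0")
    case False
    then have "norm z \<le> norm z0 + r" using norm_triangle_sub[of z z0] by (simp add: dist_norm)
    then show ?thesis by (rule M)
  qed (use assms(2) M(1) in auto)
  then show ?thesis using that M(1) by blast
qed

text \<open>The potential carries the factor 1 / N^2, so only the term with both derivatives on the
  cosine is of order one; each derivative that falls on the cutoff costs a factor 1 / N.\<close>

lemma hpkt_leading:
  assumes "r > 0"
  obtains B where "B > 0" "\<And>N z. N \<ge> 1 \<Longrightarrow>
    \<bar>hpkt z0 r k N z p q - cutoff z0 r z * cos (N * (k \<bullet> z)) * ((k \<bullet> p) * (k \<bullet> q))\<bar> \<le> B / N"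
proof -
  obtain M1 where M1: "M1 > 0" "\<And>z. \<bar>ddcutoff z0 r z p q\<bar> \<le> M1"
    using continuous_outside_bounded[OF C1_continuous'[OF C1_dcutoff] cutoff_outside(3)[OF assms]] by metis
  have h1: "continuous_on UNIV (\<lambda>z. dcutoff z0 r z p * (k \<bullet> q) + dcutoff z0 r z q * (k \<bullet> p))"
    by (intro continuous_intros C1_continuous'[OF C1_cutoff])
  have h2: "dcutoff z0 r z p * (k \<bullet> q) + dcutoff z0 r z q * (k \<bullet> p) = 0" if "r \<le> dist z z0" for z
    using cutoff_outside(2)[OF assms that] by simp
  obtain M2 where M2: "M2 > 0" "\<And>z. \<bar>dcutoff z0 r z p * (k \<bullet> q) + dcutoff z0 r z q * (k \<bullet> p)\<bar> \<le> M2"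
    using continuous_outside_bounded[OF h1 h2] by metis
  show ?thesis
  proof (rule that[of "M1 + M2"])
    fix N :: real and z assume N: "N \<ge> 1"
    have "\<bar>- (ddcutoff z0 r z p q * cos (N * (k \<bullet> z))) / N\<^sup>2\<bar> \<le> M1 / N"
    proof -
      have "\<bar>ddcutoff z0 r z p q\<bar> * \<bar>cos (N * (k \<bullet> z))\<bar> \<le> M1 * 1"
        using M1 by (intro mult_mono) auto
      moreover have "N \<le> N\<^sup>2" using N by (simp add: power2_eq_square)
      ultimately show ?thesis using N M1(1) by (simp add: abs_mult frac_le)
    qed
    moreover have "\<bar>(dcutoff z0 r z p * (k \<bullet> q) + dcutoff z0 r z q * (k \<bullet> p)) * sin (N * (k \<bullet> z)) / N\<bar> \<le> M2 / N"
    proof -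
      have "\<bar>dcutoff z0 r z p * (k \<bullet> q) + dcutoff z0 r z q * (k \<bullet> p)\<bar> * \<bar>sin (N * (k \<bullet> z))\<bar> \<le> M2 * 1"
        using M2 by (intro mult_mono) auto
      then show ?thesis using N by (simp add: abs_mult divide_right_mono)
    qed
    ultimately show "\<bar>hpkt z0 r k N z p q - cutoff z0 r z * cos (N * (k \<bullet> z)) * ((k \<bullet> p) * (k \<bullet> q))\<bar>
        \<le> (M1 + M2) / N"
      unfolding hpkt_def add_divide_distrib by linarith
  qed (use M1 M2 in auto)
qed

lemma C1_slice:
  fixes F :: "real \<times> 'b::euclidean_space \<Rightarrow> real"
  assumes "C1 F F'"
  shows "C1 (\<lambda>x. F (t, x)) (\<lambda>x h. F' (t, x) (0, h))"
  unfolding C1_def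
proof (intro conjI allI)
  fix x
  have "(F has_derivative F' (t, x)) (at (t, x))" using assms C1_def by blast
  moreover have "((\<lambda>x. (t, x)) has_derivative (\<lambda>h. (0, h))) (at x)"
    by (auto intro!: derivative_eq_intros)
  ultimately show "((\<lambda>x. F (t, x)) has_derivative (\<lambda>h. F' (t, x) (0, h))) (at x)"
    using has_derivative_compose by blast
next
  fix p
  show "continuous_on UNIV (\<lambda>x. F' (t, x) (0, p))"
    by (rule continuous_on_compose2[OF C1_continuous'[OF assms], of UNIV "\<lambda>x. (t, x)"])
      (auto intro!: continuous_intros)
qed

lemma continuous_slice:
  fixes F :: "real \<times> 'b::euclidean_space \<Rightarrow> real"
  assumes "continuous_on UNIV F"
  shows "continuous_on UNIV (\<lambda>x. F (t, x))"
  by (rule continuous_on_compose2[OF assms, of UNIV "\<lambda>x. (t, x)"]) (auto intro!: continuous_intros)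

lemma norm_snd_large:
  fixes z0 :: "real \<times> 'b::euclidean_space"
  assumes "norm x > norm z0 + r" shows "r \<le> dist (t, x) z0"
proof -
  have "norm x \<le> norm (t, x)" by (simp add: norm_Pair real_le_rsqrt)
  moreover have "norm (t, x) - norm z0 \<le> dist (t, x) z0" by (simp add: dist_norm norm_triangle_ineq2)
  ultimately show ?thesis using assms by linarith
qed

text \<open>The square of the cosine is 1/2 plus half a cosine of double frequency, and one
  integration by parts in space makes the latter small, uniformly in the time of the slice. A phase
  that varies in time alone would be constant on a slice, whence the condition on
  \<open>snd k\<close>.\<close>

lemma oscillation_average:
  fixes z0 k :: "real \<times> 'b::euclidean_space"
  assumes r: "r > 0" and k: "snd k \<noteq> 0"
  obtains B where "B > 0" "\<And>N t. N \<ge> 1 \<Longrightarrow>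
    (LINT x|lborel. (cutoff z0 r (t, x) * cos (N * (k \<bullet> (t, x))))\<^sup>2)
      \<ge> (LINT x|lborel. (cutoff z0 r (t, x))\<^sup>2) / 2 - B / N"
proof -
  define p where "p = (0::real, snd k)"
  have kp: "k \<bullet> p = (norm (snd k))\<^sup>2" by (simp add: p_def inner_prod_def power2_norm_eq_inner)
  define c where "c = (norm (snd k))\<^sup>2"
  have c: "c > 0" using k by (simp add: c_def)
  obtain M where M: "M > 0" "\<And>z. \<bar>dcutoff z0 r z p\<bar> \<le> M"
    using continuous_outside_bounded[OF C1_continuous'[OF C1_cutoff] cutoff_outside(2)[OF r]] by metis
  define v where "v = measure lborel (cball (0::'b) (norm z0 + r))"
  define B where "B = M * v / c + 1"
  have v: "v \<ge> 0" by (simp add: v_def)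
  show ?thesis
  proof (rule that[of B])
    show "B > 0" using M c v by (simp add: B_def add_nonneg_pos)
    fix N t :: real assume N: "N \<ge> 1"
    let ?c = "\<lambda>x. cutoff z0 r (t, x)" and ?th = "\<lambda>x. 2 * N * (k \<bullet> (t, x))"
    \<comment> \<open>Along \<open>p\<close> the derivative of the double frequency sine brings out
      2 N c, so the oscillating integral equals a bounded one divided by N.\<close>
    let ?F = "\<lambda>z. (cutoff z0 r z * cutoff z0 r z) * sin ((2 * N) * (k \<bullet> z))"
    let ?F' = "\<lambda>z q. cutoff z0 r z * cutoff z0 r z * (2 * N * (k \<bullet> q) * cos (2 * N * (k \<bullet> z)))
        + (cutoff z0 r z * dcutoff z0 r z q + dcutoff z0 r z q * cutoff z0 r z) * sin (2 * N * (k \<bullet> z))"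
    have "C1 ?F ?F'" by (intro C1_mult C1_cutoff C1_trig)
    from C1_slice[OF this, of t]
    have S: "C1 (\<lambda>x. ?F (t, x)) (\<lambda>x h. ?F' (t, x) (0, h))" .
    have out: "?c x = 0" "dcutoff z0 r (t, x) q = 0" if "norm x > norm z0 + r" for x q
      using cutoff_outside[OF r norm_snd_large[OF that]] by auto
    have "(LINT x|lborel. ?F' (t, x) (0, snd k)) = 0"
      by (rule integral_deriv_zero[OF S, of "norm z0 + r"]) (use out in auto)
    then have 0: "(LINT x|lborel. ?F' (t, x) p) = 0" by (simp only: p_def)
    have cc: "continuous_on UNIV ?c" by (rule continuous_slice[OF C1_continuous[OF C1_cutoff]])
    have cd: "continuous_on UNIV (\<lambda>x. dcutoff z0 r (t, x) p)"
      by (rule continuous_slice[OF C1_continuous'[OF C1_cutoff]])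
    have ct: "continuous_on UNIV ?th" by (intro continuous_intros)
    note int = integrable_continuous_support[where B = "norm z0 + r"]
    have i1: "integrable lborel (\<lambda>x. (?c x)\<^sup>2 * cos (?th x))"
      by (rule int) (use out cc ct in \<open>auto intro!: continuous_intros\<close>)
    have i2: "integrable lborel (\<lambda>x. ?c x * dcutoff z0 r (t, x) p * sin (?th x))"
      by (rule int) (use out cc cd ct in \<open>auto intro!: continuous_intros\<close>)
    have i3: "integrable lborel (\<lambda>x. (?c x)\<^sup>2)"
      by (rule int) (use out cc in \<open>auto intro!: continuous_intros\<close>)
    have "?F' (t, x) p = 2 * N * c * ((?c x)\<^sup>2 * cos (?th x))
        + 2 * (?c x * dcutoff z0 r (t, x) p * sin (?th x))" for x
      by (simp add: kp c_def power2_eq_square algebra_simps)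
    then have eq: "2 * N * c * (LINT x|lborel. (?c x)\<^sup>2 * cos (?th x))
        + 2 * (LINT x|lborel. ?c x * dcutoff z0 r (t, x) p * sin (?th x)) = 0"
      using 0 by (simp only: Bochner_Integration.integral_add[OF integrable_mult_right[OF i1]
        integrable_mult_right[OF i2]] integral_mult_right_zero)
    have "\<bar>LINT x|lborel. ?c x * dcutoff z0 r (t, x) p * sin (?th x)\<bar>
        \<le> (LINT x|lborel. indicator (cball (0::'b) (norm z0 + r)) x * M)"
    proof (rule lborel_integral_abs_le[OF i2])
      show "integrable lborel (\<lambda>x. indicator (cball (0::'b) (norm z0 + r)) x * M)"
        by (rule integrable_bounded_support[where M = M and B = "norm z0 + r"])
          (use M in \<open>auto simp: indicator_def\<close>)
      fix x
      show "\<bar>?c x * dcutoff z0 r (t, x) p * sin (?th x)\<bar> \<le> indicator (cball 0 (norm z0 + r)) x * M"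
      proof (cases "norm x > norm z0 + r")
        case False
        have "\<bar>?c x\<bar> * \<bar>dcutoff z0 r (t, x) p\<bar> * \<bar>sin (?th x)\<bar> \<le> 1 * M * 1"
          using M cutoff_01[of z0 r "(t, x)"] by (intro mult_mono) auto
        then show ?thesis using False by (simp add: abs_mult)
      qed (use out in simp)
    qed
    also have "\<dots> = M * v"
      by (simp add: v_def)
    finally have "\<bar>N * c * (LINT x|lborel. (?c x)\<^sup>2 * cos (?th x))\<bar> \<le> M * v"
      using eq by linarith
    then have "- (M * v) \<le> N * (c * (LINT x|lborel. (?c x)\<^sup>2 * cos (?th x)))" by (simp add: mult.assoc)
    then have osc: "(LINT x|lborel. (?c x)\<^sup>2 * cos (?th x)) \<ge> - ((M * v / c) / N)"
      using N c by (simp add: field_simps)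
    have "(?c x * cos (N * (k \<bullet> (t, x))))\<^sup>2 = (?c x)\<^sup>2 / 2 + ((?c x)\<^sup>2 * cos (?th x)) / 2" for x
    proof -
      have "cos (?th x) = 2 * (cos (N * (k \<bullet> (t, x))))\<^sup>2 - 1"
        using cos_double_cos[of "N * (k \<bullet> (t, x))"] by (simp add: mult.assoc)
      then show ?thesis by (simp only: power_mult_distrib) (simp add: field_simps)
    qed
    then have "(LINT x|lborel. (?c x * cos (N * (k \<bullet> (t, x))))\<^sup>2)
       = (LINT x|lborel. (?c x)\<^sup>2) / 2 + (LINT x|lborel. (?c x)\<^sup>2 * cos (?th x)) / 2"
      using i1 i3 by simp
    moreover have "(M * v / c) / N \<le> B / N"
      using N by (intro divide_right_mono) (auto simp: B_def)
    moreover have "(M * v / c) / N \<ge> 0" using M v c N by simp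
    ultimately show "(LINT x|lborel. (?c x * cos (N * (k \<bullet> (t, x))))\<^sup>2)
       \<ge> (LINT x|lborel. (?c x)\<^sup>2) / 2 - B / N" using osc by linarith
  qed
qed

section \<open>The linear system for perturbations in weak form\<close>

type_synonym 'n field = "real \<times> (real, 'n) vec \<Rightarrow> real"

definition dt :: "real \<times> ('n::{finite,linorder}) rvec" where "dt = (1, 0)"
definition ef :: "('n::{finite,linorder}) rvec" where "ef = axis first_ix 1"
definition el :: "('n::{finite,linorder}) rvec" where "el = axis last_ix 1"
definition df :: "real \<times> ('n::{finite,linorder}) rvec" where "df = (0, ef)"
definition dl :: "real \<times> ('n::{finite,linorder}) rvec" where "dl = (0, el)"

text \<open>
  Weak form of \<open>\<partial>\<^sub>t V + div U = 0\<close>, \<open>div V = 0\<close> for a symmetric matrix field \<open>U\<close>. All fields have components in the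
  first and last coordinate directions only, so that the construction is the same in every dimension.
  The vanishing means of \<open>U11\<close> and \<open>U22\<close> make the total energy exact later on.
\<close>

definition perturbation :: "(real \<times> ('n::{finite,linorder}) rvec) set \<Rightarrow>
    'n field \<Rightarrow> 'n field \<Rightarrow> 'n field \<Rightarrow> 'n field \<Rightarrow> 'n field \<Rightarrow> bool" where
  "perturbation K V1 V2 U11 U12 U22 \<longleftrightarrow>
     continuous_on UNIV V1 \<and> continuous_on UNIV V2 \<and>
     continuous_on UNIV U11 \<and> continuous_on UNIV U12 \<and> continuous_on UNIV U22 \<and>
     (\<forall>z. z \<notin> K \<longrightarrow> V1 z = 0 \<and> V2 z = 0 \<and> U11 z = 0 \<and> U12 z = 0 \<and> U22 z = 0) \<and>
     (\<forall>t. (LINT x|lborel. V1 (t, x)) = 0 \<and> (LINT x|lborel. V2 (t, x)) = 0 \<and>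
        (LINT x|lborel. U11 (t, x)) = 0 \<and> (LINT x|lborel. U22 (t, x)) = 0) \<and>
     (\<forall>t \<psi> \<psi>'. C1 \<psi> \<psi>' \<longrightarrow> (LINT x|lborel. V1 (t, x) * \<psi>' x ef + V2 (t, x) * \<psi>' x el) = 0) \<and>
     (\<forall>g1 g1' g2 g2'. C1 g1 g1' \<longrightarrow> C1 g2 g2' \<longrightarrow>
        (LINT z|lborel. V1 z * g1' z dt + V2 z * g2' z dt + U11 z * g1' z df
           + U12 z * (g1' z dl + g2' z df) + U22 z * g2' z dl) = 0)"

lemma first_neq_last:
  assumes "CARD('n::{finite,linorder}) \<ge> 2"
  shows "(first_ix :: 'n) \<noteq> last_ix"
proof
  assume eq: "(first_ix :: 'n) = last_ix"
  have "x = first_ix" for x :: 'n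
    using eq Min_le[OF finite UNIV_I, of x] Max_ge[OF finite UNIV_I, of x]
    unfolding first_ix_def last_ix_def by (metis order_antisym)
  then have "(UNIV :: 'n set) = {first_ix}" by auto
  then have "CARD('n) = card {first_ix :: 'n}" by (rule arg_cong)
  then show False using assms by simp
qed

lemma frame_inner:
  assumes "(first_ix :: 'n::{finite,linorder}) \<noteq> last_ix"
  shows "ef \<bullet> (ef :: 'n rvec) = 1" "el \<bullet> (el :: 'n rvec) = 1" "ef \<bullet> (el :: 'n rvec) = 0" "el \<bullet> (ef :: 'n rvec) = 0"
  using assms by (auto simp: ef_def el_def inner_axis_axis)

lemma integrable_field:
  fixes f :: "real \<times> 'b::euclidean_space \<Rightarrow> real"
  assumes "continuous_on UNIV f" "bounded K" "\<And>z. z \<notin> K \<Longrightarrow> f z = 0"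
  shows "integrable lborel f" "integrable lborel (\<lambda>x. f (t, x))"
proof -
  obtain B where B: "\<And>z. z \<in> K \<Longrightarrow> norm z \<le> B" using assms(2) bounded_iff by metis
  have out: "f z = 0" if "norm z > B" for z using assms(3)[of z] B[of z] that by force
  show "integrable lborel f" by (rule integrable_continuous_support[OF assms(1) out])
  have "f (t, x) = 0" if "norm x > B" for x
    using out[of "(t, x)"] that by (smt (verit) norm_snd_le snd_conv)
  then show "integrable lborel (\<lambda>x. f (t, x))"
    by (intro integrable_continuous_support[OF continuous_slice[OF assms(1)]])
qed

lemma perturbation_zero: "perturbation K (\<lambda>_. 0) (\<lambda>_. 0) (\<lambda>_. 0) (\<lambda>_. 0) (\<lambda>_. 0)"
  by (simp add: perturbation_def)

lemma perturbation_mono: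
  "perturbation K V1 V2 U11 U12 U22 \<Longrightarrow> K \<subseteq> K' \<Longrightarrow> perturbation K' V1 V2 U11 U12 U22"
  unfolding perturbation_def by blast

lemma perturbation_add:
  assumes K: "bounded K" and P: "perturbation K V1 V2 U11 U12 U22" "perturbation K W1 W2 T11 T12 T22"
  shows "perturbation K (\<lambda>z. V1 z + W1 z) (\<lambda>z. V2 z + W2 z)
    (\<lambda>z. U11 z + T11 z) (\<lambda>z. U12 z + T12 z) (\<lambda>z. U22 z + T22 z)"
proof -
  have c: "continuous_on UNIV V1" "continuous_on UNIV V2"
      "continuous_on UNIV U11" "continuous_on UNIV U12" "continuous_on UNIV U22"
      "continuous_on UNIV W1" "continuous_on UNIV W2"
      "continuous_on UNIV T11" "continuous_on UNIV T12" "continuous_on UNIV T22"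
    and o: "\<And>z. z \<notin> K \<Longrightarrow> V1 z = 0" "\<And>z. z \<notin> K \<Longrightarrow> V2 z = 0"
      "\<And>z. z \<notin> K \<Longrightarrow> U11 z = 0" "\<And>z. z \<notin> K \<Longrightarrow> U12 z = 0" "\<And>z. z \<notin> K \<Longrightarrow> U22 z = 0"
      "\<And>z. z \<notin> K \<Longrightarrow> W1 z = 0" "\<And>z. z \<notin> K \<Longrightarrow> W2 z = 0"
      "\<And>z. z \<notin> K \<Longrightarrow> T11 z = 0" "\<And>z. z \<notin> K \<Longrightarrow> T12 z = 0" "\<And>z. z \<notin> K \<Longrightarrow> T22 z = 0"
    using P unfolding perturbation_def by blast+
  note i = integrable_field(2)[OF c(1) K o(1)] integrable_field(2)[OF c(2) K o(2)]
    integrable_field(2)[OF c(3) K o(3)] integrable_field(2)[OF c(5) K o(5)]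
    integrable_field(2)[OF c(6) K o(6)] integrable_field(2)[OF c(7) K o(7)]
    integrable_field(2)[OF c(8) K o(8)] integrable_field(2)[OF c(10) K o(10)]
  have div: "(LINT x|lborel. (V1 (t, x) + W1 (t, x)) * \<psi>' x ef + (V2 (t, x) + W2 (t, x)) * \<psi>' x el) = 0"
    if "C1 \<psi> \<psi>'" for t \<psi> \<psi>'
  proof -
    let ?A = "\<lambda>z. V1 z * \<psi>' (snd z) ef + V2 z * \<psi>' (snd z) el"
    let ?B = "\<lambda>z. W1 z * \<psi>' (snd z) ef + W2 z * \<psi>' (snd z) el"
    have cp: "continuous_on UNIV (\<lambda>z. \<psi>' (snd z) p)" for p
      by (rule continuous_on_compose2[OF C1_continuous'[OF that], of UNIV snd])
        (auto intro!: continuous_intros)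
    have "integrable lborel (\<lambda>x. ?A (t, x))" "integrable lborel (\<lambda>x. ?B (t, x))"
      by (rule integrable_field(2)[OF _ K]; auto intro!: continuous_intros cp c simp: o)+
    moreover have "(LINT x|lborel. ?A (t, x)) = 0" "(LINT x|lborel. ?B (t, x)) = 0"
      using P that unfolding perturbation_def by auto
    ultimately have "(LINT x|lborel. ?A (t, x) + ?B (t, x)) = 0" by simp
    then show ?thesis by (simp add: algebra_simps)
  qed
  have mom: "(LINT z|lborel. (V1 z + W1 z) * g1' z dt + (V2 z + W2 z) * g2' z dt + (U11 z + T11 z) * g1' z df
           + (U12 z + T12 z) * (g1' z dl + g2' z df) + (U22 z + T22 z) * g2' z dl) = 0"
    if g: "C1 g1 g1'" "C1 g2 g2'" for g1 g1' g2 g2'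
  proof -
    let ?A = "\<lambda>z. V1 z * g1' z dt + V2 z * g2' z dt + U11 z * g1' z df
           + U12 z * (g1' z dl + g2' z df) + U22 z * g2' z dl"
    let ?B = "\<lambda>z. W1 z * g1' z dt + W2 z * g2' z dt + T11 z * g1' z df
           + T12 z * (g1' z dl + g2' z df) + T22 z * g2' z dl"
    have "integrable lborel ?A" "integrable lborel ?B"
      by (rule integrable_field(1)[OF _ K];
          auto intro!: continuous_intros C1_continuous'[OF g(1)] C1_continuous'[OF g(2)] c simp: o)+
    moreover have "(LINT z|lborel. ?A z) = 0" "(LINT z|lborel. ?B z) = 0"
      using P g unfolding perturbation_def by blast+
    ultimately have "(LINT z|lborel. ?A z + ?B z) = 0" by simp
    then show ?thesis by (simp add: algebra_simps)
  qed
  have mean: "(LINT x|lborel. V1 (t, x)) = 0" "(LINT x|lborel. V2 (t, x)) = 0"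
     "(LINT x|lborel. U11 (t, x)) = 0" "(LINT x|lborel. U22 (t, x)) = 0"
     "(LINT x|lborel. W1 (t, x)) = 0" "(LINT x|lborel. W2 (t, x)) = 0"
     "(LINT x|lborel. T11 (t, x)) = 0" "(LINT x|lborel. T22 (t, x)) = 0" for t
    using P unfolding perturbation_def by blast+
  show ?thesis
    unfolding perturbation_def using div mom by (simp add: i mean o continuous_on_add c)
qed

lemma perturbation_sum:
  assumes K: "bounded K" and fin: "finite I"
    and P: "\<And>i. i \<in> I \<Longrightarrow> perturbation K (V1 i) (V2 i) (U11 i) (U12 i) (U22 i)"
  shows "perturbation K (\<lambda>z. \<Sum>i\<in>I. V1 i z) (\<lambda>z. \<Sum>i\<in>I. V2 i z)
    (\<lambda>z. \<Sum>i\<in>I. U11 i z) (\<lambda>z. \<Sum>i\<in>I. U12 i z) (\<lambda>z. \<Sum>i\<in>I. U22 i z)"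
  using fin P
proof (induction I rule: finite_induct)
  case (insert i I)
  then show ?case using perturbation_add[OF K, of "V1 i" "V2 i" "U11 i" "U12 i" "U22 i"] by simp
qed (simp add: perturbation_zero)

text \<open>
  With \<open>f = a \<xi> \<Phi>\<close> and \<open>h = b \<Phi>\<close> the fields \<open>V = \<nabla>\<^sup>\<bottom> div f\<close> and
  \<open>U\<^sub>i\<^sub>j = - \<partial>\<^sub>t (\<partial>\<^sup>\<bottom>\<^sub>i f\<^sub>j + \<partial>\<^sup>\<bottom>\<^sub>j f\<^sub>i) + \<partial>\<^sup>\<bottom>\<^sub>i \<partial>\<^sup>\<bottom>\<^sub>j h\<close> satisfy \<open>div V = 0\<close> and \<open>\<partial>\<^sub>t V + div U = 0\<close> identically. They are
  combinations of the second derivatives \<open>H\<close> of the scalar potential \<open>\<Phi>\<close>; here \<open>\<xi> = (x1, x2)\<close>.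
\<close>

lemma wave_packet_field:
  fixes z0 k :: "real \<times> ('n::{finite,linorder}) rvec"
  assumes r: "r > 0" and N: "N \<noteq> 0"
  defines "H \<equiv> hpkt z0 r k N"
  shows "perturbation (ball z0 r)
    (\<lambda>z. - (a * (x1 * H z df dl + x2 * H z dl dl)))
    (\<lambda>z. a * (x1 * H z df df + x2 * H z df dl))
    (\<lambda>z. 2 * a * x1 * H z dt dl + b * H z dl dl)
    (\<lambda>z. a * x2 * H z dt dl - a * x1 * H z dt df - b * H z df dl)
    (\<lambda>z. - (2 * a * x2 * H z dt df) + b * H z df df)"
proof -
  have C: "C1 (\<lambda>z. dpkt z0 r k N z p) (\<lambda>z. H z p)" for p unfolding H_def by (rule C1_dpkt[OF N])
  have c: "continuous_on UNIV (\<lambda>z. H z p q)" for p q by (rule C1_continuous'[OF C])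
  have o: "H z p q = 0" "dpkt z0 r k N z p = 0" if "z \<notin> ball z0 r" for z p q
    using packet_outside[OF r, of z z0] that by (auto simp: H_def dist_commute)
  have sym: "H z p q = H z q p" for z p q unfolding H_def by (rule hpkt_commute)
  have K: "bounded (ball z0 r)" by simp
  define B where "B = norm z0 + r"
  have B: "z \<notin> ball z0 r" if "norm z > B" for z
    using that norm_triangle_sub[of z z0] by (auto simp: B_def dist_norm norm_minus_commute)
  have Bs: "(t, x) \<notin> ball z0 r" if "norm x > B" for t x
    using norm_snd_large[of z0 r x t] that by (auto simp: B_def dist_commute)
  \<comment> \<open>Each term of \<open>V\<close>, \<open>U11\<close> and \<open>U22\<close> is an
    \<open>H\<close> with a spatial direction in last place. It is thus a spatial derivative and has
    zero mean on every slice, even if its other direction is \<open>dt\<close>.\<close>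
  have mean: "(LINT x|lborel. H (t, x) p (0, q)) = 0" for t p q
    using integral_deriv_zero[OF C1_slice[OF C], of B] o Bs by blast
  have i: "integrable lborel (\<lambda>x. H (t, x) p q)" for t p q by (rule integrable_field(2)[OF c K o(1)])
  have mean': "(LINT x|lborel. H (t, x) p df) = 0" "(LINT x|lborel. H (t, x) p dl) = 0" for t p
    using mean by (auto simp: df_def dl_def)
  have div: "(LINT x|lborel. - (a * (x1 * H (t, x) df dl + x2 * H (t, x) dl dl)) * \<psi>' x ef
       + a * (x1 * H (t, x) df df + x2 * H (t, x) df dl) * \<psi>' x el) = 0"
    if \<psi>: "C1 \<psi> \<psi>'" for t \<psi> \<psi>'
  proof -
    \<comment> \<open>Tested form of the symmetry of third derivatives of the potential, which need
      not exist.\<close>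
    have swap: "(LINT x|lborel. H (t, x) p df * \<psi>' x el) = (LINT x|lborel. H (t, x) p dl * \<psi>' x ef)" for p
      using integral_swap_C1[OF C1_slice[OF C, of t p] \<psi>, of B ef el] o Bs by (auto simp: df_def dl_def)
    have ii: "integrable lborel (\<lambda>x. H (t, x) p q * \<psi>' x e)" for p q e
    proof -
      have "continuous_on UNIV (\<lambda>z. \<psi>' (snd z) e)"
        by (rule continuous_on_compose2[OF C1_continuous'[OF \<psi>], of UNIV snd]) (auto intro!: continuous_intros)
      then have "integrable lborel (\<lambda>x. (\<lambda>z. H z p q * \<psi>' (snd z) e) (t, x))"
        by (intro integrable_field(2)[OF _ K]) (auto intro!: continuous_intros c simp: o)
      then show ?thesis by simp
    qed
    have "(LINT x|lborel. - (a * (x1 * H (t, x) df dl + x2 * H (t, x) dl dl)) * \<psi>' x ef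
       + a * (x1 * H (t, x) df df + x2 * H (t, x) df dl) * \<psi>' x el)
      = (LINT x|lborel. (a * x1) * (H (t, x) df df * \<psi>' x el) - (a * x1) * (H (t, x) df dl * \<psi>' x ef)
         + (a * x2) * (H (t, x) dl df * \<psi>' x el) - (a * x2) * (H (t, x) dl dl * \<psi>' x ef))"
      by (intro Bochner_Integration.integral_cong refl) (simp add: sym[of _ dl df] algebra_simps)
    also have "\<dots> = 0" using ii swap[of df] swap[of dl] by simp
    finally show ?thesis .
  qed
  have mom: "(LINT z|lborel. - (a * (x1 * H z df dl + x2 * H z dl dl)) * g1' z dt
      + a * (x1 * H z df df + x2 * H z df dl) * g2' z dt
      + (2 * a * x1 * H z dt dl + b * H z dl dl) * g1' z df
      + (a * x2 * H z dt dl - a * x1 * H z dt df - b * H z df dl) * (g1' z dl + g2' z df)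
      + (- (2 * a * x2 * H z dt df) + b * H z df df) * g2' z dl) = 0"
    if g: "C1 g1 g1'" "C1 g2 g2'" for g1 g1' g2 g2'
  proof -
    \<comment> \<open>\<open>comm\<close> exchanges the first two directions and \<open>swap\<close>
      the last two, so \<open>J\<close> is symmetric in all three and the terms below
      cancel.\<close>
    define J where "J g p q e = (LINT z|lborel. H z p q * g z e)" for g :: "real \<times> 'n rvec \<Rightarrow> real \<times> 'n rvec \<Rightarrow> real" and p q e
    have swap: "J g1' p q e = J g1' p e q" "J g2' p q e = J g2' p e q" for p q e
      unfolding J_def
      by (rule integral_swap_C1[OF C g(1), of B]; use o B in blast)
         (rule integral_swap_C1[OF C g(2), of B]; use o B in blast)
    have comm: "J g p q e = J g q p e" for g p q e unfolding J_def by (simp add: sym[of _ p q])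
    have i1: "integrable lborel (\<lambda>z. H z p q * g1' z e)" "integrable lborel (\<lambda>z. H z p q * g2' z e)" for p q e
      by (rule integrable_field(1)[OF _ K];
          auto intro!: continuous_intros C1_continuous'[OF g(1)] C1_continuous'[OF g(2)] c simp: o)+
    have "(LINT z|lborel. - (a * (x1 * H z df dl + x2 * H z dl dl)) * g1' z dt
      + a * (x1 * H z df df + x2 * H z df dl) * g2' z dt
      + (2 * a * x1 * H z dt dl + b * H z dl dl) * g1' z df
      + (a * x2 * H z dt dl - a * x1 * H z dt df - b * H z df dl) * (g1' z dl + g2' z df)
      + (- (2 * a * x2 * H z dt df) + b * H z df df) * g2' z dl)
      = (LINT z|lborel. - (a * x1) * (H z df dl * g1' z dt) - (a * x2) * (H z dl dl * g1' z dt)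
      + (a * x1) * (H z df df * g2' z dt) + (a * x2) * (H z df dl * g2' z dt)
      + (2 * a * x1) * (H z dt dl * g1' z df) + b * (H z dl dl * g1' z df)
      + (a * x2) * (H z dt dl * g1' z dl) - (a * x1) * (H z dt df * g1' z dl) - b * (H z df dl * g1' z dl)
      + (a * x2) * (H z dt dl * g2' z df) - (a * x1) * (H z dt df * g2' z df) - b * (H z df dl * g2' z df)
      - (2 * a * x2) * (H z dt df * g2' z dl) + b * (H z df df * g2' z dl))"
      by (intro Bochner_Integration.integral_cong refl) (simp add: algebra_simps)
    also have "\<dots> = - (a * x1) * J g1' df dl dt - (a * x2) * J g1' dl dl dt
      + (a * x1) * J g2' df df dt + (a * x2) * J g2' df dl dt
      + (2 * a * x1) * J g1' dt dl df + b * J g1' dl dl df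
      + (a * x2) * J g1' dt dl dl - (a * x1) * J g1' dt df dl - b * J g1' df dl dl
      + (a * x2) * J g2' dt dl df - (a * x1) * J g2' dt df df - b * J g2' df dl df
      - (2 * a * x2) * J g2' dt df dl + b * J g2' df df dl"
      unfolding J_def by (simp add: i1)
    also have "\<dots> = 0"
    proof -
      have "J g1' dt dl df = J g1' df dl dt" "J g1' dt df dl = J g1' df dl dt"
           "J g1' dt dl dl = J g1' dl dl dt" "J g1' df dl dl = J g1' dl dl df"
           "J g2' dt df df = J g2' df df dt" "J g2' df dl df = J g2' df df dl"
           "J g2' dt dl df = J g2' df dl dt" "J g2' dt df dl = J g2' df dl dt"
        by (metis swap comm)+
      then show ?thesis by (simp add: algebra_simps)
    qed
    finally show ?thesis .
  qed
  show ?thesis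
    unfolding perturbation_def using div mom
    by (auto intro!: continuous_intros c simp: o i mean' Bochner_Integration.integral_diff)
qed

lemma abs_combination2:
  fixes x y :: real
  assumes "\<bar>x\<bar> \<le> d" "\<bar>y\<bar> \<le> d"
  shows "\<bar>c * x + c' * y\<bar> \<le> (\<bar>c\<bar> + \<bar>c'\<bar>) * d"
proof -
  have "\<bar>c * x + c' * y\<bar> \<le> \<bar>c\<bar> * \<bar>x\<bar> + \<bar>c'\<bar> * \<bar>y\<bar>"
    by (metis abs_mult abs_triangle_ineq)
  also have "\<dots> \<le> \<bar>c\<bar> * d + \<bar>c'\<bar> * d" using assms by (intro add_mono mult_left_mono) auto
  finally show ?thesis by (simp add: distrib_right)
qed

text \<open>
  The phase \<open>k\<close> is transported by the constant velocity \<open>(a1, a2)\<close> and its spatial part is orthogonal to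
  \<open>(m1, m2)\<close>; \<open>b\<close> is chosen such that \<open>U\<close> agrees with \<open>(a1, a2) \<otimes> V + V \<otimes> (a1, a2)\<close> to leading order.
\<close>

lemma wave_packet:
  fixes z0 :: "real \<times> ('n::{finite,linorder}) rvec" and a1 a2 m1 m2 :: real
  assumes n: "CARD('n) \<ge> 2" and r: "r > 0" and \<eta>: "\<eta> > 0" and m: "m1\<^sup>2 + m2\<^sup>2 > 0"
  obtains V1 V2 U11 U12 U22 cs where
    "perturbation (ball z0 r) V1 V2 U11 U12 U22"
    "\<And>z. \<bar>cs z\<bar> \<le> (1::real)"
    "\<And>z. \<bar>V1 z - cutoff z0 r z * cs z * m1\<bar> \<le> \<eta>" "\<And>z. \<bar>V2 z - cutoff z0 r z * cs z * m2\<bar> \<le> \<eta>"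
    "\<And>z. \<bar>U11 z - 2 * a1 * V1 z\<bar> \<le> \<eta>" "\<And>z. \<bar>U12 z - (a1 * V2 z + a2 * V1 z)\<bar> \<le> \<eta>"
    "\<And>z. \<bar>U22 z - 2 * a2 * V2 z\<bar> \<le> \<eta>"
    "\<And>t. (LINT x|lborel. (V1 (t, x))\<^sup>2 + (V2 (t, x))\<^sup>2)
        \<ge> (m1\<^sup>2 + m2\<^sup>2) / 2 * (LINT x|lborel. (cutoff z0 r (t, x))\<^sup>2) - \<eta>"
proof -
  note fl = frame_inner[OF first_neq_last[OF n]]
  define s where "s = m1\<^sup>2 + m2\<^sup>2"
  \<comment> \<open>The spatial part of the phase serves as \<xi>, so the divergence of f brings out
    |m|^2, which \<open>a\<close> cancels: \<open>V\<close> has leading amplitude m.\<close>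
  define a where "a = 1 / s"
  have s: "s > 0" using m by (simp add: s_def)
  have as: "a * s = 1" "a > 0" using s by (auto simp: a_def)
  define b where "b = 2 * a * (a1 * m1 + a2 * m2)"
  define c where "c = a1 * m2 - a2 * m1"
  define k where "k = (- c, m2 *\<^sub>R ef - m1 *\<^sub>R (el :: 'n rvec))"
  have kd: "k \<bullet> dt = - c" "k \<bullet> df = m2" "k \<bullet> dl = - m1"
    by (auto simp: k_def dt_def df_def dl_def inner_prod_def inner_diff_left fl)
  have sk: "snd k \<noteq> 0"
  proof
    assume "snd k = 0"
    then have "k \<bullet> df = 0" "k \<bullet> dl = 0" by (auto simp: df_def dl_def inner_prod_def)
    then show False using m kd by simp
  qed
  define is_bound where "is_bound p q B \<longleftrightarrow> B > 0 \<and> (\<forall>N z. N \<ge> 1 \<longrightarrow>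
    \<bar>hpkt z0 r k N z p q - cutoff z0 r z * cos (N * (k \<bullet> z)) * ((k \<bullet> p) * (k \<bullet> q))\<bar> \<le> B / N)" for p q B
  have "\<exists>B. is_bound p q B" for p q
    unfolding is_bound_def by (rule hpkt_leading[OF r, of z0 k p q]) blast
  then obtain Bf where Bf': "\<And>p q. is_bound p q (Bf p q)" by metis
  have Bf: "Bf p q > 0" "N \<ge> 1 \<Longrightarrow>
    \<bar>hpkt z0 r k N z p q - cutoff z0 r z * cos (N * (k \<bullet> z)) * ((k \<bullet> p) * (k \<bullet> q))\<bar> \<le> Bf p q / N" for p q N z
    using Bf'[of p q] by (auto simp only: is_bound_def)
  define Bh where "Bh = Bf df df + Bf df dl + Bf dl dl + Bf dt df + Bf dt dl"
  have "\<exists>Bo>0. \<forall>N t. N \<ge> 1 \<longrightarrow> (LINT x|lborel. (cutoff z0 r (t, x) * cos (N * (k \<bullet> (t, x))))\<^sup>2)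
      \<ge> (LINT x|lborel. (cutoff z0 r (t, x))\<^sup>2) / 2 - Bo / N"
    by (rule oscillation_average[OF r sk, of z0]) blast
  then obtain Bo where Bo: "Bo > 0" "\<And>N t. N \<ge> 1 \<Longrightarrow>
    (LINT x|lborel. (cutoff z0 r (t, x) * cos (N * (k \<bullet> (t, x))))\<^sup>2)
      \<ge> (LINT x|lborel. (cutoff z0 r (t, x))\<^sup>2) / 2 - Bo / N"
    by (elim exE conjE) simp
  \<comment> \<open>In units of \<delta> = \<open>Bh / N\<close>, \<open>P\<close> bounds the errors
    of \<open>V\<close>, \<open>G\<close> those of \<open>U\<close>, and \<open>M\<close> the mixed
    terms in the energy. \<open>Q\<close> collects all of them, so that a frequency N of size
    \<open>Q / \<eta>\<close> brings every error below \<eta>.\<close>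
  define P where "P = a * (\<bar>m1\<bar> + \<bar>m2\<bar>)"
  define G where "G = (2 + 2 * \<bar>a1\<bar> + 2 * \<bar>a2\<bar>) * P + \<bar>b\<bar>"
  define v where "v = measure lborel (cball (0::'n rvec) (norm z0 + r))"
  define M where "M = 2 * (\<bar>m1\<bar> + \<bar>m2\<bar>) * P"
  define Q where "Q = G * Bh + M * Bh * v + s * Bo"
  define N where "N = max 1 (Q / \<eta>)"
  have P: "P \<ge> 0" using as by (simp add: P_def)
  have Bh: "Bh > 0" unfolding Bh_def using Bf(1) by (intro add_pos_pos)
  have v: "v \<ge> 0" by (simp add: v_def)
  have M: "M \<ge> 0" using P by (simp add: M_def)
  have G: "G \<ge> 0" using P by (simp add: G_def)
  have N: "N \<ge> 1" "N \<noteq> 0" by (auto simp: N_def)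
  have "Q / \<eta> \<le> N" by (simp add: N_def)
  then have QN: "Q / N \<le> \<eta>" using \<eta> N by (simp add: field_simps)
  define H where "H = hpkt z0 r k N"
  define cs where "cs z = cos (N * (k \<bullet> z))" for z
  define X where "X z = cutoff z0 r z * cs z" for z
  define E where "E p q z = H z p q - X z * ((k \<bullet> p) * (k \<bullet> q))" for p q z
  define \<delta> where "\<delta> = Bh / N"
  have \<delta>: "\<delta> \<ge> 0" using Bh N by (simp add: \<delta>_def)
  have Ebf: "\<bar>E p q z\<bar> \<le> Bf p q / N" for p q z
    unfolding E_def H_def X_def cs_def by (rule Bf(2)[OF N(1)])
  note pos = Bf(1)[of df df] Bf(1)[of df dl] Bf(1)[of dl dl] Bf(1)[of dt df] Bf(1)[of dt dl]
  have E\<delta>: "\<bar>E p q z\<bar> \<le> \<delta>" if "Bf p q \<le> Bh" for p q z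
    unfolding \<delta>_def using order_trans[OF Ebf divide_right_mono[OF that]] N by simp
  have E: "\<bar>E df df z\<bar> \<le> \<delta>" "\<bar>E df dl z\<bar> \<le> \<delta>" "\<bar>E dl dl z\<bar> \<le> \<delta>" "\<bar>E dt df z\<bar> \<le> \<delta>" "\<bar>E dt dl z\<bar> \<le> \<delta>" for z
    by (rule E\<delta>, unfold Bh_def, use pos in linarith)+
  have H: "H z p q = X z * ((k \<bullet> p) * (k \<bullet> q)) + E p q z" for p q z by (simp add: E_def)
  define V1 where "V1 z = - (a * (m2 * H z df dl + (- m1) * H z dl dl))" for z
  define V2 where "V2 z = a * (m2 * H z df df + (- m1) * H z df dl)" for z
  define U11 where "U11 z = 2 * a * m2 * H z dt dl + b * H z dl dl" for z
  define U12 where "U12 z = a * (- m1) * H z dt dl - a * m2 * H z dt df - b * H z df dl" for z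
  define U22 where "U22 z = - (2 * a * (- m1) * H z dt df) + b * H z df df" for z
  define e1 where "e1 z = (- a * m2) * E df dl z + (a * m1) * E dl dl z" for z
  define e2 where "e2 z = (a * m2) * E df df z + (- a * m1) * E df dl z" for z
  have Pabs: "\<bar>a * m1\<bar> + \<bar>a * m2\<bar> = P" using as by (simp add: P_def abs_mult algebra_simps)
  then have Pabs': "\<bar>a * m2\<bar> + \<bar>a * m1\<bar> = P" by simp
  have e1: "\<bar>e1 z\<bar> \<le> P * \<delta>" for z
    unfolding e1_def using abs_combination2[OF E(2)[of z] E(3)[of z], of "- a * m2" "a * m1"] Pabs Pabs' by simp
  have e2: "\<bar>e2 z\<bar> \<le> P * \<delta>" for z
    unfolding e2_def using abs_combination2[OF E(1)[of z] E(2)[of z], of "a * m2" "- a * m1"] Pabs Pabs' by simp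
  have V1: "V1 z = X z * m1 + e1 z" for z
  proof -
    \<comment> \<open>Kept as a factor, \<open>a * s\<close> leaves a polynomial identity; its value
      1 enters afterwards.\<close>
    have "V1 z = (a * s) * (X z * m1) + e1 z"
      by (simp add: V1_def H kd e1_def s_def power2_eq_square algebra_simps)
    then show ?thesis using as by simp
  qed
  have V2: "V2 z = X z * m2 + e2 z" for z
  proof -
    have "V2 z = (a * s) * (X z * m2) + e2 z"
      by (simp add: V2_def H kd e2_def s_def power2_eq_square algebra_simps)
    then show ?thesis using as by simp
  qed
  have U11: "U11 z - 2 * a1 * V1 z = (2 * a * m2) * E dt dl z + b * E dl dl z - 2 * a1 * e1 z" for z
  proof -
    have "U11 z = (a * s) * (2 * a1 * (X z * m1)) + ((2 * a * m2) * E dt dl z + b * E dl dl z)"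
      by (simp add: U11_def H kd s_def b_def c_def power2_eq_square algebra_simps)
    then show ?thesis using as by (simp add: V1 algebra_simps)
  qed
  have U22: "U22 z - 2 * a2 * V2 z = (2 * a * m1) * E dt df z + b * E df df z - 2 * a2 * e2 z" for z
  proof -
    have "U22 z = (a * s) * (2 * a2 * (X z * m2)) + ((2 * a * m1) * E dt df z + b * E df df z)"
      by (simp add: U22_def H kd s_def b_def c_def power2_eq_square algebra_simps)
    then show ?thesis using as by (simp add: V2 algebra_simps)
  qed
  have U12: "U12 z - (a1 * V2 z + a2 * V1 z) = ((- a * m1) * E dt dl z + (- a * m2) * E dt df z)
      - b * E df dl z - a1 * e2 z - a2 * e1 z" for z
  proof -
    have "U12 z = (a * s) * (a1 * (X z * m2) + a2 * (X z * m1)) + ((- a * m1) * E dt dl z + (- a * m2) * E dt df z) - b * E df dl z"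
      by (simp add: U12_def H kd s_def b_def c_def power2_eq_square algebra_simps)
    then show ?thesis using as by (simp add: V1 V2 algebra_simps)
  qed
  have small: "x * \<delta> \<le> \<eta>" if "x \<le> G" for x
  proof -
    have "x * \<delta> \<le> G * \<delta>" using that \<delta> by (rule mult_right_mono)
    also have "\<dots> \<le> Q / N" unfolding \<delta>_def Q_def using M Bh v s Bo(1) N
      by (auto intro!: divide_right_mono)
    finally show ?thesis using QN by simp
  qed
  have X1: "\<bar>X z\<bar> \<le> 1" for z
    using mult_mono[of "\<bar>cutoff z0 r z\<bar>" 1 "\<bar>cs z\<bar>" 1] cutoff_01[of z0 r z] by (simp add: X_def cs_def abs_mult)
  have am: "\<bar>a * m1\<bar> \<le> P" "\<bar>a * m2\<bar> \<le> P" using Pabs by linarith+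
  have aP: "\<bar>a1\<bar> * P \<ge> 0" "\<bar>a2\<bar> * P \<ge> 0" using P by auto
  have per: "perturbation (ball z0 r) V1 V2 U11 U12 U22"
    unfolding V1_def[abs_def] V2_def[abs_def] U11_def[abs_def] U12_def[abs_def] U22_def[abs_def] H_def
    by (rule wave_packet_field[OF r N(2)])
  have G': "G = 2 * P + 2 * (\<bar>a1\<bar> * P) + 2 * (\<bar>a2\<bar> * P) + \<bar>b\<bar>" by (simp add: G_def algebra_simps)
  show ?thesis
  proof (rule that[OF per, of cs])
    show "\<bar>cs z\<bar> \<le> 1" for z by (simp add: cs_def)
    have PG: "P \<le> G" using P aP by (simp add: G_def algebra_simps)
    show "\<bar>V1 z - cutoff z0 r z * cs z * m1\<bar> \<le> \<eta>" for z
      using V1[of z] e1[of z] small[OF PG] by (simp add: X_def)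
    show "\<bar>V2 z - cutoff z0 r z * cs z * m2\<bar> \<le> \<eta>" for z
      using V2[of z] e2[of z] small[OF PG] by (simp add: X_def)
    show "\<bar>U11 z - 2 * a1 * V1 z\<bar> \<le> \<eta>" for z
    proof -
      have "\<bar>(2 * a * m2) * E dt dl z + b * E dl dl z\<bar> \<le> (2 * \<bar>a * m2\<bar> + \<bar>b\<bar>) * \<delta>"
        using abs_combination2[OF E(5)[of z] E(3)[of z], of "2 * a * m2" b] by (simp add: abs_mult mult.assoc)
      moreover have "\<bar>2 * a1 * e1 z\<bar> \<le> 2 * \<bar>a1\<bar> * (P * \<delta>)"
        using mult_left_mono[OF e1[of z], of "\<bar>a1\<bar>"] by (simp add: abs_mult)
      ultimately have "\<bar>U11 z - 2 * a1 * V1 z\<bar> \<le> (2 * \<bar>a * m2\<bar> + \<bar>b\<bar> + 2 * (\<bar>a1\<bar> * P)) * \<delta>"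
        unfolding U11 by (simp add: algebra_simps)
      also have "\<dots> \<le> \<eta>" by (rule small) (use am aP G' in linarith)
      finally show ?thesis .
    qed
    show "\<bar>U22 z - 2 * a2 * V2 z\<bar> \<le> \<eta>" for z
    proof -
      have "\<bar>(2 * a * m1) * E dt df z + b * E df df z\<bar> \<le> (2 * \<bar>a * m1\<bar> + \<bar>b\<bar>) * \<delta>"
        using abs_combination2[OF E(4)[of z] E(1)[of z], of "2 * a * m1" b] by (simp add: abs_mult mult.assoc)
      moreover have "\<bar>2 * a2 * e2 z\<bar> \<le> 2 * \<bar>a2\<bar> * (P * \<delta>)"
        using mult_left_mono[OF e2[of z], of "\<bar>a2\<bar>"] by (simp add: abs_mult)
      ultimately have "\<bar>U22 z - 2 * a2 * V2 z\<bar> \<le> (2 * \<bar>a * m1\<bar> + \<bar>b\<bar> + 2 * (\<bar>a2\<bar> * P)) * \<delta>"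
        unfolding U22 by (simp add: algebra_simps)
      also have "\<dots> \<le> \<eta>" by (rule small) (use am aP G' in linarith)
      finally show ?thesis .
    qed
    show "\<bar>U12 z - (a1 * V2 z + a2 * V1 z)\<bar> \<le> \<eta>" for z
    proof -
      have "\<bar>(- a * m1) * E dt dl z + (- a * m2) * E dt df z\<bar> \<le> P * \<delta>"
        using abs_combination2[OF E(5)[of z] E(4)[of z], of "- a * m1" "- a * m2"] Pabs Pabs' by simp
      moreover have "\<bar>b * E df dl z\<bar> \<le> \<bar>b\<bar> * \<delta>"
        using mult_left_mono[OF E(2)[of z], of "\<bar>b\<bar>"] by (simp add: abs_mult)
      moreover have "\<bar>a1 * e2 z\<bar> \<le> \<bar>a1\<bar> * (P * \<delta>)"
        using mult_left_mono[OF e2[of z], of "\<bar>a1\<bar>"] by (simp add: abs_mult)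
      moreover have "\<bar>a2 * e1 z\<bar> \<le> \<bar>a2\<bar> * (P * \<delta>)"
        using mult_left_mono[OF e1[of z], of "\<bar>a2\<bar>"] by (simp add: abs_mult)
      ultimately have "\<bar>U12 z - (a1 * V2 z + a2 * V1 z)\<bar> \<le> P * \<delta> + \<bar>b\<bar> * \<delta> + \<bar>a1\<bar> * (P * \<delta>) + \<bar>a2\<bar> * (P * \<delta>)"
        unfolding U12 by linarith
      also have "\<dots> = (P + \<bar>b\<bar> + \<bar>a1\<bar> * P + \<bar>a2\<bar> * P) * \<delta>" by (simp add: algebra_simps)
      also have "\<dots> \<le> \<eta>" by (rule small) (use P aP G' in linarith)
      finally show ?thesis .
    qed
    show "(LINT x|lborel. (V1 (t, x))\<^sup>2 + (V2 (t, x))\<^sup>2)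
        \<ge> (m1\<^sup>2 + m2\<^sup>2) / 2 * (LINT x|lborel. (cutoff z0 r (t, x))\<^sup>2) - \<eta>" for t
    proof -
      let ?I = "\<lambda>x. indicator (cball (0::'n rvec) (norm z0 + r)) x :: real"
      have cV: "continuous_on UNIV V1" "continuous_on UNIV V2"
        and oV: "\<And>z. z \<notin> ball z0 r \<Longrightarrow> V1 z = 0 \<and> V2 z = 0"
        using per unfolding perturbation_def by blast+
      have oX: "X z = 0" if "z \<notin> ball z0 r" for z
        using cutoff_outside(1)[OF r, of z z0] that by (auto simp: X_def dist_commute)
      have cX: "continuous_on UNIV X"
        unfolding X_def[abs_def] cs_def by (intro continuous_intros C1_continuous[OF C1_cutoff])
      have i1: "integrable lborel (\<lambda>x. (\<lambda>z. (V1 z)\<^sup>2 + (V2 z)\<^sup>2) (t, x))"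
        by (rule integrable_field(2)[of _ "ball z0 r"]) (use oV in \<open>auto intro!: continuous_intros cV\<close>)
      have i2: "integrable lborel (\<lambda>x. (\<lambda>z. (X z)\<^sup>2) (t, x))"
        by (rule integrable_field(2)[of _ "ball z0 r"]) (use oX in \<open>auto intro!: continuous_intros cX\<close>)
      have i3: "integrable lborel ?I"
        by (rule integrable_bounded_support[where M = 1 and B = "norm z0 + r"]) (auto simp: indicator_def)
      \<comment> \<open>The squared errors are nonnegative and dropped; only their products with
        \<open>X\<close> cost energy.\<close>
      have pt: "s * (X (t, x))\<^sup>2 - M * \<delta> * ?I x \<le> (V1 (t, x))\<^sup>2 + (V2 (t, x))\<^sup>2" for x
      proof (cases "(t, x) \<in> ball z0 r")
        case True
        have "x \<in> cball 0 (norm z0 + r)"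
          using norm_snd_large[of z0 r x t] True by (auto simp: dist_commute not_less[symmetric])
        then have 1: "?I x = 1" by simp
        let ?z = "(t, x)"
        have "\<bar>X ?z * m1 * e1 ?z\<bar> \<le> \<bar>m1\<bar> * (P * \<delta>)"
        proof -
          have "\<bar>X ?z\<bar> * \<bar>m1\<bar> * \<bar>e1 ?z\<bar> \<le> 1 * \<bar>m1\<bar> * (P * \<delta>)"
            using X1[of ?z] e1[of ?z] by (intro mult_mono) auto
          then show ?thesis by (simp add: abs_mult)
        qed
        moreover have "\<bar>X ?z * m2 * e2 ?z\<bar> \<le> \<bar>m2\<bar> * (P * \<delta>)"
        proof -
          have "\<bar>X ?z\<bar> * \<bar>m2\<bar> * \<bar>e2 ?z\<bar> \<le> 1 * \<bar>m2\<bar> * (P * \<delta>)"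
            using X1[of ?z] e2[of ?z] by (intro mult_mono) auto
          then show ?thesis by (simp add: abs_mult)
        qed
        ultimately have "\<bar>X ?z * m1 * e1 ?z\<bar> + \<bar>X ?z * m2 * e2 ?z\<bar> \<le> (\<bar>m1\<bar> + \<bar>m2\<bar>) * (P * \<delta>)"
          by (simp add: algebra_simps)
        then have "- (M * \<delta>) \<le> 2 * (X ?z * m1 * e1 ?z) + 2 * (X ?z * m2 * e2 ?z)"
          unfolding M_def by (simp add: algebra_simps)
        moreover have "(V1 ?z)\<^sup>2 + (V2 ?z)\<^sup>2 = s * (X ?z)\<^sup>2 + 2 * (X ?z * m1 * e1 ?z) + 2 * (X ?z * m2 * e2 ?z)
            + (e1 ?z)\<^sup>2 + (e2 ?z)\<^sup>2"
          by (simp add: V1 V2 s_def power2_eq_square algebra_simps)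
        ultimately show ?thesis unfolding 1 using zero_le_power2[of "e1 ?z"] zero_le_power2[of "e2 ?z"] by linarith
      next
        case False
        then show ?thesis using oV[OF False] oX[OF False] M \<delta> by (simp add: indicator_def)
      qed
      have "s * (LINT x|lborel. (X (t, x))\<^sup>2) - M * \<delta> * v = (LINT x|lborel. s * (X (t, x))\<^sup>2 - M * \<delta> * ?I x)"
        using i2 i3 by (simp add: v_def)
      also have "\<dots> \<le> (LINT x|lborel. (V1 (t, x))\<^sup>2 + (V2 (t, x))\<^sup>2)"
        using i1 i2 i3 pt by (intro integral_mono) auto
      finally have A: "s * (LINT x|lborel. (X (t, x))\<^sup>2) - M * \<delta> * v \<le> (LINT x|lborel. (V1 (t, x))\<^sup>2 + (V2 (t, x))\<^sup>2)" .
      have "s * (LINT x|lborel. (X (t, x))\<^sup>2) \<ge> s * ((LINT x|lborel. (cutoff z0 r (t, x))\<^sup>2) / 2 - Bo / N)"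
        using Bo(2)[OF N(1), of t] s by (intro mult_left_mono) (auto simp: X_def cs_def)
      moreover have "M * \<delta> * v + s * (Bo / N) \<le> \<eta>"
      proof -
        have "M * \<delta> * v + s * (Bo / N) \<le> Q / N"
          unfolding Q_def \<delta>_def using G Bh N by (simp add: add_divide_distrib algebra_simps)
        then show ?thesis using QN by simp
      qed
      moreover have "s * ((LINT x|lborel. (cutoff z0 r (t, x))\<^sup>2) / 2 - Bo / N)
          = s / 2 * (LINT x|lborel. (cutoff z0 r (t, x))\<^sup>2) - s * (Bo / N)" by (simp add: right_diff_distrib)
      ultimately show ?thesis using A unfolding s_def[symmetric] by linarith
    qed
  qed
qed

section \<open>One step of convex integration\<close>

definition quad :: "real \<Rightarrow> real \<Rightarrow> real \<Rightarrow> real \<Rightarrow> real \<Rightarrow> real" where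
  "quad a b c y1 y2 = a * y1\<^sup>2 + 2 * b * y1 * y2 + c * y2\<^sup>2"

text \<open>Sylvester's criterion for the matrix with rows (a, b) and (b, c).\<close>

definition posdef :: "real \<Rightarrow> real \<Rightarrow> real \<Rightarrow> bool" where
  "posdef a b c \<longleftrightarrow> a > 0 \<and> a * c - b\<^sup>2 > 0"

lemma posdef_pos: assumes "posdef a b c" shows "a > 0" "c > 0"
proof -
  show a: "a > 0" using assms by (simp add: posdef_def)
  have "a * c > 0" using assms zero_le_power2[of b] unfolding posdef_def by linarith
  then show "c > 0" using a by (simp add: zero_less_mult_iff)
qed

text \<open>By Cayley-Hamilton, \<open>tr R \<cdot> R - det R \<cdot> I = R\<^sup>2\<close>.\<close>

lemma posdef_lower:
  assumes "posdef a b c"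
  shows "(a * c - b\<^sup>2) / (a + c) * (y1\<^sup>2 + y2\<^sup>2) \<le> quad a b c y1 y2"
proof -
  have p: "a + c > 0" using posdef_pos[OF assms] by simp
  have "(a + c) * quad a b c y1 y2 - (a * c - b\<^sup>2) * (y1\<^sup>2 + y2\<^sup>2)
      = (a * y1 + b * y2)\<^sup>2 + (b * y1 + c * y2)\<^sup>2"
    by (simp add: quad_def power2_eq_square algebra_simps)
  then have "(a * c - b\<^sup>2) * (y1\<^sup>2 + y2\<^sup>2) \<le> (a + c) * quad a b c y1 y2"
    using zero_le_power2[of "a * y1 + b * y2"] zero_le_power2[of "b * y1 + c * y2"] by linarith
  then show ?thesis using p by (simp add: field_simps)
qed

lemma posdefI:
  assumes "\<rho> > 0" and q: "\<And>y1 y2. \<rho> * (y1\<^sup>2 + y2\<^sup>2) \<le> quad a b c y1 y2"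
  shows "posdef a b c"
proof -
  have a: "a > 0" using q[of 1 0] assms(1) by (simp add: quad_def)
  \<comment> \<open>The matrix maps (-b, a) to (0, det), so the form at this vector is
    \<open>a\<close> times the determinant.\<close>
  have "0 < \<rho> * ((- b)\<^sup>2 + a\<^sup>2)" using a assms(1) by (intro mult_pos_pos add_nonneg_pos) auto
  also have "\<dots> \<le> a * (a * c - b\<^sup>2)"
    using q[of "- b" a] by (simp add: quad_def power2_eq_square algebra_simps)
  finally show ?thesis using a by (simp add: posdef_def zero_less_mult_iff)
qed

text \<open>
  The largest multiple of a rank one matrix below \<open>R\<close>: for \<open>m = R e\<^sub>i / \<surd>R\<^sub>i\<^sub>i\<close> the Cauchy-Schwarz inequality of
  the form \<open>R\<close> gives \<open>m \<otimes> m \<le> R\<close>. Half of it is taken to keep the remainder positive.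
\<close>

lemma posdef_amplitude:
  assumes "posdef a b c"
  obtains m1 m2 where "\<And>y1 y2. (m1 * y1 + m2 * y2)\<^sup>2 \<le> quad a b c y1 y2 / 2" "m1\<^sup>2 + m2\<^sup>2 \<ge> (a + c) / 4"
proof -
  have aux: "(a / sqrt (2 * a) * y1 + b / sqrt (2 * a) * y2)\<^sup>2 \<le> quad a b c y1 y2 / 2"
    "(a / sqrt (2 * a))\<^sup>2 + (b / sqrt (2 * a))\<^sup>2 \<ge> a / 2" if "posdef a b c" for a b c y1 y2
  proof -
    have a: "a > 0" and d: "b\<^sup>2 \<le> a * c" using that by (auto simp: posdef_def)
    have "(a / sqrt (2 * a) * y1 + b / sqrt (2 * a) * y2)\<^sup>2 = (a * y1 + b * y2)\<^sup>2 / (2 * a)"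
    proof -
      have "a / sqrt (2 * a) * y1 + b / sqrt (2 * a) * y2 = (a * y1 + b * y2) / sqrt (2 * a)"
        by (simp add: add_divide_distrib)
      then show ?thesis using a by (simp add: power_divide)
    qed
    also have "(a * y1 + b * y2)\<^sup>2 \<le> a * quad a b c y1 y2"
    proof -
      have "a * quad a b c y1 y2 - (a * y1 + b * y2)\<^sup>2 = (a * c - b\<^sup>2) * y2\<^sup>2"
        by (simp add: quad_def power2_eq_square algebra_simps)
      also have "\<dots> \<ge> 0" using d by (intro mult_nonneg_nonneg) auto
      finally show ?thesis by simp
    qed
    finally show "(a / sqrt (2 * a) * y1 + b / sqrt (2 * a) * y2)\<^sup>2 \<le> quad a b c y1 y2 / 2"
      using a by (simp add: field_simps)
    have "(a / sqrt (2 * a))\<^sup>2 = a / 2" using a by (simp add: power_divide power2_eq_square)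
    then show "(a / sqrt (2 * a))\<^sup>2 + (b / sqrt (2 * a))\<^sup>2 \<ge> a / 2" by simp
  qed
  \<comment> \<open>The larger diagonal entry is at least half the trace, which gives |m|^2 \<ge> tr
    R / 4.\<close>
  show ?thesis
  proof (cases "a \<ge> c")
    case True
    show ?thesis
    proof (rule that[of "a / sqrt (2 * a)" "b / sqrt (2 * a)"])
      show "(a + c) / 4 \<le> (a / sqrt (2 * a))\<^sup>2 + (b / sqrt (2 * a))\<^sup>2"
        using aux(2)[OF assms] True by simp
    qed (rule aux(1)[OF assms])
  next
    case False
    have p: "posdef c b a" using assms posdef_pos[OF assms] by (simp add: posdef_def mult.commute)
    have q: "quad c b a y2 y1 = quad a b c y1 y2" for y1 y2 by (simp add: quad_def)
    show ?thesis
    proof (rule that[of "b / sqrt (2 * c)" "c / sqrt (2 * c)"])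
      show "(b / sqrt (2 * c) * y1 + c / sqrt (2 * c) * y2)\<^sup>2 \<le> quad a b c y1 y2 / 2" for y1 y2
        using aux(1)[OF p, of y2 y1] by (simp add: q add.commute)
      show "(a + c) / 4 \<le> (b / sqrt (2 * c))\<^sup>2 + (c / sqrt (2 * c))\<^sup>2"
        using aux(2)[OF p] False by simp
    qed
  qed
qed

lemma perturbed_quad_lower:
  fixes \<epsilon> M :: real
  assumes \<epsilon>: "0 \<le> \<epsilon>" "\<epsilon> \<le> 1" and M: "M \<ge> 1"
    and a: "\<bar>a - a0\<bar> \<le> \<epsilon>" and b: "\<bar>b - b0\<bar> \<le> \<epsilon>" and c: "\<bar>c - c0\<bar> \<le> \<epsilon>"
    and w: "\<bar>w1 - v1\<bar> \<le> \<epsilon>" "\<bar>w2 - v2\<bar> \<le> \<epsilon>"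
    and X: "\<bar>X\<bar> \<le> 1" and m: "\<bar>m1\<bar> \<le> M" "\<bar>m2\<bar> \<le> M"
    and V: "\<bar>V1 - X * m1\<bar> \<le> \<epsilon>" "\<bar>V2 - X * m2\<bar> \<le> \<epsilon>"
    and U: "\<bar>U11 - 2 * v1 * V1\<bar> \<le> \<epsilon>" "\<bar>U12 - (v1 * V2 + v2 * V1)\<bar> \<le> \<epsilon>" "\<bar>U22 - 2 * v2 * V2\<bar> \<le> \<epsilon>"
    and q0: "\<rho> * (y1\<^sup>2 + y2\<^sup>2) \<le> quad a0 b0 c0 y1 y2"
    and mq: "(m1 * y1 + m2 * y2)\<^sup>2 \<le> quad a0 b0 c0 y1 y2 / 2"
  shows "(\<rho> / 2 - 18 * M * \<epsilon>) * (y1\<^sup>2 + y2\<^sup>2)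
    \<le> quad (a - V1\<^sup>2 - (2 * w1 * V1 - U11)) (b - V1 * V2 - (w1 * V2 + w2 * V1 - U12))
        (c - V2\<^sup>2 - (2 * w2 * V2 - U22)) y1 y2"
proof -
  define Y where "Y = \<bar>y1\<bar> + \<bar>y2\<bar>"
  have Y: "Y \<ge> 0" by (simp add: Y_def)
  have lin: "\<bar>p * y1 + q * y2\<bar> \<le> \<gamma> * Y" if "\<bar>p\<bar> \<le> \<gamma>" "\<bar>q\<bar> \<le> \<gamma>" for p q \<gamma>
  proof -
    have "\<bar>p * y1 + q * y2\<bar> \<le> \<bar>p\<bar> * \<bar>y1\<bar> + \<bar>q\<bar> * \<bar>y2\<bar>" by (metis abs_mult abs_triangle_ineq)
    also have "\<dots> \<le> \<gamma> * \<bar>y1\<bar> + \<gamma> * \<bar>y2\<bar>" using that by (intro add_mono mult_right_mono) auto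
    finally show ?thesis by (simp add: Y_def distrib_left)
  qed
  have qd: "\<bar>quad p q s y1 y2\<bar> \<le> \<epsilon> * Y\<^sup>2" if "\<bar>p\<bar> \<le> \<epsilon>" "\<bar>q\<bar> \<le> \<epsilon>" "\<bar>s\<bar> \<le> \<epsilon>" for p q s
  proof -
    have "\<bar>quad p q s y1 y2\<bar> \<le> \<bar>p\<bar> * \<bar>y1\<bar>\<^sup>2 + 2 * (\<bar>q\<bar> * (\<bar>y1\<bar> * \<bar>y2\<bar>)) + \<bar>s\<bar> * \<bar>y2\<bar>\<^sup>2"
      unfolding quad_def by (intro order_trans[OF abs_triangle_ineq] add_mono) (auto simp: abs_mult)
    also have "\<dots> \<le> \<epsilon> * \<bar>y1\<bar>\<^sup>2 + 2 * (\<epsilon> * (\<bar>y1\<bar> * \<bar>y2\<bar>)) + \<epsilon> * \<bar>y2\<bar>\<^sup>2"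
      using that by (intro add_mono mult_left_mono mult_right_mono) auto
    also have "\<dots> = \<epsilon> * Y\<^sup>2" by (simp add: Y_def power2_eq_square algebra_simps)
    finally show ?thesis .
  qed
  define my where "my = m1 * y1 + m2 * y2"
  define Vy where "Vy = V1 * y1 + V2 * y2"
  define e where "e = (V1 - X * m1) * y1 + (V2 - X * m2) * y2"
  define d where "d = (w1 - v1) * y1 + (w2 - v2) * y2"
  have my: "\<bar>my\<bar> \<le> M * Y" unfolding my_def by (rule lin[OF m])
  have e: "\<bar>e\<bar> \<le> \<epsilon> * Y" unfolding e_def by (rule lin[OF V])
  have d: "\<bar>d\<bar> \<le> \<epsilon> * Y" unfolding d_def by (rule lin[OF w])
  have Vy: "Vy = X * my + e" by (simp add: Vy_def my_def e_def algebra_simps)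
  have Xmy: "\<bar>X * my\<bar> \<le> M * Y"
    using mult_mono[OF X my] by (simp add: abs_mult)
  have Vy1: "\<bar>Vy\<bar> \<le> (M + 1) * Y"
  proof -
    have "\<epsilon> * Y \<le> 1 * Y" using \<epsilon> Y by (intro mult_right_mono)
    then show ?thesis using Vy Xmy e by (simp add: distrib_right)
  qed
  have s1: "Vy\<^sup>2 \<le> my\<^sup>2 + (2 * M + 1) * \<epsilon> * Y\<^sup>2"
  proof -
    have "(X * my)\<^sup>2 \<le> my\<^sup>2"
    proof -
      have "X\<^sup>2 \<le> 1" using X by (simp add: abs_square_le_1)
      then have "X\<^sup>2 * my\<^sup>2 \<le> 1 * my\<^sup>2" by (intro mult_right_mono) auto
      then show ?thesis by (simp add: power_mult_distrib)
    qed
    moreover have "(X * my) * e \<le> (M * Y) * (\<epsilon> * Y)"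
    proof -
      have "\<bar>X * my\<bar> * \<bar>e\<bar> \<le> (M * Y) * (\<epsilon> * Y)" using mult_mono[OF Xmy e] Y M by simp
      then show ?thesis by (metis abs_ge_self abs_mult order_trans)
    qed
    moreover have "e\<^sup>2 \<le> \<epsilon> * Y\<^sup>2"
    proof -
      have "e\<^sup>2 \<le> (\<epsilon> * Y)\<^sup>2" using power_mono[OF e, of 2] by simp
      also have "\<dots> = \<epsilon> * (\<epsilon> * Y\<^sup>2)" by (simp add: power2_eq_square)
      also have "\<dots> \<le> 1 * (\<epsilon> * Y\<^sup>2)" using \<epsilon> by (intro mult_right_mono) auto
      finally show ?thesis by simp
    qed
    moreover have "Vy\<^sup>2 = (X * my)\<^sup>2 + 2 * ((X * my) * e) + e\<^sup>2"
      by (simp add: Vy power2_sum)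
    ultimately show ?thesis by (simp add: power2_eq_square algebra_simps)
  qed
  have s2: "2 * d * Vy \<le> (2 * M + 2) * \<epsilon> * Y\<^sup>2"
  proof -
    have "\<bar>d\<bar> * \<bar>Vy\<bar> \<le> (\<epsilon> * Y) * ((M + 1) * Y)" using mult_mono[OF d Vy1] \<epsilon> Y by simp
    then have "d * Vy \<le> (\<epsilon> * Y) * ((M + 1) * Y)" by (metis abs_ge_self abs_mult order_trans)
    then show ?thesis by (simp add: power2_eq_square algebra_simps)
  qed
  have s3: "quad (a - a0) (b - b0) (c - c0) y1 y2 \<ge> - (\<epsilon> * Y\<^sup>2)" using qd[OF a b c] by linarith
  have s4: "quad (U11 - 2 * v1 * V1) (U12 - (v1 * V2 + v2 * V1)) (U22 - 2 * v2 * V2) y1 y2 \<ge> - (\<epsilon> * Y\<^sup>2)"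
    using qd[OF U] by linarith
  have eq: "quad (a - V1\<^sup>2 - (2 * w1 * V1 - U11)) (b - V1 * V2 - (w1 * V2 + w2 * V1 - U12))
        (c - V2\<^sup>2 - (2 * w2 * V2 - U22)) y1 y2
     = quad a0 b0 c0 y1 y2 + quad (a - a0) (b - b0) (c - c0) y1 y2
       + quad (U11 - 2 * v1 * V1) (U12 - (v1 * V2 + v2 * V1)) (U22 - 2 * v2 * V2) y1 y2
       - Vy\<^sup>2 - 2 * d * Vy"
    by (simp add: quad_def d_def Vy_def power2_eq_square algebra_simps)
  have "Y\<^sup>2 \<le> 2 * (y1\<^sup>2 + y2\<^sup>2)"
    using sum_squares_bound[of "\<bar>y1\<bar>" "\<bar>y2\<bar>"] by (simp add: Y_def power2_sum)
  then have "(9 * M * \<epsilon>) * Y\<^sup>2 \<le> (9 * M * \<epsilon>) * (2 * (y1\<^sup>2 + y2\<^sup>2))" using M \<epsilon> by (intro mult_left_mono) auto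
  moreover have "5 * (\<epsilon> * Y\<^sup>2) \<le> 5 * M * (\<epsilon> * Y\<^sup>2)" using M \<epsilon> by (intro mult_right_mono) auto
  ultimately show ?thesis
    unfolding eq using s1 s2 s3 s4 q0 mq[folded my_def] by (simp add: algebra_simps)
qed

text \<open>
  The balls of radius \<open>1 / (4 K)\<close> around these points have overlapping time windows for consecutive \<open>l\<close>;
  the shift by half a cell for odd \<open>l\<close> keeps them disjoint.
\<close>

definition cell_centre :: "nat \<Rightarrow> nat \<Rightarrow> ('n \<Rightarrow> nat) \<Rightarrow> real \<times> ('n::{finite,linorder}) rvec" where
  "cell_centre K l k = (real l / (4 * real K), \<chi> i. (real (k i) + 1 / 4 + real (l mod 2) / 2) / real K)"

definition cell :: "nat \<Rightarrow> ('n \<Rightarrow> nat) \<Rightarrow> (('n::{finite,linorder}) rvec) set" where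
  "cell K k = cbox (\<chi> i. real (k i) / real K) (\<chi> i. (real (k i) + 1) / real K)"

definition cells :: "nat \<Rightarrow> ('n::finite \<Rightarrow> nat) set" where
  "cells K = {k. \<forall>i. k i < K}"

lemma finite_cells: "finite (cells K :: ('n::finite \<Rightarrow> nat) set)" and
  card_cells: "card (cells K :: ('n::finite \<Rightarrow> nat) set) = K ^ CARD('n)"
proof -
  have "(cells K :: ('n \<Rightarrow> nat) set) = PiE UNIV (\<lambda>_. {..<K})" by (auto simp: cells_def PiE_def)
  then show "finite (cells K :: ('n \<Rightarrow> nat) set)" "card (cells K :: ('n \<Rightarrow> nat) set) = K ^ CARD('n)"
    by (simp_all add: finite_PiE card_PiE)
qed

lemma real_mod_2_le: "real (l mod 2) \<le> 1"
  by (simp add: mod_2_eq_odd)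

lemma real_Suc_le: "a < b \<Longrightarrow> real a + 1 \<le> real b"
  using of_nat_mono[of "Suc a" b, where 'a = real] by simp

lemma abs_scale_less: "0 < c \<Longrightarrow> \<bar>x\<bar> < 1 / c \<Longrightarrow> \<bar>c * x\<bar> < (1::real)"
  by (simp add: abs_mult field_simps)

text \<open>Scaled by 2 K, the i-th coordinate lies in the unit interval that begins at the integer
  2 k_i + (l mod 2). Disjointness thus becomes a matter of integers.\<close>

lemma cell_ball:
  fixes x :: "('n::{finite,linorder}) rvec"
  assumes K: "K > 0" and z: "(t, x) \<in> ball (cell_centre K l k) (1 / (4 * real K))"
  shows "\<bar>4 * real K * t - real l\<bar> < 1"
    "2 * real (k i) + real (l mod 2) < 2 * real K * x $ i"
    "2 * real K * x $ i < 2 * real (k i) + real (l mod 2) + 1"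
proof -
  have d: "dist (cell_centre K l k) (t, x) < 1 / (4 * real K)" using z by simp
  have "dist (real l / (4 * real K)) t \<le> dist (cell_centre K l k) (t, x)"
    unfolding cell_centre_def dist_Pair_Pair by (simp add: real_le_rsqrt)
  then have "\<bar>real l / (4 * real K) - t\<bar> < 1 / (4 * real K)" using d by (simp add: dist_real_def)
  then have "\<bar>(4 * real K) * (real l / (4 * real K) - t)\<bar> < 1"
    using K by (intro abs_scale_less) auto
  then show "\<bar>4 * real K * t - real l\<bar> < 1" using K by (simp add: right_diff_distrib abs_minus_commute)
  have "dist (snd (cell_centre K l k)) x \<le> dist (cell_centre K l k) (t, x)"
    unfolding cell_centre_def dist_Pair_Pair by (simp add: real_le_rsqrt)
  moreover have "dist (snd (cell_centre K l k) $ i) (x $ i) \<le> dist (snd (cell_centre K l k)) x"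
    by (rule dist_vec_nth_le)
  ultimately have "\<bar>(real (k i) + 1 / 4 + real (l mod 2) / 2) / real K - x $ i\<bar> < 1 / (4 * real K)"
    using d by (simp add: cell_centre_def dist_real_def)
  then have "\<bar>(4 * real K) * ((real (k i) + 1 / 4 + real (l mod 2) / 2) / real K - x $ i)\<bar> < 1"
    using K by (intro abs_scale_less) auto
  moreover have "(4 * real K) * ((real (k i) + 1 / 4 + real (l mod 2) / 2) / real K - x $ i)
      = 4 * real (k i) + 1 + 2 * real (l mod 2) - 4 * real K * x $ i"
    using K by (simp add: right_diff_distrib)
  ultimately show "2 * real (k i) + real (l mod 2) < 2 * real K * x $ i"
    "2 * real K * x $ i < 2 * real (k i) + real (l mod 2) + 1" by linarith+
qed

text \<open>The integer part of 2 K x_i gives both k_i and the parity of l. The time windows leave l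
  and l' at distance at most 1, and equal parity excludes 1.\<close>

lemma cell_balls_disjoint:
  fixes z :: "real \<times> ('n::{finite,linorder}) rvec"
  assumes K: "K > 0" and "z \<in> ball (cell_centre K l k) (1 / (4 * real K))"
    "z \<in> ball (cell_centre K l' k') (1 / (4 * real K))"
  shows "l = l' \<and> k = k'"
proof -
  obtain t x where z: "z = (t, x)" by (cases z)
  note b = cell_ball[OF K assms(2)[unfolded z]] cell_ball[OF K assms(3)[unfolded z]]
  have eq: "2 * k i + l mod 2 = 2 * k' i + l' mod 2" for i
    using b(2,3,5,6)[of i] by linarith
  have par: "l mod 2 = l' mod 2"
    using arg_cong[OF eq[of undefined], of "\<lambda>n. n mod 2"] by simp
  then have "k = k'" using eq by auto
  moreover have "\<bar>real l - real l'\<bar> < 2" using b(1,4) by linarith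
  then have "l < l' + 2 \<and> l' < l + 2" by linarith
  then have "l = l'" using par by presburger
  ultimately show ?thesis by simp
qed

lemma cell_ball_space:
  fixes x :: "('n::{finite,linorder}) rvec"
  assumes K: "K > 0" and k: "k \<in> cells K" and z: "(t, x) \<in> ball (cell_centre K l k) (1 / (4 * real K))"
  shows "0 < x $ i" "x $ i < 1"
proof -
  note b = cell_ball(2,3)[OF K z, of i]
  have "0 < 2 * real K * x $ i" using b(1) by linarith
  then show "0 < x $ i" using K by (simp add: zero_less_mult_iff)
  have "2 * a + b + 1 \<le> 2 * (a + 1)" if "b \<le> 1" for a b :: real using that by simp
  from this[OF real_mod_2_le] have "2 * real (k i) + real (l mod 2) + 1 \<le> 2 * (real (k i) + 1)" .
  also have "\<dots> \<le> 2 * real K" using k real_Suc_le[of "k i" K] by (simp add: cells_def)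
  finally have "2 * real K * x $ i < 2 * real K * 1" using b(2) by linarith
  then show "x $ i < 1" using K by simp
qed

lemma norm_vec_le_card:
  fixes x :: "real ^ 'n"
  assumes "\<And>i. \<bar>x $ i\<bar> \<le> d" shows "norm x \<le> real CARD('n) * d"
proof -
  have "norm x \<le> (\<Sum>i\<in>UNIV. \<bar>x $ i\<bar>)" by (rule norm_le_l1_cart)
  also have "\<dots> \<le> (\<Sum>i\<in>(UNIV::'n set). d)" using assms by (intro sum_mono)
  finally show ?thesis by simp
qed

lemma cell_centre_near:
  fixes x :: "('n::{finite,linorder}) rvec"
  assumes K: "K > 0" and x: "x \<in> cell K k" and t: "\<bar>4 * real K * t - real l\<bar> \<le> 1"
  shows "dist (t, x) (cell_centre K l k) \<le> (real CARD('n) + 1) / real K"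
proof -
  note lm = real_mod_2_le[of l]
  have "\<bar>(x - snd (cell_centre K l k)) $ i\<bar> \<le> 1 / real K" for i
  proof -
    have "real (k i) / real K \<le> x $ i" "x $ i \<le> (real (k i) + 1) / real K"
      using x by (auto simp: cell_def mem_box_cart)
    moreover have "real (k i) / real K \<le> (real (k i) + 1 / 4 + real (l mod 2) / 2) / real K"
      "(real (k i) + 1 / 4 + real (l mod 2) / 2) / real K \<le> (real (k i) + 1) / real K"
      using K lm by (auto intro!: divide_right_mono)
    moreover have "(real (k i) + 1) / real K = real (k i) / real K + 1 / real K" by (simp add: add_divide_distrib)
    ultimately show ?thesis unfolding cell_centre_def by simp
  qed
  then have "norm (x - snd (cell_centre K l k)) \<le> real CARD('n) * (1 / real K)" by (rule norm_vec_le_card)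
  then have 1: "dist x (snd (cell_centre K l k)) \<le> real CARD('n) / real K" by (simp add: dist_norm)
  have "\<bar>t - real l / (4 * real K)\<bar> \<le> 1 / (4 * real K)"
  proof -
    have "\<bar>t - real l / (4 * real K)\<bar> = \<bar>4 * real K * t - real l\<bar> / (4 * real K)"
    proof -
      have "t - real l / (4 * real K) = (4 * real K * t - real l) / (4 * real K)"
        using K by (simp add: diff_divide_distrib)
      then show ?thesis by (simp add: abs_divide)
    qed
    then show ?thesis using t K by (simp add: divide_right_mono)
  qed
  also have "1 / (4 * real K) \<le> 1 / real K" using K by (simp add: field_simps)
  finally have 2: "dist t (fst (cell_centre K l k)) \<le> 1 / real K" by (simp add: cell_centre_def dist_real_def)
  have "dist (t, x) (cell_centre K l k) \<le> dist t (fst (cell_centre K l k)) + dist x (snd (cell_centre K l k))"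
    by (subst dist_prod_def) (simp add: sqrt_sum_squares_le_sum)
  also have "\<dots> \<le> 1 / real K + real CARD('n) / real K" using 1 2 by simp
  finally show ?thesis by (simp add: add_divide_distrib)
qed

lemma cell_ball_in_cell:
  fixes x :: "('n::{finite,linorder}) rvec"
  assumes K: "K > 0" and z: "(t, x) \<in> ball (cell_centre K l k) (1 / (4 * real K))"
  shows "x \<in> cell K k"
proof -
  have "real (k i) \<le> real K * x $ i \<and> real K * x $ i \<le> real (k i) + 1" for i
  proof -
    show ?thesis using cell_ball(2,3)[OF K z, of i] real_mod_2_le[of l] by linarith
  qed
  then show ?thesis using K by (auto simp: cell_def mem_box_cart field_simps)
qed

lemma measure_cell:
  assumes "K > 0"
  shows "measure lborel (cell K k :: ('n::{finite,linorder}) rvec set) = (1 / real K) ^ CARD('n)"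
proof -
  have "cell K k \<noteq> ({} :: 'n rvec set)"
    using assms by (auto simp: cell_def interval_ne_empty_cart divide_right_mono)
  then show ?thesis
    unfolding cell_def by (subst content_cbox_cart) (auto simp: diff_divide_distrib[symmetric])
qed

lemma cell_subset:
  assumes "K > 0" "k \<in> cells K"
  shows "cell K k \<subseteq> cbox 0 (1 :: ('n::{finite,linorder}) rvec)"
proof
  fix x :: "'n rvec" assume x: "x \<in> cell K k"
  have "0 \<le> x $ i \<and> x $ i \<le> 1" for i
  proof -
    have "real (k i) + 1 \<le> real K" using assms real_Suc_le[of "k i" K] by (simp add: cells_def)
    then have "(real (k i) + 1) / real K \<le> 1" using assms by simp
    moreover have "0 \<le> real (k i) / real K" by simp
    moreover have "real (k i) / real K \<le> x $ i" "x $ i \<le> (real (k i) + 1) / real K"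
      using x by (auto simp: cell_def mem_box_cart)
    ultimately show ?thesis by linarith
  qed
  then show "x \<in> cbox 0 1" by (simp add: mem_box_cart)
qed

lemma cells_cover:
  fixes x :: "('n::{finite,linorder}) rvec"
  assumes K: "K > 0" and x: "x \<in> cbox 0 1"
  shows "\<exists>k\<in>cells K. x \<in> cell K k"
proof -
  define k where "k i = min (K - 1) (nat \<lfloor>real K * x $ i\<rfloor>)" for i
  have "k i < K" for i using K by (auto simp: k_def min_def)
  moreover have "real (k i) / real K \<le> x $ i \<and> x $ i \<le> (real (k i) + 1) / real K" for i
  proof -
    have xi: "0 \<le> x $ i" "x $ i \<le> 1" using x by (auto simp: mem_box_cart)
    have "real (k i) \<le> real (nat \<lfloor>real K * x $ i\<rfloor>)" by (simp add: k_def)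
    also have "\<dots> \<le> real K * x $ i" using xi by (simp add: of_nat_nat)
    finally have 1: "real (k i) \<le> real K * x $ i" .
    have "real K * x $ i \<le> real (k i) + 1"
    proof (cases "K - 1 \<le> nat \<lfloor>real K * x $ i\<rfloor>")
      case True
      then have "real (k i) + 1 = real K" using K by (simp add: k_def of_nat_diff)
      moreover have "real K * x $ i \<le> real K * 1" using xi by (intro mult_left_mono) auto
      ultimately show ?thesis by simp
    next
      case False
      then have "k i = nat \<lfloor>real K * x $ i\<rfloor>" by (simp add: k_def)
      then show ?thesis using xi by (simp add: of_nat_nat)
    qed
    then show ?thesis using 1 K by (simp add: field_simps)
  qed
  ultimately show ?thesis by (intro bexI[of _ k]) (auto simp: cells_def cell_def mem_box_cart)
qed

text \<open>Within r / 2 of the centre in time and in space \<open>cut_arg\<close> is at least 1/2,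
  so the squared cutoff is at least 2^(-6). The spatial ball of radius r / 2 contains a cube of side
  r / d, whose volume is the other factor.\<close>

lemma cutoff_mass:
  fixes x0 :: "('n::{finite,linorder}) rvec"
  assumes r: "r > 0" and t: "\<bar>t - t0\<bar> \<le> r / 2"
  shows "(LINT x|lborel. (cutoff (t0, x0) r (t, x))\<^sup>2) \<ge> 1 / 64 * (r / real CARD('n)) ^ CARD('n)"
proof -
  define h where "h = r / (2 * real CARD('n))"
  have h: "h > 0" using r by (simp add: h_def)
  define Q where "Q = cbox (x0 - (\<chi> i. h)) (x0 + (\<chi> i. h))"
  have ne: "Q \<noteq> {}" using h by (auto simp: Q_def interval_ne_empty_cart)
  have mQ: "measure lborel Q = (r / real CARD('n)) ^ CARD('n)"
    using ne unfolding Q_def by (subst content_cbox_cart) (auto simp: h_def)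
  have low: "1 / 64 * indicator Q x \<le> (cutoff (t0, x0) r (t, x))\<^sup>2" for x
  proof (cases "x \<in> Q")
    case True
    then have "\<bar>(x - x0) $ i\<bar> \<le> h" for i by (auto simp: Q_def mem_box_cart abs_le_iff algebra_simps)
    then have "norm (x - x0) \<le> real CARD('n) * h" by (rule norm_vec_le_card)
    then have n: "norm (x - x0) \<le> r / 2" by (simp add: h_def)
    have "(norm (x - x0))\<^sup>2 \<le> (r / 2)\<^sup>2" using n by (intro power_mono) auto
    moreover have "(t - t0)\<^sup>2 \<le> (r / 2)\<^sup>2" using t by (metis abs_ge_zero power2_abs power_mono)
    ultimately have "((t, x) - (t0, x0)) \<bullet> ((t, x) - (t0, x0)) \<le> r\<^sup>2 / 2"
      by (simp add: inner_prod_def power2_norm_eq_inner[symmetric] power2_eq_square[symmetric] power_divide)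
    then have "(((t, x) - (t0, x0)) \<bullet> ((t, x) - (t0, x0))) / r\<^sup>2 \<le> 1 / 2"
      using r by (simp only: divide_le_eq) simp
    then have "1 / 2 \<le> cut_arg (t0, x0) r (t, x)" unfolding cut_arg_def by linarith
    then have "(1 / 2) ^ 3 \<le> cutoff (t0, x0) r (t, x)"
      unfolding cutoff_def by (intro power_mono) auto
    then have "((1 / 2) ^ 3)\<^sup>2 \<le> (cutoff (t0, x0) r (t, x))\<^sup>2" by (intro power_mono) auto
    then show ?thesis using True by (simp add: power_divide)
  qed simp
  have i1: "integrable lborel (\<lambda>x. 1 / 64 * indicator Q x :: real)"
    unfolding Q_def by (simp add: emeasure_lborel_cbox_eq)
  have i2: "integrable lborel (\<lambda>x. (\<lambda>z. (cutoff (t0, x0) r z)\<^sup>2) (t, x))"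
    by (rule integrable_field(2)[of _ "ball (t0, x0) r"])
      (auto intro!: continuous_intros C1_continuous[OF C1_cutoff] simp: cutoff_outside(1)[OF r] dist_commute)
  have "(LINT x|lborel. 1 / 64 * indicator Q x) \<le> (LINT x|lborel. (cutoff (t0, x0) r (t, x))\<^sup>2)"
    using i1 i2 low by (intro integral_mono) auto
  then show ?thesis using mQ by (simp add: Q_def)
qed

lemma uniform_modulus:
  fixes f :: "'a::metric_space \<Rightarrow> real"
  assumes "continuous_on UNIV f" "compact K" "\<epsilon> > 0"
  obtains d where "d > 0" "\<And>x y. x \<in> K \<Longrightarrow> y \<in> K \<Longrightarrow> dist x y < d \<Longrightarrow> \<bar>f x - f y\<bar> \<le> \<epsilon>"
proof -
  have "uniformly_continuous_on K f"
    using assms by (intro compact_uniformly_continuous) (auto intro: continuous_on_subset)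
  then obtain d where "d > 0" "\<And>x y. x \<in> K \<Longrightarrow> y \<in> K \<Longrightarrow> dist y x < d \<Longrightarrow> dist (f y) (f x) < \<epsilon>"
    using assms(3) unfolding uniformly_continuous_on_def by metis
  then show ?thesis by (intro that[of d]) (auto simp: dist_real_def less_imp_le)
qed

text \<open>
  The relative energy gain of a step: \<open>|m|\<^sup>2 / 2 \<ge> tr R / 8\<close> times the lower bound of \<open>cutoff_mass\<close> on a cell of unit size.
\<close>

definition gain :: "nat \<Rightarrow> real" where
  "gain n = (1 / 512) * (1 / (4 * real n)) ^ n"

lemma gain_bounds: "n > 0 \<Longrightarrow> 0 < gain n" "gain n \<le> 1"
proof -
  show "n > 0 \<Longrightarrow> 0 < gain n" by (simp add: gain_def)
  have "1 / (4 * real n) \<le> 1" by (cases n) (auto simp: divide_le_eq)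
  then have "(1 / (4 * real n)) ^ n \<le> 1" by (intro power_le_one) auto
  then show "gain n \<le> 1" by (simp add: gain_def)
qed

text \<open>The subtracted terms define the stress R' for which (w + V) \<otimes> (w + V) + R' = w
  \<otimes> w + R + U, so that the momentum equation persists. The data are frozen at the centre of
  each ball, and since the balls are disjoint, the quadratic terms of different packets never
  meet.\<close>

lemma convex_step:
  fixes w1 w2 R11 R12 R22 :: "('n::{finite,linorder}) field"
  assumes n: "CARD('n) \<ge> 2"
    and cw: "continuous_on UNIV w1" "continuous_on UNIV w2"
    and cR: "continuous_on UNIV R11" "continuous_on UNIV R12" "continuous_on UNIV R22"
    and pos: "\<And>t x. t > 0 \<Longrightarrow> posdef (R11 (t, x)) (R12 (t, x)) (R22 (t, x))"
    and \<tau>: "0 < \<tau>" "\<tau> \<le> L" and \<eta>: "\<eta> > 0"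
  obtains V1 V2 U11 U12 U22 where
    "perturbation ({\<tau> / 2..L + 1} \<times> box 0 1) V1 V2 U11 U12 U22"
    "\<And>t x. t > 0 \<Longrightarrow> posdef
        (R11 (t, x) - (V1 (t, x))\<^sup>2 - (2 * w1 (t, x) * V1 (t, x) - U11 (t, x)))
        (R12 (t, x) - V1 (t, x) * V2 (t, x) - (w1 (t, x) * V2 (t, x) + w2 (t, x) * V1 (t, x) - U12 (t, x)))
        (R22 (t, x) - (V2 (t, x))\<^sup>2 - (2 * w2 (t, x) * V2 (t, x) - U22 (t, x)))"
    "\<And>t. \<bar>LINT x|lborel. w1 (t, x) * V1 (t, x) + w2 (t, x) * V2 (t, x)\<bar> \<le> \<eta>"
    "\<And>t. \<tau> \<le> t \<Longrightarrow> t \<le> L \<Longrightarrow> (LINT x|lborel. (V1 (t, x))\<^sup>2 + (V2 (t, x))\<^sup>2)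
        \<ge> gain CARD('n) * (LINT x|lborel. indicator (cbox 0 1) x * (R11 (t, x) + R22 (t, x))) - \<eta>"
proof -
  \<comment> \<open>Starting at \<tau> / 2 leaves room for balls around centres slightly below
    \<tau>, yet stays away from t = 0, where \<open>R\<close> may degenerate.\<close>
  define Q where "Q = {\<tau> / 2..L + 1} \<times> (cbox 0 1 :: 'n rvec set)"
  define Q' where "Q' = {\<tau> / 2..L + 1} \<times> (box 0 1 :: 'n rvec set)"
  have Q'Q: "Q' \<subseteq> Q" using box_subset_cbox by (auto simp: Q_def Q'_def)
  have compQ: "compact Q" unfolding Q_def by (intro compact_Times) auto
  have bQ: "bounded Q" "bounded Q'" using compact_imp_bounded[OF compQ] Q'Q bounded_subset by blast+
  have "(\<tau>, 0) \<in> Q" using \<tau> by (auto simp: Q_def mem_box_cart)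
  then have neQ: "Q \<noteq> {}" by auto
  have posQ: "posdef (R11 z) (R12 z) (R22 z)" if "z \<in> Q" for z
    using pos[of "fst z" "snd z"] that \<tau> by (cases z) (auto simp: Q_def)
  have trQ: "R11 z + R22 z > 0" if "z \<in> Q" for z using posdef_pos[OF posQ[OF that]] by simp
  have cQ: "continuous_on Q R11" "continuous_on Q R12" "continuous_on Q R22"
    using cR continuous_on_subset by blast+
  have "\<forall>z\<in>Q. R11 z + R22 z \<noteq> 0" using trQ by (metis less_irrefl)
  then have cq: "continuous_on Q (\<lambda>z. (R11 z * R22 z - (R12 z)\<^sup>2) / (R11 z + R22 z))"
    by (intro continuous_on_divide continuous_on_diff continuous_on_mult continuous_on_add continuous_on_power cQ)
  \<comment> \<open>det / tr is a continuous lower bound for the least eigenvalue, so its minimum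
    over the compact set is a uniform positive bound.\<close>
  obtain zm where zm: "zm \<in> Q" "\<And>z. z \<in> Q \<Longrightarrow>
      (R11 zm * R22 zm - (R12 zm)\<^sup>2) / (R11 zm + R22 zm) \<le> (R11 z * R22 z - (R12 z)\<^sup>2) / (R11 z + R22 z)"
    using continuous_attains_inf[OF compQ neQ cq] by blast
  define \<rho> where "\<rho> = (R11 zm * R22 zm - (R12 zm)\<^sup>2) / (R11 zm + R22 zm)"
  have \<rho>: "\<rho> > 0" using posQ[OF zm(1)] trQ[OF zm(1)] by (simp add: \<rho>_def posdef_def)
  have low: "\<rho> * (y1\<^sup>2 + y2\<^sup>2) \<le> quad (R11 z) (R12 z) (R22 z) y1 y2" if "z \<in> Q" for z y1 y2
    using order_trans[OF mult_right_mono[OF zm(2)[OF that], of "y1\<^sup>2 + y2\<^sup>2"] posdef_lower[OF posQ[OF that]]]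
    by (simp add: \<rho>_def)
  obtain B where B: "\<And>z. z \<in> Q \<Longrightarrow> norm z \<le> B" using bQ(1) bounded_iff by metis
  obtain M1 where M1: "M1 > 0" "\<And>z. norm z \<le> B \<Longrightarrow> \<bar>R11 z\<bar> \<le> M1"
    using continuous_bounded_on_ball[OF cR(1)] by metis
  obtain M2 where M2: "M2 > 0" "\<And>z. norm z \<le> B \<Longrightarrow> \<bar>R22 z\<bar> \<le> M2"
    using continuous_bounded_on_ball[OF cR(3)] by metis
  define M where "M = M1 + M2 + 1"
  have M: "M \<ge> 1" using M1(1) M2(1) by (simp add: M_def)
  have RM: "R11 z \<le> M" "R22 z \<le> M" if "z \<in> Q" for z
    using M1(1) M1(2)[OF B[OF that]] M2(1) M2(2)[OF B[OF that]] unfolding M_def by linarith+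
  \<comment> \<open>The loss 18 M \<epsilon> of \<open>perturbed_quad_lower\<close> becomes at most
    \<rho> / 4, so \<rho> / 4 of the bound \<rho> / 2 remains. The last entry makes the cross term 4
    M \<epsilon> at most \<eta>.\<close>
  define \<epsilon> where "\<epsilon> = min 1 (min (\<rho> / (72 * M)) (\<eta> / (4 * M)))"
  have \<epsilon>: "\<epsilon> > 0" "\<epsilon> \<le> 1" using \<rho> \<eta> M by (auto simp: \<epsilon>_def)
  have \<epsilon>\<rho>: "18 * M * \<epsilon> \<le> \<rho> / 4"
  proof -
    have "\<epsilon> \<le> \<rho> / (72 * M)" by (simp add: \<epsilon>_def)
    then show ?thesis using M by (simp add: field_simps)
  qed
  have \<epsilon>\<eta>: "4 * M * \<epsilon> \<le> \<eta>"
  proof -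
    have "\<epsilon> \<le> \<eta> / (4 * M)" by (simp add: \<epsilon>_def)
    then show ?thesis using M by (simp add: field_simps)
  qed
  have "1 * (4 * \<epsilon>) \<le> M * (4 * \<epsilon>)" using M \<epsilon> by (intro mult_right_mono) auto
  then have \<epsilon>4: "4 * \<epsilon> \<le> \<eta>" using \<epsilon>\<eta> by (simp add: mult_ac)
  obtain d1 where d1: "d1 > 0" "\<And>x y. x \<in> Q \<Longrightarrow> y \<in> Q \<Longrightarrow> dist x y < d1 \<Longrightarrow> \<bar>w1 x - w1 y\<bar> \<le> \<epsilon>"
    using uniform_modulus[OF cw(1) compQ \<epsilon>(1)] by metis
  obtain d2 where d2: "d2 > 0" "\<And>x y. x \<in> Q \<Longrightarrow> y \<in> Q \<Longrightarrow> dist x y < d2 \<Longrightarrow> \<bar>w2 x - w2 y\<bar> \<le> \<epsilon>"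
    using uniform_modulus[OF cw(2) compQ \<epsilon>(1)] by metis
  obtain d3 where d3: "d3 > 0" "\<And>x y. x \<in> Q \<Longrightarrow> y \<in> Q \<Longrightarrow> dist x y < d3 \<Longrightarrow> \<bar>R11 x - R11 y\<bar> \<le> \<epsilon>"
    using uniform_modulus[OF cR(1) compQ \<epsilon>(1)] by metis
  obtain d4 where d4: "d4 > 0" "\<And>x y. x \<in> Q \<Longrightarrow> y \<in> Q \<Longrightarrow> dist x y < d4 \<Longrightarrow> \<bar>R12 x - R12 y\<bar> \<le> \<epsilon>"
    using uniform_modulus[OF cR(2) compQ \<epsilon>(1)] by metis
  obtain d5 where d5: "d5 > 0" "\<And>x y. x \<in> Q \<Longrightarrow> y \<in> Q \<Longrightarrow> dist x y < d5 \<Longrightarrow> \<bar>R22 x - R22 y\<bar> \<le> \<epsilon>"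
    using uniform_modulus[OF cR(3) compQ \<epsilon>(1)] by metis
  define d where "d = min d1 (min d2 (min d3 (min d4 d5)))"
  have d: "d > 0" using d1 d2 d3 d4 d5 by (simp add: d_def)
  \<comment> \<open>The first summand brings every point of a cell within the modulus
    \<open>d\<close> of its centre, the second makes the radius 1 / (4 K) at most \<tau> /
    4.\<close>
  obtain K where K': "real K > (real CARD('n) + 1) / d + 1 / \<tau> + 1" using reals_Archimedean2 by blast
  have p1: "(real CARD('n) + 1) / d > 0" "1 / \<tau> > 0" using d \<tau> by (auto intro!: divide_pos_pos)
  have K: "K > 0" using K' p1 by (cases K) auto
  define r where "r = 1 / (4 * real K)"
  have r: "r > 0" using K by (simp add: r_def)
  have Kd: "(real CARD('n) + 1) / real K < d"
  proof -
    have "(real CARD('n) + 1) / d < real K" using K' p1 by linarith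
    then show ?thesis using d K by (simp add: field_simps)
  qed
  have r\<tau>: "r \<le> \<tau> / 4"
  proof -
    have "1 / \<tau> < real K" using K' p1 by linarith
    then show ?thesis using \<tau> K by (simp add: r_def field_simps)
  qed
  have r2: "r \<le> 1 / 2"
    using K by (simp add: r_def field_simps)
  have rK: "4 * real K * (real l * r) = real l" for l using K by (simp add: r_def)
  \<comment> \<open>The margin r on both sides admits the layer nearest to any time in [\<tau>, L];
    the balls still stay inside \<open>Q'\<close>.\<close>
  define Ls where "Ls = {l :: nat. \<tau> - r \<le> real l * r \<and> real l * r \<le> L + r}"
  have "Ls \<subseteq> {..nat \<lceil>(L + r) / r\<rceil>}"
  proof
    fix l assume "l \<in> Ls"
    then have "real l \<le> (L + r) / r" using r by (simp add: Ls_def field_simps)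
    then show "l \<in> {..nat \<lceil>(L + r) / r\<rceil>}" by simp linarith
  qed
  then have finL: "finite Ls" using finite_subset by blast
  define I where "I = Ls \<times> (cells K :: ('n \<Rightarrow> nat) set)"
  have finI: "finite I" using finL by (simp add: I_def finite_cells)
  define zc :: "nat \<times> ('n \<Rightarrow> nat) \<Rightarrow> real \<times> 'n rvec" where "zc c = cell_centre K (fst c) (snd c)" for c
  have zc_fst: "fst (zc c) = real (fst c) * r" for c by (simp add: zc_def cell_centre_def r_def)
  have ball_Q': "z \<in> Q'" if c: "c \<in> I" and z: "z \<in> ball (zc c) r" for c z
  proof -
    obtain t x where zt: "z = (t, x)" by (cases z)
    have zb: "(t, x) \<in> ball (cell_centre K (fst c) (snd c)) (1 / (4 * real K))"
      using z by (simp add: zt zc_def r_def)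
    have k: "snd c \<in> cells K" and l: "\<tau> - r \<le> real (fst c) * r" "real (fst c) * r \<le> L + r"
      using c by (auto simp: I_def Ls_def)
    have "dist (fst (zc c)) (fst z) \<le> dist (zc c) z" by (rule dist_fst_le)
    then have "\<bar>real (fst c) * r - t\<bar> < r" using z by (simp add: zc_fst zt dist_real_def)
    then have "\<tau> / 2 \<le> t \<and> t \<le> L + 1" using l r\<tau> r2 by linarith
    moreover have "x \<in> box 0 1" using cell_ball_space[OF K k zb] by (simp add: mem_box_cart)
    ultimately show ?thesis by (simp add: Q'_def zt)
  qed
  have zcQ: "zc c \<in> Q" if "c \<in> I" for c using ball_Q'[OF that, of "zc c"] r Q'Q by auto
  have near: "dist z (zc c) < d" if z: "z \<in> ball (zc c) r" for c z
  proof -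
    obtain t x where zt: "z = (t, x)" by (cases z)
    have zb: "(t, x) \<in> ball (cell_centre K (fst c) (snd c)) (1 / (4 * real K))"
      using z by (simp add: zt zc_def r_def)
    have "dist (t, x) (cell_centre K (fst c) (snd c)) \<le> (real CARD('n) + 1) / real K"
      by (rule cell_centre_near[OF K cell_ball_in_cell[OF K zb]]) (use cell_ball(1)[OF K zb] in linarith)
    then show ?thesis using Kd by (simp add: zt zc_def)
  qed
  have disj: "c = c'" if "z \<in> ball (zc c) r" "z \<in> ball (zc c') r" for z c c'
    using cell_balls_disjoint[OF K, of z "fst c" "snd c" "fst c'" "snd c'"] that
    by (auto simp: zc_def r_def prod_eq_iff)
  \<comment> \<open>The energy errors of all cells of a layer are added up, hence the division by
    the number of cells.\<close>
  define \<epsilon>' where "\<epsilon>' = min \<epsilon> (\<eta> / (2 * real K ^ CARD('n)))"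
  have \<epsilon>': "\<epsilon>' > 0" "\<epsilon>' \<le> \<epsilon>" using \<epsilon> \<eta> K by (auto simp: \<epsilon>'_def)
  have \<epsilon>'K: "real K ^ CARD('n) * \<epsilon>' \<le> \<eta> / 2"
  proof -
    have "\<epsilon>' \<le> \<eta> / (2 * real K ^ CARD('n))" by (simp add: \<epsilon>'_def)
    then show ?thesis using K by (simp add: field_simps)
  qed
  define good where "good c V1 V2 U11 U12 U22 m1 m2 cs \<longleftrightarrow>
      perturbation (ball (zc c) r) V1 V2 U11 U12 U22 \<and>
      (\<forall>z. \<bar>cs z\<bar> \<le> (1::real)) \<and>
      (\<forall>z. \<bar>V1 z - cutoff (zc c) r z * cs z * m1\<bar> \<le> \<epsilon>') \<and> (\<forall>z. \<bar>V2 z - cutoff (zc c) r z * cs z * m2\<bar> \<le> \<epsilon>') \<and>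
      (\<forall>z. \<bar>U11 z - 2 * w1 (zc c) * V1 z\<bar> \<le> \<epsilon>') \<and>
      (\<forall>z. \<bar>U12 z - (w1 (zc c) * V2 z + w2 (zc c) * V1 z)\<bar> \<le> \<epsilon>') \<and>
      (\<forall>z. \<bar>U22 z - 2 * w2 (zc c) * V2 z\<bar> \<le> \<epsilon>') \<and>
      (\<forall>t. (LINT x|lborel. (V1 (t, x))\<^sup>2 + (V2 (t, x))\<^sup>2)
        \<ge> (m1\<^sup>2 + m2\<^sup>2) / 2 * (LINT x|lborel. (cutoff (zc c) r (t, x))\<^sup>2) - \<epsilon>') \<and>
      (\<forall>y1 y2. (m1 * y1 + m2 * y2)\<^sup>2 \<le> quad (R11 (zc c)) (R12 (zc c)) (R22 (zc c)) y1 y2 / 2) \<and>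
      m1\<^sup>2 + m2\<^sup>2 \<ge> (R11 (zc c) + R22 (zc c)) / 4"
    for c :: "nat \<times> ('n \<Rightarrow> nat)" and V1 V2 U11 U12 U22 cs :: "'n field" and m1 m2 :: real
  have "\<exists>V1 V2 U11 U12 U22 m1 m2 cs. good c V1 V2 U11 U12 U22 m1 m2 cs" if c: "c \<in> I" for c
  proof -
    obtain m1 m2 where m: "\<And>y1 y2. (m1 * y1 + m2 * y2)\<^sup>2 \<le> quad (R11 (zc c)) (R12 (zc c)) (R22 (zc c)) y1 y2 / 2"
      "m1\<^sup>2 + m2\<^sup>2 \<ge> (R11 (zc c) + R22 (zc c)) / 4"
      using posdef_amplitude[OF posQ[OF zcQ[OF c]]] by metis
    have "m1\<^sup>2 + m2\<^sup>2 > 0" using trQ[OF zcQ[OF c]] by (intro less_le_trans[OF _ m(2)]) simp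
    then show ?thesis
      by (rule wave_packet[OF n r \<epsilon>'(1), where ?a1.0 = "w1 (zc c)" and ?a2.0 = "w2 (zc c)" and ?z0.0 = "zc c"])
        (use m in \<open>unfold good_def, blast\<close>)
  qed
  then obtain V1 V2 U11 U12 U22 m1 m2 cs where good:
    "\<And>c. c \<in> I \<Longrightarrow> good c (V1 c) (V2 c) (U11 c) (U12 c) (U22 c) (m1 c) (m2 c) (cs c)"
    by metis
  have per: "perturbation (ball (zc c) r) (V1 c) (V2 c) (U11 c) (U12 c) (U22 c)" if "c \<in> I" for c
    using good[OF that] unfolding good_def by blast
  have csb: "\<bar>cs c z\<bar> \<le> 1" if "c \<in> I" for c z using good[OF that] unfolding good_def by blast
  have Vb: "\<bar>V1 c z - cutoff (zc c) r z * cs c z * m1 c\<bar> \<le> \<epsilon>" "\<bar>V2 c z - cutoff (zc c) r z * cs c z * m2 c\<bar> \<le> \<epsilon>"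
    if "c \<in> I" for c z
    using good[OF that] \<epsilon>'(2) unfolding good_def by (meson order_trans)+
  have Ub: "\<bar>U11 c z - 2 * w1 (zc c) * V1 c z\<bar> \<le> \<epsilon>"
     "\<bar>U12 c z - (w1 (zc c) * V2 c z + w2 (zc c) * V1 c z)\<bar> \<le> \<epsilon>"
     "\<bar>U22 c z - 2 * w2 (zc c) * V2 c z\<bar> \<le> \<epsilon>" if "c \<in> I" for c z
    using good[OF that] \<epsilon>'(2) unfolding good_def by (meson order_trans)+
  have en: "(LINT x|lborel. (V1 c (t, x))\<^sup>2 + (V2 c (t, x))\<^sup>2)
        \<ge> ((m1 c)\<^sup>2 + (m2 c)\<^sup>2) / 2 * (LINT x|lborel. (cutoff (zc c) r (t, x))\<^sup>2) - \<epsilon>'" if "c \<in> I" for c t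
    using good[OF that] unfolding good_def by blast
  have mq: "(m1 c * y1 + m2 c * y2)\<^sup>2 \<le> quad (R11 (zc c)) (R12 (zc c)) (R22 (zc c)) y1 y2 / 2"
    if "c \<in> I" for c y1 y2 using good[OF that] unfolding good_def by blast
  have mt: "(m1 c)\<^sup>2 + (m2 c)\<^sup>2 \<ge> (R11 (zc c) + R22 (zc c)) / 4" if "c \<in> I" for c
    using good[OF that] unfolding good_def by blast
  have sqM: "\<bar>x\<bar> \<le> M" if "x\<^sup>2 \<le> M / 2" for x
  proof -
    have "M / 2 \<le> M * M" using mult_mono[of 1 M 1 M] M by simp
    then have "x\<^sup>2 \<le> M\<^sup>2" using that by (simp add: power2_eq_square)
    then show ?thesis using M by (simp add: abs_le_square_iff[symmetric])
  qed
  have mM: "\<bar>m1 c\<bar> \<le> M" "\<bar>m2 c\<bar> \<le> M" if "c \<in> I" for c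
  proof -
    have "(m1 c)\<^sup>2 \<le> M / 2" using mq[OF that, of 1 0] RM(1)[OF zcQ[OF that]] by (simp add: quad_def)
    then show "\<bar>m1 c\<bar> \<le> M" by (rule sqM)
    have "(m2 c)\<^sup>2 \<le> M / 2" using mq[OF that, of 0 1] RM(2)[OF zcQ[OF that]] by (simp add: quad_def)
    then show "\<bar>m2 c\<bar> \<le> M" by (rule sqM)
  qed
  have cX: "\<bar>cutoff (zc c) r z * cs c z\<bar> \<le> 1" if "c \<in> I" for c z
    using mult_mono[of "\<bar>cutoff (zc c) r z\<bar>" 1 "\<bar>cs c z\<bar>" 1] csb[OF that, of z] cutoff_01[of "zc c" r z]
    by (simp add: abs_mult)
  have out: "V1 c z = 0 \<and> V2 c z = 0 \<and> U11 c z = 0 \<and> U12 c z = 0 \<and> U22 c z = 0"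
    if "c \<in> I" "z \<notin> ball (zc c) r" for c z
    using per[OF that(1)] that(2) unfolding perturbation_def by blast
  define W1 where "W1 z = (\<Sum>c\<in>I. V1 c z)" for z
  define W2 where "W2 z = (\<Sum>c\<in>I. V2 c z)" for z
  define T11 where "T11 z = (\<Sum>c\<in>I. U11 c z)" for z
  define T12 where "T12 z = (\<Sum>c\<in>I. U12 c z)" for z
  define T22 where "T22 z = (\<Sum>c\<in>I. U22 c z)" for z
  have perW: "perturbation Q' W1 W2 T11 T12 T22"
    unfolding W1_def[abs_def] W2_def[abs_def] T11_def[abs_def] T12_def[abs_def] T22_def[abs_def]
    using ball_Q' by (intro perturbation_sum[OF bQ(2) finI] perturbation_mono[OF per]) auto
  have single: "(\<Sum>c'\<in>I. f c') = f c" if "c \<in> I" "z \<in> ball (zc c) r"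
      "\<And>c'. c' \<in> I \<Longrightarrow> z \<notin> ball (zc c') r \<Longrightarrow> f c' = 0" for f :: "nat \<times> ('n \<Rightarrow> nat) \<Rightarrow> real" and c z
  proof -
    have "(\<Sum>c'\<in>I. f c') = (\<Sum>c'\<in>I. if c' = c then f c else 0)"
    proof (rule sum.cong[OF refl])
      fix c' assume c': "c' \<in> I"
      show "f c' = (if c' = c then f c else 0)"
      proof (cases "c' = c")
        case False
        then have "z \<notin> ball (zc c') r" using disj[OF that(2), of c'] by blast
        then show ?thesis using that(3)[OF c'] False by simp
      qed simp
    qed
    then show ?thesis using that(1) finI by simp
  qed
  have at: "W1 z = V1 c z \<and> W2 z = V2 c z \<and> T11 z = U11 c z \<and> T12 z = U12 c z \<and> T22 z = U22 c z"
    if "c \<in> I" "z \<in> ball (zc c) r" for c z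
    unfolding W1_def W2_def T11_def T12_def T22_def
    using out by (intro conjI single[OF that]) auto
  have away: "W1 z = 0 \<and> W2 z = 0 \<and> T11 z = 0 \<and> T12 z = 0 \<and> T22 z = 0"
    if "\<And>c. c \<in> I \<Longrightarrow> z \<notin> ball (zc c) r" for z
    unfolding W1_def W2_def T11_def T12_def T22_def
    using out that by (intro conjI sum.neutral) auto
  have close: "\<bar>w1 z - w1 (zc c)\<bar> \<le> \<epsilon>" "\<bar>w2 z - w2 (zc c)\<bar> \<le> \<epsilon>"
      "\<bar>R11 z - R11 (zc c)\<bar> \<le> \<epsilon>" "\<bar>R12 z - R12 (zc c)\<bar> \<le> \<epsilon>" "\<bar>R22 z - R22 (zc c)\<bar> \<le> \<epsilon>"
    if "c \<in> I" "z \<in> Q" "dist z (zc c) < d" for c z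
    using that zcQ[OF that(1)] d1 d2 d3 d4 d5 by (auto simp: d_def)
  have ballQ: "z \<in> Q" if "c \<in> I" "z \<in> ball (zc c) r" for c z using ball_Q'[OF that] Q'Q by auto
  show ?thesis
  proof (rule that[OF perW[unfolded Q'_def]])
    fix t :: real and x :: "'n rvec" assume t: "t > 0"
    let ?z = "(t, x)"
    show "posdef (R11 ?z - (W1 ?z)\<^sup>2 - (2 * w1 ?z * W1 ?z - T11 ?z))
        (R12 ?z - W1 ?z * W2 ?z - (w1 ?z * W2 ?z + w2 ?z * W1 ?z - T12 ?z))
        (R22 ?z - (W2 ?z)\<^sup>2 - (2 * w2 ?z * W2 ?z - T22 ?z))"
    proof (cases "\<exists>c\<in>I. ?z \<in> ball (zc c) r")
      case True
      then obtain c where c: "c \<in> I" "?z \<in> ball (zc c) r" by blast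
      note cl = close[OF c(1) ballQ[OF c] near[OF c(2)]]
      show ?thesis
      proof (rule posdefI[of "\<rho> / 4"])
        fix y1 y2
        have "(\<rho> / 2 - 18 * M * \<epsilon>) * (y1\<^sup>2 + y2\<^sup>2)
          \<le> quad (R11 ?z - (V1 c ?z)\<^sup>2 - (2 * w1 ?z * V1 c ?z - U11 c ?z))
            (R12 ?z - V1 c ?z * V2 c ?z - (w1 ?z * V2 c ?z + w2 ?z * V1 c ?z - U12 c ?z))
            (R22 ?z - (V2 c ?z)\<^sup>2 - (2 * w2 ?z * V2 c ?z - U22 c ?z)) y1 y2"
          by (rule perturbed_quad_lower[OF less_imp_le[OF \<epsilon>(1)] \<epsilon>(2) M cl(3-5) cl(1,2) cX[OF c(1)] mM[OF c(1)]
              Vb[OF c(1)] Ub[OF c(1)] low[OF zcQ[OF c(1)]] mq[OF c(1)]])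
        moreover have "\<rho> / 4 * (y1\<^sup>2 + y2\<^sup>2) \<le> (\<rho> / 2 - 18 * M * \<epsilon>) * (y1\<^sup>2 + y2\<^sup>2)"
          using \<epsilon>\<rho> by (intro mult_right_mono) auto
        ultimately show "\<rho> / 4 * (y1\<^sup>2 + y2\<^sup>2) \<le> quad (R11 ?z - (W1 ?z)\<^sup>2 - (2 * w1 ?z * W1 ?z - T11 ?z))
          (R12 ?z - W1 ?z * W2 ?z - (w1 ?z * W2 ?z + w2 ?z * W1 ?z - T12 ?z))
          (R22 ?z - (W2 ?z)\<^sup>2 - (2 * w2 ?z * W2 ?z - T22 ?z)) y1 y2"
          using at[OF c] by simp
      qed (use \<rho> in simp)
    next
      case False
      then show ?thesis using away[of ?z] pos[OF t, of x] by auto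
    qed
  next
    fix t :: real
    \<comment> \<open>With the velocity frozen at the centres, the cross term is a combination of
      means of the packets and vanishes. The difference to the true cross term is at most 4 M
      \<epsilon>, since w varies by \<epsilon> on a ball and each component of \<open>V\<close> is
      at most 2 M.\<close>
    define W0 where "W0 z = (\<Sum>c\<in>I. w1 (zc c) * V1 c z + w2 (zc c) * V2 c z)" for z
    have cV: "continuous_on UNIV (V1 c)" "continuous_on UNIV (V2 c)" if "c \<in> I" for c
      using per[OF that] unfolding perturbation_def by blast+
    have iV: "integrable lborel (\<lambda>x. V1 c (t, x))" "integrable lborel (\<lambda>x. V2 c (t, x))" if "c \<in> I" for c
      by (rule integrable_field(2)[OF _ bounded_ball[of "zc c" r]]; use cV[OF that] out[OF that] in blast)+
    have mV: "(LINT x|lborel. V1 c (t, x)) = 0" "(LINT x|lborel. V2 c (t, x)) = 0" if "c \<in> I" for c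
      using per[OF that] unfolding perturbation_def by blast+
    have W0: "(LINT x|lborel. W0 (t, x)) = 0"
    proof -
      have "(LINT x|lborel. W0 (t, x)) = (\<Sum>c\<in>I. LINT x|lborel. w1 (zc c) * V1 c (t, x) + w2 (zc c) * V2 c (t, x))"
        unfolding W0_def using iV by (intro Bochner_Integration.integral_sum) auto
      also have "\<dots> = 0" using iV mV by (intro sum.neutral) auto
      finally show ?thesis .
    qed
    have iW0: "integrable lborel (\<lambda>x. W0 (t, x))"
      unfolding W0_def using iV by (intro Bochner_Integration.integrable_sum) auto
    have cW: "continuous_on UNIV W1" "continuous_on UNIV W2" and oW: "\<And>z. z \<notin> Q' \<Longrightarrow> W1 z = 0 \<and> W2 z = 0"
      using perW unfolding perturbation_def by blast+
    have iwW: "integrable lborel (\<lambda>x. (\<lambda>z. w1 z * W1 z + w2 z * W2 z) (t, x))"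
      by (rule integrable_field(2)[OF _ bQ(2)]) (use oW in \<open>auto intro!: continuous_intros cw cW\<close>)
    have iB: "integrable lborel (\<lambda>x. indicator (cbox (0::'n rvec) 1) x * (4 * M * \<epsilon>))"
      by (simp add: emeasure_lborel_cbox_eq)
    have "\<bar>w1 (t, x) * W1 (t, x) + w2 (t, x) * W2 (t, x) - W0 (t, x)\<bar> \<le> indicator (cbox 0 1) x * (4 * M * \<epsilon>)" for x
    proof (cases "\<exists>c\<in>I. (t, x) \<in> ball (zc c) r")
      case True
      let ?z = "(t, x)"
      obtain c where c: "c \<in> I" "?z \<in> ball (zc c) r" using True by blast
      note cl = close[OF c(1) ballQ[OF c] near[OF c(2)]]
      have "W0 ?z = w1 (zc c) * V1 c ?z + w2 (zc c) * V2 c ?z"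
        unfolding W0_def using out by (intro single[OF c]) auto
      then have eq: "w1 ?z * W1 ?z + w2 ?z * W2 ?z - W0 ?z = (w1 ?z - w1 (zc c)) * V1 c ?z + (w2 ?z - w2 (zc c)) * V2 c ?z"
        using at[OF c] by (simp add: algebra_simps)
      have V2M: "\<bar>V1 c ?z\<bar> \<le> 2 * M" "\<bar>V2 c ?z\<bar> \<le> 2 * M"
      proof -
        have "\<bar>cutoff (zc c) r ?z * cs c ?z * m1 c\<bar> \<le> 1 * M" "\<bar>cutoff (zc c) r ?z * cs c ?z * m2 c\<bar> \<le> 1 * M"
          unfolding abs_mult[of "cutoff (zc c) r ?z * cs c ?z"]
          by (intro mult_mono cX[OF c(1)] mM[OF c(1)]; simp)+
        then show "\<bar>V1 c ?z\<bar> \<le> 2 * M" "\<bar>V2 c ?z\<bar> \<le> 2 * M"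
          using Vb[OF c(1), of ?z] \<epsilon> M by linarith+
      qed
      have "\<bar>(w1 ?z - w1 (zc c)) * V1 c ?z\<bar> \<le> \<epsilon> * (2 * M)" "\<bar>(w2 ?z - w2 (zc c)) * V2 c ?z\<bar> \<le> \<epsilon> * (2 * M)"
        unfolding abs_mult using cl V2M \<epsilon> by (auto intro!: mult_mono)
      then have "\<bar>w1 ?z * W1 ?z + w2 ?z * W2 ?z - W0 ?z\<bar> \<le> 4 * M * \<epsilon>"
        unfolding eq by (simp add: algebra_simps)
      moreover have "x \<in> cbox 0 1" using ballQ[OF c] by (simp add: Q_def)
      ultimately show ?thesis by simp
    next
      case False
      then have "W0 (t, x) = 0" unfolding W0_def using out by (intro sum.neutral) auto
      then show ?thesis using away[of "(t, x)"] False M \<epsilon> by auto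
    qed
    then have "\<bar>LINT x|lborel. (w1 (t, x) * W1 (t, x) + w2 (t, x) * W2 (t, x)) - W0 (t, x)\<bar>
        \<le> (LINT x|lborel. indicator (cbox (0::'n rvec) 1) x * (4 * M * \<epsilon>))"
      using iwW iW0 iB by (intro lborel_integral_abs_le) auto
    also have "\<dots> = measure lborel (cbox (0::'n rvec) 1) * (4 * M * \<epsilon>)" by simp
    also have "measure lborel (cbox (0::'n rvec) 1) = 1"
      by (subst content_cbox_cart) (auto simp: interval_ne_empty_cart)
    finally show "\<bar>LINT x|lborel. w1 (t, x) * W1 (t, x) + w2 (t, x) * W2 (t, x)\<bar> \<le> \<eta>"
      using iwW iW0 W0 \<epsilon>\<eta> by simp
  next
    fix t :: real assume t: "\<tau> \<le> t" "t \<le> L"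
    \<comment> \<open>The nearest layer: rounding t / r brings t within r / 2 of its time
      coordinate, as \<open>cutoff_mass\<close> requires.\<close>
    define l where "l = nat \<lfloor>t / r + 1 / 2\<rfloor>"
    have tr0: "t / r + 1 / 2 \<ge> 0" using t \<tau> r by (intro add_nonneg_nonneg divide_nonneg_pos) auto
    have "real l \<le> t / r + 1 / 2" "t / r + 1 / 2 < real l + 1"
      using tr0 by (auto simp: l_def of_nat_nat)
      then have "\<bar>t / r - real l\<bar> \<le> 1 / 2" unfolding abs_le_iff by linarith
    then have "\<bar>t / r - real l\<bar> * r \<le> 1 / 2 * r" using r by (intro mult_right_mono) auto
    moreover have "\<bar>t / r - real l\<bar> * r = \<bar>t - real l * r\<bar>"
      using r by (simp add: abs_mult_pos left_diff_distrib)
    ultimately have tl: "\<bar>t - real l * r\<bar> \<le> r / 2" by simp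
    have "\<tau> - r \<le> real l * r \<and> real l * r \<le> L + r" using tl t r by linarith
    then have lL: "l \<in> Ls" by (simp add: Ls_def)
    have tl': "\<bar>4 * real K * t - real l\<bar> \<le> 1"
    proof -
      have "4 * real K * t - real l = 4 * real K * (t - real l * r)" using rK[of l] by (simp add: right_diff_distrib)
      then have "\<bar>4 * real K * t - real l\<bar> = 4 * real K * \<bar>t - real l * r\<bar>" by (simp add: abs_mult)
      also have "\<dots> \<le> 4 * real K * (r / 2)" using tl by (intro mult_left_mono) auto
      finally show ?thesis using K by (simp add: r_def)
    qed
    let ?tr = "\<lambda>x. R11 (t, x) + R22 (t, x)"
    let ?g = "gain CARD('n)" and ?v = "(1 / real K) ^ CARD('n)"
    have ctr: "continuous_on UNIV ?tr" by (intro continuous_intros continuous_slice cR)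
    have icell: "integrable lborel (\<lambda>x. indicator (cell K k) x * ?tr x)" for k
      using borel_integrable_compact[of "cell K k" ?tr] continuous_on_subset[OF ctr]
      by (simp add: cell_def mult.commute indicator_def if_distrib cong: if_cong)
    have g0: "0 \<le> ?g" "?g \<le> 1" using gain_bounds[of "CARD('n)"] by auto
    \<comment> \<open>The ball fills only a fixed part of the cell, but tr R is nearly constant on
      the whole cell, so the energy of the packet can be compared with the integral of tr R over
      it.\<close>
    have cellest: "?g * (LINT x|lborel. indicator (cell K k) x * ?tr x) - (2 * \<epsilon> * ?v + \<epsilon>')
        \<le> (LINT x|lborel. (V1 (l, k) (t, x))\<^sup>2 + (V2 (l, k) (t, x))\<^sup>2)" if k: "k \<in> cells K" for k
    proof -
      let ?c = "(l, k)"
      have c: "?c \<in> I" using lL k by (simp add: I_def)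
      let ?T = "R11 (zc ?c) + R22 (zc ?c)"
      have T: "?T > 0" by (rule trQ[OF zcQ[OF c]])
      have mass: "1 / 64 * (r / real CARD('n)) ^ CARD('n) \<le> (LINT x|lborel. (cutoff (zc ?c) r (t, x))\<^sup>2)"
      proof -
        have "\<bar>t - fst (zc ?c)\<bar> \<le> r / 2" using tl by (simp add: zc_fst)
        from cutoff_mass[OF r this, of "snd (zc ?c)"] show ?thesis by simp
      qed
      have "(r / real CARD('n)) ^ CARD('n) = (1 / (4 * real CARD('n))) ^ CARD('n) * ?v"
        by (simp add: r_def power_mult_distrib[symmetric] mult_ac)
      then have gv: "?T * (?g * ?v) = ?T / 4 / 2 * (1 / 64 * (r / real CARD('n)) ^ CARD('n))"
        by (simp add: gain_def)
      also have "\<dots> \<le> ((m1 ?c)\<^sup>2 + (m2 ?c)\<^sup>2) / 2 * (LINT x|lborel. (cutoff (zc ?c) r (t, x))\<^sup>2)"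
        using mt[OF c] T mass r by (intro mult_mono) (auto simp: add_nonneg_nonneg)
      also have "\<dots> \<le> (LINT x|lborel. (V1 ?c (t, x))\<^sup>2 + (V2 ?c (t, x))\<^sup>2) + \<epsilon>'"
        using en[OF c, of t] by simp
      finally have A: "?T * (?g * ?v) - \<epsilon>' \<le> (LINT x|lborel. (V1 ?c (t, x))\<^sup>2 + (V2 ?c (t, x))\<^sup>2)" by simp
      have "(LINT x|lborel. indicator (cell K k) x * ?tr x) \<le> (LINT x|lborel. indicator (cell K k) x * (?T + 2 * \<epsilon>))"
      proof (rule integral_mono[OF icell])
        show "integrable lborel (\<lambda>x. indicator (cell K k) x * (?T + 2 * \<epsilon>))"
          by (simp add: cell_def emeasure_lborel_cbox_eq)
        fix x :: "'n rvec"
        show "indicator (cell K k) x * ?tr x \<le> indicator (cell K k) x * (?T + 2 * \<epsilon>)"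
        proof (cases "x \<in> cell K k")
          case True
          have "dist (t, x) (zc ?c) < d"
            using cell_centre_near[OF K True tl'] Kd by (simp add: zc_def)
          moreover have "(t, x) \<in> Q" using t \<tau> cell_subset[OF K k] True by (auto simp: Q_def)
          ultimately show ?thesis using close(3,5)[OF c, of "(t, x)"] True by simp
        qed simp
      qed
      also have "\<dots> = ?v * (?T + 2 * \<epsilon>)" using measure_cell[OF K, of k] by (simp add: cell_def)
      finally have "?g * (LINT x|lborel. indicator (cell K k) x * ?tr x) \<le> ?g * (?v * (?T + 2 * \<epsilon>))"
        using g0 by (intro mult_left_mono) auto
      also have "\<dots> = ?T * (?g * ?v) + ?g * (2 * \<epsilon> * ?v)" by (simp add: algebra_simps)
      also have "?g * (2 * \<epsilon> * ?v) \<le> 1 * (2 * \<epsilon> * ?v)" using g0 \<epsilon> by (intro mult_right_mono) auto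
      finally show ?thesis using A by simp
    qed
    have "integrable lborel (\<lambda>x. indicator (cbox 0 1) x * ?tr x)"
      using borel_integrable_compact[of "cbox 0 1" ?tr] continuous_on_subset[OF ctr]
      by (simp add: mult.commute indicator_def if_distrib cong: if_cong)
    \<comment> \<open>Closed cells share their faces; as tr R is nonnegative on the cube, an
      inequality holds and suffices.\<close>
    moreover have "indicator (cbox 0 1) x * ?tr x \<le> (\<Sum>k\<in>cells K. indicator (cell K k) x * ?tr x)" for x
    proof (cases "x \<in> cbox 0 1")
      case True
      have p: "?tr x \<ge> 0" using trQ[of "(t, x)"] True t \<tau> by (simp add: Q_def)
      obtain k where k: "k \<in> cells K" "x \<in> cell K k" using cells_cover[OF K True] by blast
      have "?tr x = indicator (cell K k) x * ?tr x" using k by simp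
      also have "\<dots> \<le> (\<Sum>k\<in>cells K. indicator (cell K k) x * ?tr x)"
        using p by (intro member_le_sum[OF k(1)] finite_cells) auto
      finally show ?thesis using True by simp
    next
      case False
      then have "indicator (cell K k) x * ?tr x = 0" if "k \<in> cells K" for k
        using cell_subset[OF K that] by (auto simp: indicator_def)
      then have "(\<Sum>k\<in>cells K. indicator (cell K k) x * ?tr x) = 0" by (intro sum.neutral ballI)
      then show ?thesis using False by simp
    qed
    ultimately have "(LINT x|lborel. indicator (cbox 0 1) x * ?tr x)
        \<le> (LINT x|lborel. (\<Sum>k\<in>cells K. indicator (cell K k) x * ?tr x))"
      using icell by (intro integral_mono) auto
    also have "\<dots> = (\<Sum>k\<in>cells K. LINT x|lborel. indicator (cell K k) x * ?tr x)"
      using icell by (intro Bochner_Integration.integral_sum)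
    finally have "?g * (LINT x|lborel. indicator (cbox 0 1) x * ?tr x)
        \<le> ?g * (\<Sum>k\<in>cells K. LINT x|lborel. indicator (cell K k) x * ?tr x)"
      using g0 by (intro mult_left_mono) auto
    also have "\<dots> = (\<Sum>k\<in>cells K. ?g * (LINT x|lborel. indicator (cell K k) x * ?tr x))"
      by (rule sum_distrib_left)
    also have "\<dots> \<le> (\<Sum>k\<in>cells K. (LINT x|lborel. (V1 (l, k) (t, x))\<^sup>2 + (V2 (l, k) (t, x))\<^sup>2) + (2 * \<epsilon> * ?v + \<epsilon>'))"
      using cellest by (intro sum_mono) (simp add: diff_le_eq)
    also have "\<dots> = (\<Sum>k\<in>cells K. LINT x|lborel. (V1 (l, k) (t, x))\<^sup>2 + (V2 (l, k) (t, x))\<^sup>2)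
        + real K ^ CARD('n) * (2 * \<epsilon> * ?v + \<epsilon>')"
      by (simp add: sum.distrib card_cells)
    also have "real K ^ CARD('n) * (2 * \<epsilon> * ?v + \<epsilon>') \<le> \<eta>"
    proof -
      have "real K ^ CARD('n) * ?v = 1" using K by (simp add: power_mult_distrib[symmetric])
      then have "real K ^ CARD('n) * (2 * \<epsilon> * ?v + \<epsilon>') = 2 * \<epsilon> + real K ^ CARD('n) * \<epsilon>'"
        by (simp add: algebra_simps)
      then show ?thesis using \<epsilon>'K \<epsilon>4 by simp
    qed
    also have "(\<Sum>k\<in>cells K. LINT x|lborel. (V1 (l, k) (t, x))\<^sup>2 + (V2 (l, k) (t, x))\<^sup>2)
        \<le> (LINT x|lborel. (W1 (t, x))\<^sup>2 + (W2 (t, x))\<^sup>2)"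
    proof -
      have cV: "continuous_on UNIV (V1 c)" "continuous_on UNIV (V2 c)" if "c \<in> I" for c
        using per[OF that] unfolding perturbation_def by blast+
      have iV: "integrable lborel (\<lambda>x. (V1 c (t, x))\<^sup>2 + (V2 c (t, x))\<^sup>2)" if "c \<in> I" for c
      proof -
        have "integrable lborel (\<lambda>x. (\<lambda>z. (V1 c z)\<^sup>2 + (V2 c z)\<^sup>2) (t, x))"
          by (rule integrable_field(2)[OF _ bounded_ball[of "zc c" r]])
            (use out[OF that] in \<open>auto intro!: continuous_intros cV[OF that]\<close>)
        then show ?thesis by simp
      qed
      \<comment> \<open>The supports are disjoint, so the square of the sum has no mixed
        terms.\<close>
      have eq: "(W1 z)\<^sup>2 + (W2 z)\<^sup>2 = (\<Sum>c\<in>I. (V1 c z)\<^sup>2 + (V2 c z)\<^sup>2)" for z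
      proof (cases "\<exists>c\<in>I. z \<in> ball (zc c) r")
        case True
        then obtain c where c: "c \<in> I" "z \<in> ball (zc c) r" by blast
        have "(\<Sum>c\<in>I. (V1 c z)\<^sup>2 + (V2 c z)\<^sup>2) = (V1 c z)\<^sup>2 + (V2 c z)\<^sup>2"
          using out by (intro single[OF c]) auto
        then show ?thesis using at[OF c] by simp
      next
        case False
        then have "(\<Sum>c\<in>I. (V1 c z)\<^sup>2 + (V2 c z)\<^sup>2) = 0" using out by (intro sum.neutral) auto
        then show ?thesis using away[of z] False by auto
      qed
      have "(\<Sum>k\<in>cells K. LINT x|lborel. (V1 (l, k) (t, x))\<^sup>2 + (V2 (l, k) (t, x))\<^sup>2)
          = (\<Sum>c\<in>{l} \<times> cells K. LINT x|lborel. (V1 c (t, x))\<^sup>2 + (V2 c (t, x))\<^sup>2)"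
        using sum.cartesian_product[of "\<lambda>l k. LINT x|lborel. (V1 (l, k) (t, x))\<^sup>2 + (V2 (l, k) (t, x))\<^sup>2" "cells K" "{l}"]
        by (simp add: case_prod_unfold)
      \<comment> \<open>The layers other than \<open>l\<close> only add energy.\<close>
      also have "\<dots> \<le> (\<Sum>c\<in>I. LINT x|lborel. (V1 c (t, x))\<^sup>2 + (V2 c (t, x))\<^sup>2)"
        using lL finI by (intro sum_mono2) (auto simp: I_def)
      also have "\<dots> = (LINT x|lborel. (W1 (t, x))\<^sup>2 + (W2 (t, x))\<^sup>2)"
        unfolding eq using iV by (intro Bochner_Integration.integral_sum[symmetric])
      finally show ?thesis .
    qed
    finally show "(LINT x|lborel. (W1 (t, x))\<^sup>2 + (W2 (t, x))\<^sup>2)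
        \<ge> ?g * (LINT x|lborel. indicator (cbox 0 1) x * ?tr x) - \<eta>" by simp
  qed
qed

section \<open>Subsolutions and their iteration\<close>

lemma Omega_borel [measurable]: "(Omega :: ('n::{finite,linorder}) rvec set) \<in> sets borel"
proof -
  have "open {x :: 'n rvec. x $ i < 1}" "open {x :: 'n rvec. 0 < x $ i}" "closed {x :: 'n rvec. 0 \<le> x $ i}" for i
    by (auto intro!: open_Collect_less closed_Collect_le continuous_intros)
  then have "{x :: 'n rvec. x $ i < 1} \<in> sets borel" "{x :: 'n rvec. 0 < x $ i} \<in> sets borel"
      "{x :: 'n rvec. 0 \<le> x $ i} \<in> sets borel" for i by auto
  then have "(\<Inter>i\<in>UNIV - {last_ix}. {x :: 'n rvec. 0 \<le> x $ i} \<inter> {x. x $ i < 1})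
      \<inter> ({x. 0 < x $ last_ix} \<inter> {x. x $ last_ix < 1}) \<in> sets borel"
    by (cases "UNIV - {last_ix :: 'n} = {}") (auto intro!: sets.finite_INT)
  also have "(\<Inter>i\<in>UNIV - {last_ix}. {x :: 'n rvec. 0 \<le> x $ i} \<inter> {x. x $ i < 1})
      \<inter> ({x. 0 < x $ last_ix} \<inter> {x. x $ last_ix < 1}) = Omega"
    by (auto simp: Omega_def)
  finally show ?thesis .
qed

lemma Omega_box: "box 0 1 \<subseteq> Omega" "Omega \<subseteq> cbox 0 (1 :: ('n::{finite,linorder}) rvec)"
  by (auto simp: Omega_def mem_box_cart less_imp_le) (metis less_imp_le)+

lemma measure_unit_cube: "measure lborel (cbox 0 (1 :: ('n::finite) rvec)) = 1"
  by (subst content_cbox_cart) (auto simp: interval_ne_empty_cart)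

lemma Omega_AE: "AE x in lborel. indicator Omega x = (indicator (cbox 0 (1 :: ('n::{finite,linorder}) rvec)) x :: real)"
proof -
  have "negligible (cbox 0 1 - box 0 (1 :: 'n rvec))" by (rule negligible_frontier_interval)
  then have "cbox 0 1 - box 0 (1 :: 'n rvec) \<in> null_sets lborel"
    by (simp add: negligible_iff_null_sets null_sets_completion_iff)
  then have "AE x in lborel. x \<notin> cbox 0 1 - box 0 (1 :: 'n rvec)" by (rule AE_not_in)
  then show ?thesis
    using Omega_box by (elim eventually_mono) (auto simp: indicator_def)
qed

lemma measure_Omega: "measure lborel (Omega :: ('n::{finite,linorder}) rvec set) = 1"
proof -
  have "(LINT x|lborel. indicator (Omega :: 'n rvec set) x) = (LINT x|lborel. indicator (cbox 0 (1 :: 'n rvec)) x :: real)"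
    using Omega_AE by (intro integral_cong_AE) auto
  then show ?thesis by (simp add: measure_unit_cube)
qed

lemma emeasure_Omega: "emeasure lborel (Omega :: ('n::{finite,linorder}) rvec set) < \<infinity>"
proof -
  have "emeasure lborel (Omega :: 'n rvec set) \<le> emeasure lborel (cbox 0 (1 :: 'n rvec))"
    using Omega_box by (intro emeasure_mono) auto
  also have "\<dots> < \<infinity>" by (simp add: emeasure_lborel_cbox_eq)
  finally show ?thesis .
qed

lemma Omega_bounded: "bounded (Omega :: ('n::{finite,linorder}) rvec set)"
  using Omega_box(2) bounded_cbox bounded_subset by blast

lemma integrable_Omega:
  fixes f :: "('n::{finite,linorder}) rvec \<Rightarrow> real"
  assumes "continuous_on UNIV f"
  shows "integrable lborel (\<lambda>x. indicator Omega x * f x)"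
proof -
  obtain B where B: "\<And>x. x \<in> (Omega :: 'n rvec set) \<Longrightarrow> norm x \<le> B" using Omega_bounded bounded_iff by metis
  obtain M where M: "M > 0" "\<And>x. norm x \<le> B \<Longrightarrow> \<bar>f x\<bar> \<le> M"
    using continuous_bounded_on_ball[OF assms] by metis
  show ?thesis
  proof (rule integrable_bounded_support[where M = M and B = B])
    show "(\<lambda>x. indicator Omega x * f x) \<in> borel_measurable borel"
      using borel_measurable_continuous_onI[OF assms] by measurable
    show "\<bar>indicator Omega x * f x\<bar> \<le> M" for x using M B[of x] by (auto simp: indicator_def)
    show "indicator Omega x * f x = 0" if "norm x > B" for x using B[of x] that by (auto simp: indicator_def)
  qed
qed

lemma integral_combination:
  fixes f g h u v :: "'a \<Rightarrow> real"
  assumes "integrable M f" "integrable M g" "integrable M h" "integrable M u" "integrable M v"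
  shows "(LINT x|M. f x - g x - 2 * h x + u x + v x)
    = (LINT x|M. f x) - (LINT x|M. g x) - 2 * (LINT x|M. h x) + (LINT x|M. u x) + (LINT x|M. v x)"
    and "(LINT x|M. f x + g x - h x + u x - a * v x)
    = (LINT x|M. f x) + (LINT x|M. g x) - (LINT x|M. h x) + (LINT x|M. u x) - a * (LINT x|M. v x)"
  using assms by simp_all

text \<open>The energy still stored in the stress, which the iteration transfers to the
  flow.\<close>

definition defect :: "('n::{finite,linorder}) field \<Rightarrow> 'n field \<Rightarrow> real \<Rightarrow> real" where
  "defect R11 R22 t = (LINT x|lborel. indicator Omega x * (R11 (t, x) + R22 (t, x)))"

text \<open>
  Relative to the constant flow \<open>A e\<^sub>1\<close> with stress \<open>(c t / 2) I\<close>, the fields satisfy \<open>\<partial>\<^sub>t w + div (w \<otimes> w + R) = 0\<close>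
  without pressure.
\<close>

definition subsolution :: "real \<Rightarrow> real \<Rightarrow> ('n::{finite,linorder}) field \<Rightarrow> 'n field \<Rightarrow>
    'n field \<Rightarrow> 'n field \<Rightarrow> 'n field \<Rightarrow> bool" where
  "subsolution A c w1 w2 R11 R12 R22 \<longleftrightarrow>
     continuous_on UNIV w1 \<and> continuous_on UNIV w2 \<and>
     continuous_on UNIV R11 \<and> continuous_on UNIV R12 \<and> continuous_on UNIV R22 \<and>
     (\<forall>t x. t > 0 \<longrightarrow> posdef (R11 (t, x)) (R12 (t, x)) (R22 (t, x))) \<and>
     (\<exists>K. bounded K \<and> K \<subseteq> {0<..} \<times> box 0 1 \<and>
        perturbation K (\<lambda>z. w1 z - A) w2 (\<lambda>z. (w1 z)\<^sup>2 + R11 z - A\<^sup>2 - c * fst z / 2)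
          (\<lambda>z. w1 z * w2 z + R12 z) (\<lambda>z. (w2 z)\<^sup>2 + R22 z - c * fst z / 2))"

lemma subsolution_start:
  assumes "c > 0"
  shows "subsolution A c (\<lambda>_. A) (\<lambda>_. 0) (\<lambda>z. c * fst z / 2) (\<lambda>_. 0) (\<lambda>z. c * fst z / 2)"
proof -
  have "perturbation {} (\<lambda>z. A - A) (\<lambda>_. 0) (\<lambda>z. A\<^sup>2 + c * fst z / 2 - A\<^sup>2 - c * fst z / 2)
          (\<lambda>z. A * 0 + 0) (\<lambda>z. 0\<^sup>2 + c * fst z / 2 - c * fst z / 2)"
    using perturbation_zero[of "{}"] by simp
  moreover have "posdef (c * t / 2) 0 (c * t / 2)" if "t > 0" for t
    using that assms by (simp add: posdef_def)
  ultimately show ?thesis unfolding subsolution_def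
    by (intro conjI exI[of _ "{}"] continuous_intros) auto
qed

lemma subsolution_base:
  assumes "subsolution A c w1 w2 R11 R12 R22" "z \<notin> {0<..} \<times> box 0 1"
  shows "w1 z = A" "w2 z = 0"
  using assms unfolding subsolution_def perturbation_def by (metis (no_types, lifting) eq_iff_diff_eq_0 subsetD)+

text \<open>Conservation of the total energy: zero mean of the two diagonal fluxes fixes the
  integral of |w|^2 + tr R, and zero mean of \<open>w1 - A\<close> turns |w|^2 - A^2 into |w - A
  e1|^2.\<close>

lemma deviation_defect:
  fixes w1 w2 R11 R12 R22 :: "('n::{finite,linorder}) field"
  assumes S: "subsolution A c w1 w2 R11 R12 R22"
  shows "(LINT x|lborel. (w1 (t, x) - A)\<^sup>2 + (w2 (t, x))\<^sup>2) = c * t - defect R11 R22 t"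
proof -
  have cw: "continuous_on UNIV w1" "continuous_on UNIV w2" "continuous_on UNIV R11" "continuous_on UNIV R22"
    using S unfolding subsolution_def by blast+
  obtain K where K: "bounded K" "K \<subseteq> {0<..} \<times> box 0 1"
    and P: "perturbation K (\<lambda>z. w1 z - A) w2 (\<lambda>z. (w1 z)\<^sup>2 + R11 z - A\<^sup>2 - c * fst z / 2)
          (\<lambda>z. w1 z * w2 z + R12 z) (\<lambda>z. (w2 z)\<^sup>2 + R22 z - c * fst z / 2)"
    using S unfolding subsolution_def by blast
  let ?V = "\<lambda>z. w1 z - A" and ?U1 = "\<lambda>z. (w1 z)\<^sup>2 + R11 z - A\<^sup>2 - c * fst z / 2"
    and ?U2 = "\<lambda>z. (w2 z)\<^sup>2 + R22 z - c * fst z / 2"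
  have c: "continuous_on UNIV ?V" "continuous_on UNIV ?U1" "continuous_on UNIV ?U2"
    and o: "\<And>z. z \<notin> K \<Longrightarrow> ?V z = 0" "\<And>z. z \<notin> K \<Longrightarrow> ?U1 z = 0" "\<And>z. z \<notin> K \<Longrightarrow> ?U2 z = 0"
      "\<And>z. z \<notin> K \<Longrightarrow> w2 z = 0"
    and m: "(LINT x|lborel. ?V (t, x)) = 0" "(LINT x|lborel. ?U1 (t, x)) = 0" "(LINT x|lborel. ?U2 (t, x)) = 0"
    using P unfolding perturbation_def by blast+
  have i: "integrable lborel (\<lambda>x. ?V (t, x))" "integrable lborel (\<lambda>x. ?U1 (t, x))" "integrable lborel (\<lambda>x. ?U2 (t, x))"
    by (rule integrable_field(2)[OF c(1) K(1)], erule o(1))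
      (rule integrable_field(2)[OF c(2) K(1)], erule o(2), rule integrable_field(2)[OF c(3) K(1)], erule o(3))
  have iR: "integrable lborel (\<lambda>x. indicator Omega x * (R11 (t, x) + R22 (t, x)))"
    by (intro integrable_Omega continuous_intros continuous_slice cw)
  have i1: "integrable lborel (\<lambda>x::'n rvec. indicator Omega x * (c * t) :: real)"
    by (intro integrable_Omega continuous_intros)
  have "(w1 (t, x) - A)\<^sup>2 + (w2 (t, x))\<^sup>2 = ?U1 (t, x) + ?U2 (t, x)
      - indicator Omega x * (R11 (t, x) + R22 (t, x)) + indicator Omega x * (c * t) - 2 * A * ?V (t, x)" for x
  proof (cases "x \<in> Omega")
    case True
    then show ?thesis by (simp add: power2_eq_square algebra_simps)
  next
    case False
    then have "(t, x) \<notin> K" using K(2) Omega_box(1) by auto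
    then show ?thesis using False o(1-4)[of "(t, x)"] by simp
  qed
  then have "(LINT x|lborel. (w1 (t, x) - A)\<^sup>2 + (w2 (t, x))\<^sup>2) = (LINT x|lborel. ?U1 (t, x) + ?U2 (t, x)
      - indicator Omega x * (R11 (t, x) + R22 (t, x)) + indicator Omega x * (c * t) - 2 * A * ?V (t, x))"
    by (simp only:)
  also have "\<dots> = (LINT x|lborel. ?U1 (t, x)) + (LINT x|lborel. ?U2 (t, x)) - defect R11 R22 t
      + (LINT x|lborel. indicator (Omega :: 'n rvec set) x * (c * t)) - 2 * A * (LINT x|lborel. ?V (t, x))"
    unfolding defect_def by (rule integral_combination(2)[OF i(2,3) iR i1 i(1)])
  also have "(LINT x|lborel. indicator (Omega :: 'n rvec set) x * (c * t)) = c * t"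
    by (simp add: measure_Omega)
  finally show ?thesis using m by simp
qed

text \<open>The defect drops by the energy of \<open>V\<close> up to twice the cross term. So the
  increment is bounded by the drop, which makes increments small as soon as the defect is. In the
  last estimate the third \<eta> is the loss in the energy gain.\<close>

lemma subsolution_step:
  fixes w1 w2 R11 R12 R22 :: "('n::{finite,linorder}) field"
  assumes n: "CARD('n) \<ge> 2" and S: "subsolution A c w1 w2 R11 R12 R22"
    and \<tau>: "0 < \<tau>" "\<tau> \<le> L" and \<eta>: "\<eta> > 0"
  obtains w1' w2' R11' R12' R22' where "subsolution A c w1' w2' R11' R12' R22'"
    "\<And>t. (LINT x|lborel. (w1' (t, x) - w1 (t, x))\<^sup>2 + (w2' (t, x) - w2 (t, x))\<^sup>2)
       \<le> defect R11 R22 t - defect R11' R22' t + 2 * \<eta>"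
    "\<And>t. \<tau> \<le> t \<Longrightarrow> t \<le> L \<Longrightarrow> defect R11' R22' t \<le> (1 - gain CARD('n)) * defect R11 R22 t + 3 * \<eta>"
proof -
  have cw: "continuous_on UNIV w1" "continuous_on UNIV w2"
    and cR: "continuous_on UNIV R11" "continuous_on UNIV R12" "continuous_on UNIV R22"
    and pos: "\<And>t x. t > 0 \<Longrightarrow> posdef (R11 (t, x)) (R12 (t, x)) (R22 (t, x))"
    using S unfolding subsolution_def by blast+
  obtain K where K: "bounded K" "K \<subseteq> {0<..} \<times> box 0 1"
    and P: "perturbation K (\<lambda>z. w1 z - A) w2 (\<lambda>z. (w1 z)\<^sup>2 + R11 z - A\<^sup>2 - c * fst z / 2)
          (\<lambda>z. w1 z * w2 z + R12 z) (\<lambda>z. (w2 z)\<^sup>2 + R22 z - c * fst z / 2)"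
    using S unfolding subsolution_def by blast
  define Q where "Q = {\<tau> / 2..L + 1} \<times> (box 0 1 :: 'n rvec set)"
  have Q: "bounded Q" "Q \<subseteq> {0<..} \<times> box 0 1"
    using \<tau> by (auto simp: Q_def intro: bounded_Times)
  define good where "good V1 V2 U11 U12 U22 \<longleftrightarrow> perturbation Q V1 V2 U11 U12 U22 \<and>
    (\<forall>t x. t > 0 \<longrightarrow> posdef
        (R11 (t, x) - (V1 (t, x))\<^sup>2 - (2 * w1 (t, x) * V1 (t, x) - U11 (t, x)))
        (R12 (t, x) - V1 (t, x) * V2 (t, x) - (w1 (t, x) * V2 (t, x) + w2 (t, x) * V1 (t, x) - U12 (t, x)))
        (R22 (t, x) - (V2 (t, x))\<^sup>2 - (2 * w2 (t, x) * V2 (t, x) - U22 (t, x)))) \<and>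
    (\<forall>t. \<bar>LINT x|lborel. w1 (t, x) * V1 (t, x) + w2 (t, x) * V2 (t, x)\<bar> \<le> \<eta>) \<and>
    (\<forall>t. \<tau> \<le> t \<longrightarrow> t \<le> L \<longrightarrow> (LINT x|lborel. (V1 (t, x))\<^sup>2 + (V2 (t, x))\<^sup>2)
        \<ge> gain CARD('n) * (LINT x|lborel. indicator (cbox 0 1) x * (R11 (t, x) + R22 (t, x))) - \<eta>)"
    for V1 V2 U11 U12 U22 :: "'n field"
  have "\<exists>V1 V2 U11 U12 U22. good V1 V2 U11 U12 U22"
    by (rule convex_step[OF n cw cR pos \<tau> \<eta>]) (unfold good_def Q_def, blast+)
  then obtain V1 V2 U11 U12 U22 where good: "good V1 V2 U11 U12 U22" by blast
  then have PV: "perturbation Q V1 V2 U11 U12 U22"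
    and pos': "\<And>t x. t > 0 \<Longrightarrow> posdef
        (R11 (t, x) - (V1 (t, x))\<^sup>2 - (2 * w1 (t, x) * V1 (t, x) - U11 (t, x)))
        (R12 (t, x) - V1 (t, x) * V2 (t, x) - (w1 (t, x) * V2 (t, x) + w2 (t, x) * V1 (t, x) - U12 (t, x)))
        (R22 (t, x) - (V2 (t, x))\<^sup>2 - (2 * w2 (t, x) * V2 (t, x) - U22 (t, x)))"
    and cross: "\<And>t. \<bar>LINT x|lborel. w1 (t, x) * V1 (t, x) + w2 (t, x) * V2 (t, x)\<bar> \<le> \<eta>"
    and en: "\<And>t. \<tau> \<le> t \<Longrightarrow> t \<le> L \<Longrightarrow> (LINT x|lborel. (V1 (t, x))\<^sup>2 + (V2 (t, x))\<^sup>2)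
        \<ge> gain CARD('n) * (LINT x|lborel. indicator (cbox 0 1) x * (R11 (t, x) + R22 (t, x))) - \<eta>"
    unfolding good_def by blast+
  have cV: "continuous_on UNIV V1" "continuous_on UNIV V2" "continuous_on UNIV U11" "continuous_on UNIV U12" "continuous_on UNIV U22"
    and oV: "\<And>z. z \<notin> Q \<Longrightarrow> V1 z = 0 \<and> V2 z = 0 \<and> U11 z = 0 \<and> U12 z = 0 \<and> U22 z = 0"
    and mU: "\<And>t. (LINT x|lborel. U11 (t, x)) = 0" "\<And>t. (LINT x|lborel. U22 (t, x)) = 0"
    using PV unfolding perturbation_def by blast+
  define S11 where "S11 z = R11 z - (V1 z)\<^sup>2 - (2 * w1 z * V1 z - U11 z)" for z
  define S12 where "S12 z = R12 z - V1 z * V2 z - (w1 z * V2 z + w2 z * V1 z - U12 z)" for z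
  define S22 where "S22 z = R22 z - (V2 z)\<^sup>2 - (2 * w2 z * V2 z - U22 z)" for z
  have sub: "subsolution A c (\<lambda>z. w1 z + V1 z) (\<lambda>z. w2 z + V2 z) S11 S12 S22"
    unfolding subsolution_def
  proof (intro conjI exI[of _ "K \<union> Q"])
    have "perturbation (K \<union> Q) (\<lambda>z. (w1 z - A) + V1 z) (\<lambda>z. w2 z + V2 z)
        (\<lambda>z. ((w1 z)\<^sup>2 + R11 z - A\<^sup>2 - c * fst z / 2) + U11 z)
        (\<lambda>z. (w1 z * w2 z + R12 z) + U12 z) (\<lambda>z. ((w2 z)\<^sup>2 + R22 z - c * fst z / 2) + U22 z)"
      using K Q by (intro perturbation_add perturbation_mono[OF P] perturbation_mono[OF PV]) auto
    moreover have "((w1 z)\<^sup>2 + R11 z - A\<^sup>2 - c * fst z / 2) + U11 z = (w1 z + V1 z)\<^sup>2 + S11 z - A\<^sup>2 - c * fst z / 2"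
      "(w1 z * w2 z + R12 z) + U12 z = (w1 z + V1 z) * (w2 z + V2 z) + S12 z"
      "((w2 z)\<^sup>2 + R22 z - c * fst z / 2) + U22 z = (w2 z + V2 z)\<^sup>2 + S22 z - c * fst z / 2"
      "(w1 z - A) + V1 z = w1 z + V1 z - A" for z
      by (auto simp: S11_def S12_def S22_def power2_eq_square algebra_simps)
    ultimately show "perturbation (K \<union> Q) (\<lambda>z. w1 z + V1 z - A) (\<lambda>z. w2 z + V2 z)
        (\<lambda>z. (w1 z + V1 z)\<^sup>2 + S11 z - A\<^sup>2 - c * fst z / 2)
        (\<lambda>z. (w1 z + V1 z) * (w2 z + V2 z) + S12 z) (\<lambda>z. (w2 z + V2 z)\<^sup>2 + S22 z - c * fst z / 2)"
      by (simp only:)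
    show "\<forall>t x. 0 < t \<longrightarrow> posdef (S11 (t, x)) (S12 (t, x)) (S22 (t, x))"
      using pos' unfolding S11_def S12_def S22_def by blast
  qed (use K Q in \<open>auto simp: S11_def[abs_def] S12_def[abs_def] S22_def[abs_def] intro!: continuous_intros cw cR cV\<close>)
  have i1: "integrable lborel (\<lambda>x. (\<lambda>z. (V1 z)\<^sup>2 + (V2 z)\<^sup>2) (t, x))"
    and i2: "integrable lborel (\<lambda>x. (\<lambda>z. w1 z * V1 z + w2 z * V2 z) (t, x))"
    and i3: "integrable lborel (\<lambda>x. U11 (t, x))" "integrable lborel (\<lambda>x. U22 (t, x))" for t
    using oV by (auto intro!: integrable_field(2)[OF _ Q(1)] continuous_intros cV cw)
  have i4: "integrable lborel (\<lambda>x. indicator Omega x * (R11 (t, x) + R22 (t, x)))" for t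
    by (intro integrable_Omega continuous_intros continuous_slice cR)
  have defect': "defect S11 S22 t = defect R11 R22 t - (LINT x|lborel. (V1 (t, x))\<^sup>2 + (V2 (t, x))\<^sup>2)
      - 2 * (LINT x|lborel. w1 (t, x) * V1 (t, x) + w2 (t, x) * V2 (t, x))" for t
  proof -
    have "indicator Omega x * (S11 (t, x) + S22 (t, x)) = indicator Omega x * (R11 (t, x) + R22 (t, x))
        - ((V1 (t, x))\<^sup>2 + (V2 (t, x))\<^sup>2) - 2 * (w1 (t, x) * V1 (t, x) + w2 (t, x) * V2 (t, x))
        + U11 (t, x) + U22 (t, x)" for x
    proof (cases "x \<in> Omega")
      case True
      then show ?thesis by (simp add: S11_def S22_def algebra_simps)
    next
      case False
      then have "(t, x) \<notin> Q" using Q(2) Omega_box(1) by auto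
      then show ?thesis using False oV by simp
    qed
    then have "defect S11 S22 t = (LINT x|lborel. indicator Omega x * (R11 (t, x) + R22 (t, x))
        - ((V1 (t, x))\<^sup>2 + (V2 (t, x))\<^sup>2) - 2 * (w1 (t, x) * V1 (t, x) + w2 (t, x) * V2 (t, x))
        + U11 (t, x) + U22 (t, x))"
      unfolding defect_def by (simp only:)
    also have "\<dots> = defect R11 R22 t - (LINT x|lborel. (V1 (t, x))\<^sup>2 + (V2 (t, x))\<^sup>2)
      - 2 * (LINT x|lborel. w1 (t, x) * V1 (t, x) + w2 (t, x) * V2 (t, x))
      + (LINT x|lborel. U11 (t, x)) + (LINT x|lborel. U22 (t, x))"
      unfolding defect_def
      by (rule integral_combination[OF i4[of t] i1[of t] i2[of t] i3(1)[of t] i3(2)[of t]])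
    finally show ?thesis using mU by simp
  qed
  have Dc: "defect R11 R22 t = (LINT x|lborel. indicator (cbox 0 1) x * (R11 (t, x) + R22 (t, x)))" for t
    unfolding defect_def
  proof (rule integral_cong_AE)
    have "(\<lambda>x. R11 (t, x) + R22 (t, x)) \<in> borel_measurable borel"
      by (intro borel_measurable_continuous_onI continuous_intros continuous_slice cR)
    then show "(\<lambda>x. indicator Omega x * (R11 (t, x) + R22 (t, x))) \<in> borel_measurable lborel"
      "(\<lambda>x. indicator (cbox 0 1) x * (R11 (t, x) + R22 (t, x))) \<in> borel_measurable lborel"
      by auto
    show "AE x in lborel. indicator Omega x * (R11 (t, x) + R22 (t, x)) = indicator (cbox 0 1) x * (R11 (t, x) + R22 (t, x))"
      by (rule eventually_mono[OF Omega_AE]) simp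
  qed
  show ?thesis
  proof (rule that[OF sub])
    show "(LINT x|lborel. (w1 (t, x) + V1 (t, x) - w1 (t, x))\<^sup>2 + (w2 (t, x) + V2 (t, x) - w2 (t, x))\<^sup>2)
       \<le> defect R11 R22 t - defect S11 S22 t + 2 * \<eta>" for t
      using defect'[of t] cross[of t] by simp
    show "defect S11 S22 t \<le> (1 - gain CARD('n)) * defect R11 R22 t + 3 * \<eta>" if "\<tau> \<le> t" "t \<le> L" for t
      using defect'[of t] cross[of t] en[OF that] unfolding Dc[of t, symmetric] by (simp add: algebra_simps)
  qed
qed

lemma defect_nonneg:
  assumes S: "subsolution A c w1 w2 R11 R12 R22" and t: "t > 0"
  shows "defect R11 R22 t \<ge> 0"
  unfolding defect_def
proof (rule integral_nonneg_AE, rule AE_I2)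
  fix x
  have "posdef (R11 (t, x)) (R12 (t, x)) (R22 (t, x))" using S t unfolding subsolution_def by blast
  then show "0 \<le> indicator Omega x * (R11 (t, x) + R22 (t, x))"
    using posdef_pos by (intro mult_nonneg_nonneg) (force intro: add_nonneg_nonneg less_imp_le)+
qed

lemma defect_le:
  assumes S: "subsolution A c w1 w2 R11 R12 R22"
  shows "defect R11 R22 t \<le> c * t"
proof -
  have "0 \<le> (LINT x|lborel. (w1 (t, x) - A)\<^sup>2 + (w2 (t, x))\<^sup>2)" by (intro integral_nonneg_AE AE_I2) auto
  then show ?thesis using deviation_defect[OF S, of t] by simp
qed

text \<open>One half of the gain drives the decay, the other half absorbs the errors of the
  steps.\<close>

definition rate :: "nat \<Rightarrow> real" where "rate n = 1 - gain n / 2"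

lemma rate_bounds: "n > 0 \<Longrightarrow> rate n < 1" "1 / 2 \<le> rate n"
  using gain_bounds[of n] by (auto simp: rate_def)

text \<open>For times above a fixed bound the gain is available from the index at which
  \<open>L / real (Suc k)\<close> falls below that bound; earlier indices are covered by the crude
  estimate c t of the defect. Therefore the constant depends on the bound, while the rate does
  not.\<close>

lemma subsolution_sequence:
  fixes A c L :: real
  assumes n: "CARD('n::{finite,linorder}) \<ge> 2" and c: "c > 0" and L: "L > 0"
  obtains w1 w2 R11 R12 R22 :: "nat \<Rightarrow> ('n::{finite,linorder}) field" where
    "\<And>k. subsolution A c (w1 k) (w2 k) (R11 k) (R12 k) (R22 k)"
    "\<And>\<tau>. \<tau> > 0 \<Longrightarrow> \<exists>C\<ge>0. \<forall>t\<in>{\<tau>..L}. \<forall>k. defect (R11 k) (R22 k) t \<le> C * rate CARD('n) ^ k \<and>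
       (LINT x|lborel. (w1 (Suc k) (t, x) - w1 k (t, x))\<^sup>2 + (w2 (Suc k) (t, x) - w2 k (t, x))\<^sup>2) \<le> C * rate CARD('n) ^ k"
proof -
  define q where "q = rate CARD('n)"
  define g where "g = gain CARD('n)"
  have g: "g > 0" "g \<le> 1" using gain_bounds[of "CARD('n)"] by (auto simp: g_def)
  have q: "q < 1" "1 / 2 \<le> q" "q = 1 - g / 2" using rate_bounds[of "CARD('n)"] by (auto simp: q_def g_def rate_def)
  \<comment> \<open>Three errors \<eta> make up (g / 2) q^k, the half of the gain that
    \<open>rate\<close> sets aside.\<close>
  define \<eta> where "\<eta> k = g / 6 * q ^ k" for k
  have \<eta>: "\<eta> k > 0" for k using g q by (simp add: \<eta>_def)
  \<comment> \<open>Tends to zero, so that every positive time up to L is eventually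
    reached.\<close>
  define \<tau> where "\<tau> k = L / real (Suc k)" for k
  have \<tau>: "0 < \<tau> k" "\<tau> k \<le> L" for k using L by (auto simp: \<tau>_def field_simps)
  define ok :: "'n field \<times> 'n field \<times> 'n field \<times> 'n field \<times> 'n field \<Rightarrow> bool" where
    "ok S = (case S of (w1, w2, R11, R12, R22) \<Rightarrow> subsolution A c w1 w2 R11 R12 R22)" for S
  define nx :: "nat \<Rightarrow> 'n field \<times> 'n field \<times> 'n field \<times> 'n field \<times> 'n field \<Rightarrow>
      'n field \<times> 'n field \<times> 'n field \<times> 'n field \<times> 'n field \<Rightarrow> bool" where
    "nx k S S' = (case S of (w1, w2, R11, R12, R22) \<Rightarrow> case S' of (w1', w2', R11', R12', R22') \<Rightarrow>
      (\<forall>t. (LINT x|lborel. (w1' (t, x) - w1 (t, x))\<^sup>2 + (w2' (t, x) - w2 (t, x))\<^sup>2)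
         \<le> defect R11 R22 t - defect R11' R22' t + 2 * \<eta> k) \<and>
      (\<forall>t. \<tau> k \<le> t \<longrightarrow> t \<le> L \<longrightarrow> defect R11' R22' t \<le> (1 - g) * defect R11 R22 t + 3 * \<eta> k))" for k S S'
  have "\<exists>F. \<forall>k. ok (F k) \<and> nx k (F k) (F (Suc k))"
  proof (rule dependent_nat_choice)
    show "\<exists>S. ok S" using subsolution_start[OF c, of A] unfolding ok_def
      by (intro exI[of _ "(\<lambda>_. A, \<lambda>_. 0, \<lambda>z. c * fst z / 2, \<lambda>_. 0, \<lambda>z. c * fst z / 2)"]) simp
    fix S k assume "ok S"
    obtain w1 w2 R11 R12 R22 where S: "S = (w1, w2, R11, R12, R22)" by (cases S)
    have sub: "subsolution A c w1 w2 R11 R12 R22" using \<open>ok S\<close> by (simp add: ok_def S)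
    show "\<exists>S'. ok S' \<and> nx k S S'"
    proof (rule subsolution_step[OF n sub \<tau> \<eta>])
      fix w1' w2' R11' R12' R22'
      assume "subsolution A c w1' w2' R11' R12' R22'"
        "\<And>t. (LINT x|lborel. (w1' (t, x) - w1 (t, x))\<^sup>2 + (w2' (t, x) - w2 (t, x))\<^sup>2)
         \<le> defect R11 R22 t - defect R11' R22' t + 2 * \<eta> k"
        "\<And>t. \<tau> k \<le> t \<Longrightarrow> t \<le> L \<Longrightarrow> defect R11' R22' t \<le> (1 - gain CARD('n)) * defect R11 R22 t + 3 * \<eta> k"
      then show ?thesis
        by (intro exI[of _ "(w1', w2', R11', R12', R22')"]) (simp add: ok_def nx_def S g_def)
    qed
  qed
  then obtain F where F: "\<And>k. ok (F k)" "\<And>k. nx k (F k) (F (Suc k))" by blast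
  define w1 where "w1 k = fst (F k)" for k
  define w2 where "w2 k = fst (snd (F k))" for k
  define R11 where "R11 k = fst (snd (snd (F k)))" for k
  define R12 where "R12 k = fst (snd (snd (snd (F k))))" for k
  define R22 where "R22 k = snd (snd (snd (snd (F k))))" for k
  define D where "D k t = defect (R11 k) (R22 k) t" for k t
  have sub: "subsolution A c (w1 k) (w2 k) (R11 k) (R12 k) (R22 k)" for k
    using F(1)[of k] by (simp add: ok_def w1_def w2_def R11_def R12_def R22_def split: prod.splits)
  have inc: "(LINT x|lborel. (w1 (Suc k) (t, x) - w1 k (t, x))\<^sup>2 + (w2 (Suc k) (t, x) - w2 k (t, x))\<^sup>2)
         \<le> D k t - D (Suc k) t + 2 * \<eta> k" for k t
    using F(2)[of k] by (simp add: nx_def D_def w1_def w2_def R11_def R12_def R22_def split: prod.splits)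
  have dec: "D (Suc k) t \<le> (1 - g) * D k t + 3 * \<eta> k" if "\<tau> k \<le> t" "t \<le> L" for k t
    using F(2)[of k] that by (simp add: nx_def D_def w1_def w2_def R11_def R12_def R22_def split: prod.splits)
  have D0: "0 \<le> D k t" if "t > 0" for k t unfolding D_def by (rule defect_nonneg[OF sub that])
  have Dc: "D k t \<le> c * t" for k t unfolding D_def by (rule defect_le[OF sub])
  have main: "\<exists>C\<ge>0. \<forall>t\<in>{\<sigma>..L}. \<forall>k. D k t \<le> C * q ^ k \<and>
       (LINT x|lborel. (w1 (Suc k) (t, x) - w1 k (t, x))\<^sup>2 + (w2 (Suc k) (t, x) - w2 k (t, x))\<^sup>2) \<le> C * q ^ k"
    if \<sigma>: "\<sigma> > 0" for \<sigma>
  proof -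
    obtain k0 where k0: "real k0 > L / \<sigma>" using reals_Archimedean2 by blast
    have \<tau>\<sigma>: "\<tau> k \<le> \<sigma>" if "k \<ge> k0" for k
    proof -
      have "L < real k0 * \<sigma>" using k0 \<sigma> by (simp add: field_simps)
      also have "\<dots> \<le> real (Suc k) * \<sigma>" using that \<sigma> by (intro mult_right_mono) auto
      finally show ?thesis by (simp add: \<tau>_def field_simps)
    qed
    \<comment> \<open>Chosen so that C q^k takes the value 1 + c L at the index k0. All defects up
      to k0 then lie below C q^k, and C \<ge> 1 allows the errors \<eta> to be absorbed
      later.\<close>
    define C where "C = (1 + c * L) / q ^ k0"
    have C0: "C * q ^ k0 = 1 + c * L" using q by (simp add: C_def)
    have qk: "q ^ k > 0" for k using q by simp
    have cL: "c * L \<ge> 0" using c L by simp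
    have C1: "C \<ge> 1"
    proof -
      have "q ^ k0 \<le> 1" using q by (intro power_le_one) auto
      then show ?thesis using qk[of k0] cL by (simp add: C_def le_divide_eq)
    qed
    have DC: "D k t \<le> C * q ^ k" if t: "t \<in> {\<sigma>..L}" for k t
    proof -
      have ct: "c * t \<le> c * L" using t c by simp
      have small: "D k t \<le> C * q ^ k" if "k \<le> k0" for k
      proof -
        have "C * q ^ k0 \<le> C * q ^ k" using that q C1 by (intro mult_left_mono power_decreasing) auto
        then show ?thesis using C0 Dc[of k t] ct by linarith
      qed
      have "D k t \<le> C * q ^ k" if "k \<ge> k0" for k
        using that
      proof (induction k rule: dec_induct)
        case base
        show ?case by (rule small) simp
      next
        case (step k)
        have "D (Suc k) t \<le> (1 - g) * D k t + 3 * \<eta> k" using \<tau>\<sigma>[OF step.hyps(1)] t by (intro dec) auto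
        also have "(1 - g) * D k t \<le> (1 - g) * (C * q ^ k)" using step.IH g by (intro mult_left_mono) auto
        also have "3 * \<eta> k \<le> g / 2 * (C * q ^ k)"
        proof -
          have "1 * q ^ k \<le> C * q ^ k" using C1 qk[of k] by (intro mult_right_mono) auto
          then have "g / 2 * q ^ k \<le> g / 2 * (C * q ^ k)" using g by (intro mult_left_mono) auto
          then show ?thesis by (simp add: \<eta>_def)
        qed
        also have "(1 - g) * (C * q ^ k) + g / 2 * (C * q ^ k) = C * q ^ Suc k"
          by (simp add: q(3) algebra_simps)
        finally show ?case by simp
      qed
      then show ?thesis using small by (cases "k \<le> k0") auto
    qed
    have "(LINT x|lborel. (w1 (Suc k) (t, x) - w1 k (t, x))\<^sup>2 + (w2 (Suc k) (t, x) - w2 k (t, x))\<^sup>2) \<le> (C + 1) * q ^ k"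
      if t: "t \<in> {\<sigma>..L}" for k t
    proof -
      have "2 * \<eta> k \<le> q ^ k"
      proof -
        have "g / 3 * q ^ k \<le> 1 * q ^ k" using g qk[of k] by (intro mult_right_mono) auto
        then show ?thesis by (simp add: \<eta>_def)
      qed
      then show ?thesis using inc[of k t] DC[OF t, of k] D0[of t "Suc k"] t \<sigma> by (simp add: distrib_right)
    qed
    moreover have "D k t \<le> (C + 1) * q ^ k" if "t \<in> {\<sigma>..L}" for k t
      using DC[OF that, of k] qk[of k] by (simp add: distrib_right)
    ultimately show ?thesis using C1 by (intro exI[of _ "C + 1"]) auto
  qed
  show ?thesis by (rule that[OF sub]) (use main in \<open>simp add: q_def D_def\<close>)
qed

section \<open>The limit flow\<close>

text \<open>With s = sqrt q, the squared increments divided by s^j still have integrals of order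
  s^j, so their sum is finite almost everywhere. Cauchy-Schwarz with weights s^j then bounds the
  square of a tail of the telescoping sum by s^k / (1 - s) times the tail of that series.\<close>

lemma L2_telescoping_limit:
  fixes f :: "nat \<Rightarrow> 'a \<Rightarrow> real" and q C :: real
  assumes meas: "\<And>k. f k \<in> borel_measurable M"
    and int: "\<And>k. integrable M (\<lambda>x. (f (Suc k) x - f k x)\<^sup>2)"
    and bd: "\<And>k. (LINT x|M. (f (Suc k) x - f k x)\<^sup>2) \<le> C * q ^ k"
    and q: "0 < q" "q < 1" and C: "C \<ge> 0"
  defines "F \<equiv> \<lambda>x. lim (\<lambda>k. f k x)"
  shows "integrable M (\<lambda>x. (F x - f k x)\<^sup>2)"
    "(LINT x|M. (F x - f k x)\<^sup>2) \<le> C / (1 - sqrt q)\<^sup>2 * q ^ k"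
proof -
  define s where "s = sqrt q"
  have s: "0 < s" "s < 1" "s\<^sup>2 = q" using q by (auto simp: s_def)
  have geo: "(\<Sum>i. s ^ i) = 1 / (1 - s)" "summable (\<lambda>i. s ^ i)"
    using s by (auto intro: suminf_geometric summable_geometric)
  define g where "g j x = (f (Suc j) x - f j x)\<^sup>2 / s ^ j" for j x
  have g0: "0 \<le> g j x" for j x using s by (simp add: g_def)
  have gm: "g j \<in> borel_measurable M" for j unfolding g_def using meas by measurable
  have gint: "integrable M (g j)" for j unfolding g_def using int by simp
  have gbd: "(LINT x|M. g j x) \<le> C * s ^ j" for j
  proof -
    have "(LINT x|M. g j x) = (LINT x|M. (f (Suc j) x - f j x)\<^sup>2) / s ^ j" unfolding g_def by simp
    also have "\<dots> \<le> C * q ^ j / s ^ j" using bd s by (intro divide_right_mono) auto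
    also have "q ^ j = s ^ j * s ^ j" by (simp add: s(3)[symmetric] power2_eq_square power_mult_distrib)
    finally show ?thesis using s by simp
  qed
  have tail: "(\<integral>\<^sup>+x. (\<Sum>j. ennreal (g (j + k) x)) \<partial>M) \<le> ennreal (C * s ^ k / (1 - s))" for k
  proof -
    have "(\<integral>\<^sup>+x. (\<Sum>j. ennreal (g (j + k) x)) \<partial>M) = (\<Sum>j. \<integral>\<^sup>+x. ennreal (g (j + k) x) \<partial>M)"
      using gm by (intro nn_integral_suminf) auto
    also have "\<dots> = (\<Sum>j. ennreal (LINT x|M. g (j + k) x))"
      using gint g0 by (simp add: nn_integral_eq_integral)
    also have "\<dots> \<le> (\<Sum>j. ennreal (C * s ^ k * s ^ j))"
    proof (intro suminf_le ennreal_leI)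
      show "(LINT x|M. g (j + k) x) \<le> C * s ^ k * s ^ j" for j
        using gbd[of "j + k"] by (simp add: power_add mult_ac)
    qed auto
    also have "\<dots> = ennreal (\<Sum>j. C * s ^ k * s ^ j)"
      using C s geo by (intro suminf_ennreal2) (auto intro!: summable_mult)
    also have "(\<Sum>j. C * s ^ k * s ^ j) = C * s ^ k / (1 - s)"
      using geo by (simp add: suminf_mult)
    finally show ?thesis .
  qed
  have AEs: "AE x in M. summable (\<lambda>j. g j x)"
  proof -
    have "(\<integral>\<^sup>+x. (\<Sum>j. ennreal (g j x)) \<partial>M) \<noteq> \<infinity>"
      using tail[of 0] by (auto simp: top_unique)
    then have "AE x in M. (\<Sum>j. ennreal (g j x)) \<noteq> \<infinity>"
      using gm by (intro nn_integral_noteq_infinite) auto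
    then show ?thesis
      by (rule eventually_mono) (auto intro: summable_suminf_not_top g0)
  qed
  have pt: "(F x - f k x)\<^sup>2 \<le> s ^ k / (1 - s) * (\<Sum>j. g (j + k) x)" if sg: "summable (\<lambda>j. g j x)" for x k
  proof -
    let ?d = "\<lambda>j. f (Suc j) x - f j x"
    have dg: "(?d j)\<^sup>2 = s ^ j * g j x" for j using s by (simp add: g_def)
    \<comment> \<open>Since d^2 = s^j g, each increment is dominated by the sum of two summable
      sequences, so the values converge at this point.\<close>
    have "\<bar>?d j\<bar> \<le> s ^ j + g j x" for j
    proof -
      have sj: "s ^ j > 0" using s by simp
      then have "(\<bar>?d j\<bar>)\<^sup>2 \<le> (s ^ j + g j x)\<^sup>2"
        using dg[of j] g0[of j x] by (simp add: power2_sum)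
      moreover have "0 \<le> s ^ j + g j x" using sj g0[of j x] by linarith
      ultimately show ?thesis by (rule power2_le_imp_le)
    qed
    then have "summable ?d"
      using summable_add[OF geo(2) sg] by (intro summable_comparison_test[of ?d]) auto
    then have "convergent (\<lambda>n. \<Sum>j<n. ?d j)" by (simp add: summable_iff_convergent)
    moreover have "(\<Sum>j<n. ?d j) = f n x - f 0 x" for n
      using sum_lessThan_telescope[of "\<lambda>j. f j x" n] by simp
    ultimately have "convergent (\<lambda>n. f n x - f 0 x)" by (simp only:)
    then have "convergent (\<lambda>n. (f n x - f 0 x) + f 0 x)" by (intro convergent_add convergent_const)
    then have lim: "(\<lambda>n. f n x) \<longlonglongrightarrow> F x" by (simp add: F_def convergent_LIMSEQ_iff)
    have sgk: "summable (\<lambda>j. g (j + k) x)" using sg summable_iff_shift[of "\<lambda>j. g j x" k] by simp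
    have "(f (n + k) x - f k x)\<^sup>2 \<le> s ^ k / (1 - s) * (\<Sum>j. g (j + k) x)" for n
    proof -
      have "f (n + k) x - f k x = (\<Sum>j<n. ?d (j + k))"
        using sum_lessThan_telescope[of "\<lambda>j. f (j + k) x" n] by simp
      also have "\<dots> = (\<Sum>j<n. sqrt (s ^ (j + k)) * (?d (j + k) / sqrt (s ^ (j + k))))"
        using s by simp
      finally have "(f (n + k) x - f k x)\<^sup>2
         = (\<Sum>j<n. sqrt (s ^ (j + k)) * (?d (j + k) / sqrt (s ^ (j + k))))\<^sup>2" by (rule arg_cong)
      also have "\<dots> \<le> (\<Sum>j<n. (sqrt (s ^ (j + k)))\<^sup>2) * (\<Sum>j<n. (?d (j + k) / sqrt (s ^ (j + k)))\<^sup>2)"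
        by (rule Cauchy_Schwarz_ineq_sum)
      also have "(\<Sum>j<n. (sqrt (s ^ (j + k)))\<^sup>2) = s ^ k * (\<Sum>j<n. s ^ j)"
        using s by (simp add: power_add sum_distrib_left mult.commute)
      also have "(\<Sum>j<n. (?d (j + k) / sqrt (s ^ (j + k)))\<^sup>2) = (\<Sum>j<n. g (j + k) x)"
        using s by (simp add: power_divide g_def)
      also have "s ^ k * (\<Sum>j<n. s ^ j) * (\<Sum>j<n. g (j + k) x) \<le> s ^ k * (1 / (1 - s)) * (\<Sum>j. g (j + k) x)"
      proof (intro mult_mono)
        show "(\<Sum>j<n. s ^ j) \<le> 1 / (1 - s)"
          using sum_le_suminf[OF geo(2), of "{..<n}"] s by (simp add: geo(1))
        show "(\<Sum>j<n. g (j + k) x) \<le> (\<Sum>j. g (j + k) x)"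
          by (rule sum_le_suminf[OF sgk]) (auto simp: g0)
      qed (use s g0 in \<open>auto intro!: sum_nonneg\<close>)
      finally show ?thesis by simp
    qed
    moreover have "(\<lambda>n. (f (n + k) x - f k x)\<^sup>2) \<longlonglongrightarrow> (F x - f k x)\<^sup>2"
      using LIMSEQ_ignore_initial_segment[OF lim, of k] by (intro tendsto_intros)
    ultimately show ?thesis by (intro LIMSEQ_le_const2) auto
  qed
  have Fm: "F \<in> borel_measurable M" unfolding F_def using meas by (intro borel_measurable_lim_metric)
  have nn: "(\<integral>\<^sup>+x. ennreal ((F x - f k x)\<^sup>2) \<partial>M) \<le> ennreal (C / (1 - sqrt q)\<^sup>2 * q ^ k)" for k
  proof -
    have "(\<integral>\<^sup>+x. ennreal ((F x - f k x)\<^sup>2) \<partial>M)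
        \<le> (\<integral>\<^sup>+x. ennreal (s ^ k / (1 - s)) * (\<Sum>j. ennreal (g (j + k) x)) \<partial>M)"
    proof (rule nn_integral_mono_AE, rule eventually_mono[OF AEs])
      fix x assume sg: "summable (\<lambda>j. g j x)"
      have sgk: "summable (\<lambda>j. g (j + k) x)" using sg summable_iff_shift[of "\<lambda>j. g j x" k] by simp
      have "ennreal ((F x - f k x)\<^sup>2) \<le> ennreal (s ^ k / (1 - s) * (\<Sum>j. g (j + k) x))"
        by (intro ennreal_leI pt[OF sg])
      also have "\<dots> = ennreal (s ^ k / (1 - s)) * ennreal (\<Sum>j. g (j + k) x)"
        using s by (intro ennreal_mult' ) auto
      also have "ennreal (\<Sum>j. g (j + k) x) = (\<Sum>j. ennreal (g (j + k) x))"
        by (rule suminf_ennreal2[symmetric]) (auto simp: g0 sgk)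
      finally show "ennreal ((F x - f k x)\<^sup>2) \<le> ennreal (s ^ k / (1 - s)) * (\<Sum>j. ennreal (g (j + k) x))" .
    qed
    also have "\<dots> = ennreal (s ^ k / (1 - s)) * (\<integral>\<^sup>+x. (\<Sum>j. ennreal (g (j + k) x)) \<partial>M)"
      using gm by (intro nn_integral_cmult) auto
    also have "\<dots> \<le> ennreal (s ^ k / (1 - s)) * ennreal (C * s ^ k / (1 - s))"
      using tail by (intro mult_left_mono) auto
    also have "\<dots> = ennreal (s ^ k / (1 - s) * (C * s ^ k / (1 - s)))"
      using s by (intro ennreal_mult'[symmetric]) auto
    also have "s ^ k / (1 - s) * (C * s ^ k / (1 - s)) = C / (1 - sqrt q)\<^sup>2 * q ^ k"
      unfolding s_def[symmetric] s(3)[symmetric] using s(1) by (simp add: power2_eq_square power_mult_distrib mult_ac)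
    finally show ?thesis .
  qed
  show "integrable M (\<lambda>x. (F x - f k x)\<^sup>2)"
  proof (rule integrableI_bounded)
    show "(\<lambda>x. (F x - f k x)\<^sup>2) \<in> borel_measurable M" using Fm meas by measurable
    show "(\<integral>\<^sup>+x. ennreal (norm ((F x - f k x)\<^sup>2)) \<partial>M) < \<infinity>"
      using nn[of k] by (simp add: le_less_trans)
  qed
  show "(LINT x|M. (F x - f k x)\<^sup>2) \<le> C / (1 - sqrt q)\<^sup>2 * q ^ k"
    using nn[of k] C q by (intro integral_real_bounded) auto
qed

section \<open>Inequalities for products and integrals over slices\<close>

lemma integrable_square_product:
  fixes a b :: "'a \<Rightarrow> real"
  assumes "a \<in> borel_measurable M" "b \<in> borel_measurable M"
    "integrable M (\<lambda>x. (a x)\<^sup>2)" "integrable M (\<lambda>x. (b x)\<^sup>2)"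
  shows "integrable M (\<lambda>x. a x * b x)"
proof (rule Bochner_Integration.integrable_bound)
  show "integrable M (\<lambda>x. (a x)\<^sup>2 + (b x)\<^sup>2)" using assms by simp
  show "AE x in M. norm (a x * b x) \<le> norm ((a x)\<^sup>2 + (b x)\<^sup>2)"
  proof (rule AE_I2)
    fix x
    have "2 * \<bar>a x\<bar> * \<bar>b x\<bar> \<le> (a x)\<^sup>2 + (b x)\<^sup>2" using sum_squares_bound[of "\<bar>a x\<bar>" "\<bar>b x\<bar>"] by simp
    moreover have "0 \<le> \<bar>a x\<bar> * \<bar>b x\<bar>" by simp
    ultimately have "\<bar>a x\<bar> * \<bar>b x\<bar> \<le> (a x)\<^sup>2 + (b x)\<^sup>2" by linarith
    then show "norm (a x * b x) \<le> norm ((a x)\<^sup>2 + (b x)\<^sup>2)" by (simp add: abs_mult)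
  qed
qed (use assms in measurable)

lemma young_abs:
  fixes a b l :: real
  assumes "l > 0" shows "2 * \<bar>a * b\<bar> \<le> a\<^sup>2 / l + l * b\<^sup>2"
proof -
  have "0 \<le> (\<bar>a\<bar> / sqrt l - sqrt l * \<bar>b\<bar>)\<^sup>2" by simp
  also have "\<dots> = a\<^sup>2 / l + l * b\<^sup>2 - 2 * \<bar>a * b\<bar>"
    using assms by (simp add: power2_diff power_divide power_mult_distrib abs_mult)
  finally show ?thesis by simp
qed

text \<open>Stands in for the Cauchy-Schwarz inequality. With weight s^k a squared difference of
  order s^(2k) yields a bound of order s^k; at t = 0 the weight will be sqrt t.\<close>

lemma young_integral:
  fixes a b :: "'a \<Rightarrow> real"
  assumes m: "a \<in> borel_measurable M" "b \<in> borel_measurable M"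
    and i: "integrable M (\<lambda>x. (a x)\<^sup>2)" "integrable M (\<lambda>x. (b x)\<^sup>2)" and l: "l > 0"
  shows "2 * \<bar>LINT x|M. a x * b x\<bar> \<le> (LINT x|M. (a x)\<^sup>2) / l + l * (LINT x|M. (b x)\<^sup>2)"
proof -
  have "2 * \<bar>LINT x|M. a x * b x\<bar> \<le> 2 * (LINT x|M. \<bar>a x * b x\<bar>)" by simp
  also have "\<dots> = (LINT x|M. 2 * \<bar>a x * b x\<bar>)" by simp
  also have "\<dots> \<le> (LINT x|M. (a x)\<^sup>2 / l + l * (b x)\<^sup>2)"
    using integrable_square_product[OF m i] i l by (intro integral_mono young_abs) auto
  also have "\<dots> = (LINT x|M. (a x)\<^sup>2) / l + l * (LINT x|M. (b x)\<^sup>2)" using i by simp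
  finally show ?thesis .
qed

text \<open>The iteration controls single time slices only. Tonelli's theorem for the majorant
  \<open>H\<close> turns such bounds into integrability in space-time.\<close>

lemma integrable_slices:
  fixes h H :: "real \<times> 'b::euclidean_space \<Rightarrow> real"
  assumes hm: "h \<in> borel_measurable borel" and Hm: "H \<in> borel_measurable borel"
    and hH: "\<And>z. \<bar>h z\<bar> \<le> H z" and out: "\<And>t x. t \<notin> {a..b} \<Longrightarrow> H (t, x) = 0"
    and B: "\<And>t. t \<in> {a..b} \<Longrightarrow> (\<integral>\<^sup>+x. ennreal (H (t, x)) \<partial>lborel) \<le> ennreal B" and "B \<ge> 0" "a \<le> b"
  shows "integrable lborel h \<and> \<bar>LINT z|lborel. h z\<bar> \<le> B * (b - a)"
proof -
  have "(\<integral>\<^sup>+z. ennreal (H z) \<partial>lborel) = (\<integral>\<^sup>+z. ennreal (H z) \<partial>(lborel \<Otimes>\<^sub>M lborel))"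
    by (simp add: lborel_prod)
  also have "\<dots> = (\<integral>\<^sup>+t. (\<integral>\<^sup>+x. ennreal (H (t, x)) \<partial>lborel) \<partial>lborel)"
    using Hm by (subst lborel.nn_integral_fst[symmetric]) (auto simp: borel_prod[symmetric])
  also have "\<dots> \<le> (\<integral>\<^sup>+t. ennreal B * indicator {a..b} t \<partial>lborel)"
  proof (rule nn_integral_mono)
    fix t show "(\<integral>\<^sup>+x. ennreal (H (t, x)) \<partial>lborel) \<le> ennreal B * indicator {a..b} t"
      using B[of t] out[of t] by (cases "t \<in> {a..b}") auto
  qed
  also have "\<dots> = ennreal (B * (b - a))"
    using \<open>a \<le> b\<close> \<open>B \<ge> 0\<close> by (simp add: nn_integral_cmult_indicator ennreal_mult)
  finally have nH: "(\<integral>\<^sup>+z. ennreal (H z) \<partial>lborel) \<le> ennreal (B * (b - a))" .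
  have nh: "(\<integral>\<^sup>+z. ennreal (norm (h z)) \<partial>lborel) \<le> ennreal (B * (b - a))"
    using hH by (intro order_trans[OF nn_integral_mono nH]) (auto intro: ennreal_leI)
  have i: "integrable lborel h"
    using hm nh by (intro integrableI_bounded) (auto simp: le_less_trans)
  have "\<bar>LINT z|lborel. h z\<bar> \<le> (LINT z|lborel. norm (h z))" using integral_norm_bound[of lborel h] by simp
  also have "\<dots> \<le> B * (b - a)"
    using nh \<open>a \<le> b\<close> \<open>B \<ge> 0\<close> by (intro integral_real_bounded) auto
  finally show ?thesis using i by blast
qed

lemma lborel_integrable_translate:
  fixes f :: "'a::euclidean_space \<Rightarrow> real"
  assumes "integrable lborel f" shows "integrable lborel (\<lambda>z. f (z + c))"
proof -
  have "integrable (distr lborel borel ((+) c)) f" using assms by (simp add: lborel_distr_plus)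
  then have "integrable lborel (\<lambda>z. f (c + z))"
    using assms by (subst (asm) integrable_distr_eq) auto
  then show ?thesis by (simp add: add.commute)
qed

text \<open>
  The cell of a torus direction: a shift by \<open>s p\<close> moves the part of the cell where the coordinate
  \<open>co\<close> is below \<open>s\<close> to the other end, where periodicity identifies it with itself.
\<close>

lemma periodic_cell_shift:
  fixes f co :: "'a::euclidean_space \<Rightarrow> real"
  assumes S0: "S0 \<in> sets borel" "\<And>z s. z + s *\<^sub>R p \<in> S0 \<longleftrightarrow> z \<in> S0"
    and co: "co \<in> borel_measurable borel" "\<And>z s. co (z + s *\<^sub>R p) = co z + s"
    and S: "S = {z \<in> S0. 0 \<le> co z \<and> co z < 1}"
    and f: "f \<in> borel_measurable borel" "\<And>z. f (z + p) = f z" "integrable lborel (\<lambda>z. indicator S z * f z)"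
    and s: "0 < s" "s \<le> 1"
  shows "(LINT z|lborel. indicator S z * f (z + s *\<^sub>R p)) = (LINT z|lborel. indicator S z * f z)"
proof -
  have Sm: "S \<in> sets borel"
  proof -
    have "S = S0 \<inter> {z \<in> space borel. 0 \<le> co z} \<inter> {z \<in> space borel. co z < 1}" by (auto simp: S)
    also have "\<dots> \<in> sets borel" using S0 co(1) by (intro sets.Int borel_measurable_le borel_measurable_less) auto
    finally show ?thesis .
  qed
  define lo where "lo = S \<inter> {z. co z < s}"
  define hi where "hi = S \<inter> {z. s \<le> co z}"
  have lom: "lo \<in> sets borel" "hi \<in> sets borel"
  proof -
    have "lo = S \<inter> {z \<in> space borel. co z < s}" "hi = S \<inter> {z \<in> space borel. s \<le> co z}" by (auto simp: lo_def hi_def)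
    moreover have "{z \<in> space borel. co z < s} \<in> sets borel" "{z \<in> space borel. s \<le> co z} \<in> sets borel"
      using co(1) by (auto intro: borel_measurable_le borel_measurable_less)
    ultimately show "lo \<in> sets borel" "hi \<in> sets borel" using Sm by auto
  qed
  have i: "integrable lborel (\<lambda>z. indicator lo z * f z)" "integrable lborel (\<lambda>z. indicator hi z * f z)"
  proof -
    have "(\<lambda>z. indicator lo z * f z) = (\<lambda>z. indicator lo z *\<^sub>R (indicator S z * f z))"
      "(\<lambda>z. indicator hi z * f z) = (\<lambda>z. indicator hi z *\<^sub>R (indicator S z * f z))"
      by (auto simp: lo_def hi_def indicator_def fun_eq_iff)
    then show "integrable lborel (\<lambda>z. indicator lo z * f z)" "integrable lborel (\<lambda>z. indicator hi z * f z)"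
      using integrable_mult_indicator[OF _ f(3)] lom by simp_all
  qed
  have mem: "z + s' *\<^sub>R p \<in> S \<longleftrightarrow> z \<in> S0 \<and> 0 \<le> co z + s' \<and> co z + s' < 1" for z s'
    by (simp add: S S0(2) co(2))
  \<comment> \<open>The shifted cell s \<le> co < 1 + s consists of \<open>hi\<close> and of the
    translate of \<open>lo\<close> by one period.\<close>
  have eq: "indicator S (z + (- s) *\<^sub>R p) = indicator hi z + (indicator lo (z + (- 1) *\<^sub>R p) :: real)" for z
  proof -
    have "z + (- 1) *\<^sub>R p \<in> lo \<longleftrightarrow> z \<in> S0 \<and> 0 \<le> co z - 1 \<and> co z - 1 < 1 \<and> co z - 1 < s"
      using mem[of z "- 1"] co(2)[of z "- 1"] by (auto simp: lo_def)
    moreover have "z \<in> hi \<longleftrightarrow> z \<in> S0 \<and> 0 \<le> co z \<and> co z < 1 \<and> s \<le> co z" by (auto simp: hi_def S)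
    ultimately show ?thesis using mem[of z "- s"] s by (auto simp: indicator_def)
  qed
  have "(LINT z|lborel. indicator S z * f (z + s *\<^sub>R p))
     = (LINT z|lborel. indicator S (z + (- s) *\<^sub>R p) * f z)"
  proof -
    have "(\<lambda>z. indicator S (z + (- s) *\<^sub>R p)) \<in> borel_measurable borel"
      using Sm by measurable
    then have "(\<lambda>z. indicator S (z + (- s) *\<^sub>R p) * f z) \<in> borel_measurable borel" using f(1) by measurable
    from lborel_integral_translate[OF this, of "s *\<^sub>R p"] show ?thesis by simp
  qed
  also have "\<dots> = (LINT z|lborel. indicator hi z * f z + indicator lo (z + (- 1) *\<^sub>R p) * f z)"
    by (simp only: eq distrib_right)
  also have "\<dots> = (LINT z|lborel. indicator hi z * f z + indicator lo (z + (- 1) *\<^sub>R p) * f (z + (- 1) *\<^sub>R p))"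
  proof -
    have "f (z + (- 1) *\<^sub>R p) = f z" for z using f(2)[of "z + (- 1) *\<^sub>R p"] by simp
    then show ?thesis by (simp only:)
  qed
  also have "\<dots> = (LINT z|lborel. indicator hi z * f z)
      + (LINT z|lborel. indicator lo (z + (- 1) *\<^sub>R p) * f (z + (- 1) *\<^sub>R p))"
    using i(2) lborel_integrable_translate[OF i(1)] by (rule Bochner_Integration.integral_add)
  also have "(LINT z|lborel. indicator lo (z + (- 1) *\<^sub>R p) * f (z + (- 1) *\<^sub>R p)) = (LINT z|lborel. indicator lo z * f z)"
    by (rule lborel_integral_translate[of "\<lambda>z. indicator lo z * f z"]) (use lom f in measurable)
  also have "(LINT z|lborel. indicator hi z * f z) + (LINT z|lborel. indicator lo z * f z)
      = (LINT z|lborel. indicator hi z * f z + indicator lo z * f z)"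
    using i by simp
  also have "\<dots> = (LINT z|lborel. indicator S z * f z)"
    by (intro Bochner_Integration.integral_cong) (auto simp: lo_def hi_def indicator_def)
  finally show ?thesis .
qed

lemma tendsto_geometric_bound:
  fixes x B s :: real
  assumes s: "0 < s" "s < 1" and b: "\<And>k. \<bar>x\<bar> \<le> B * s ^ k"
  shows "x = 0"
proof -
  have "(\<lambda>k. B * s ^ k) \<longlonglongrightarrow> B * 0" using s by (intro tendsto_intros LIMSEQ_realpow_zero) auto
  then have "\<bar>x\<bar> \<le> B * 0" using b by (intro LIMSEQ_le_const) auto
  then show ?thesis by simp
qed

text \<open>Rates appear as squares of s^k because Young's inequality with weight s^k turns them
  into s^k. The constant may depend on \<tau>, as the convergence is not uniform near t = 0; by
  \<open>base\<close> the limit at t = 0 is exactly the constant flow.\<close>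

locale wild_limit =
  fixes A c L s :: real and w1 w2 R11 R12 R22 :: "nat \<Rightarrow> ('n::{finite,linorder}) field" and W1 W2 :: "'n field"
  assumes c: "c > 0" and L: "L > 0" and s: "0 < s" "s < 1"
    and sub: "\<And>k. subsolution A c (w1 k) (w2 k) (R11 k) (R12 k) (R22 k)"
    and Wm: "W1 \<in> borel_measurable borel" "W2 \<in> borel_measurable borel"
    and base: "\<And>z. z \<notin> {0<..} \<times> box 0 1 \<Longrightarrow> W1 z = A \<and> W2 z = 0"
    and conv: "\<And>\<tau>. \<tau> > 0 \<Longrightarrow> \<exists>C\<ge>0. \<forall>t\<in>{\<tau>..L}. \<forall>k. defect (R11 k) (R22 k) t \<le> C * (s ^ k)\<^sup>2 \<and>
       integrable lborel (\<lambda>x. (W1 (t, x) - w1 k (t, x))\<^sup>2) \<and> (LINT x|lborel. (W1 (t, x) - w1 k (t, x))\<^sup>2) \<le> C * (s ^ k)\<^sup>2 \<and>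
       integrable lborel (\<lambda>x. (W2 (t, x) - w2 k (t, x))\<^sup>2) \<and> (LINT x|lborel. (W2 (t, x) - w2 k (t, x))\<^sup>2) \<le> C * (s ^ k)\<^sup>2"
begin

abbreviation converges_from :: "real \<Rightarrow> real \<Rightarrow> bool" where
  "converges_from C \<tau> \<equiv> \<forall>t\<in>{\<tau>..L}. \<forall>k. defect (R11 k) (R22 k) t \<le> C * (s ^ k)\<^sup>2 \<and>
       integrable lborel (\<lambda>x. (W1 (t, x) - w1 k (t, x))\<^sup>2) \<and> (LINT x|lborel. (W1 (t, x) - w1 k (t, x))\<^sup>2) \<le> C * (s ^ k)\<^sup>2 \<and>
       integrable lborel (\<lambda>x. (W2 (t, x) - w2 k (t, x))\<^sup>2) \<and> (LINT x|lborel. (W2 (t, x) - w2 k (t, x))\<^sup>2) \<le> C * (s ^ k)\<^sup>2"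

lemma sk: "0 < s ^ k" "s ^ k \<le> 1"
  using s by (auto intro: power_le_one)

lemma cont: "continuous_on UNIV (w1 k)" "continuous_on UNIV (w2 k)"
    "continuous_on UNIV (R11 k)" "continuous_on UNIV (R12 k)" "continuous_on UNIV (R22 k)"
  using sub[of k] unfolding subsolution_def by blast+

lemma wbase: "z \<notin> {0<..} \<times> box 0 1 \<Longrightarrow> w1 k z = A" "z \<notin> {0<..} \<times> box 0 1 \<Longrightarrow> w2 k z = 0"
  using subsolution_base[OF sub] by blast+

lemma meas_slice:
  fixes f :: "'n field"
  assumes "f \<in> borel_measurable borel" shows "(\<lambda>x. f (t, x)) \<in> borel_measurable borel"
  using measurable_compose[of "Pair t" borel borel f borel] assms
  by (simp add: borel_measurable_continuous_onI continuous_on_Pair)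

lemma meas_w: "w1 k \<in> borel_measurable borel" "w2 k \<in> borel_measurable borel"
    "R11 k \<in> borel_measurable borel" "R12 k \<in> borel_measurable borel" "R22 k \<in> borel_measurable borel"
  using cont by (auto intro: borel_measurable_continuous_onI)

lemmas meas_slices = meas_slice[OF Wm(1)] meas_slice[OF Wm(2)] meas_slice[OF meas_w(1)] meas_slice[OF meas_w(2)]
  meas_slice[OF meas_w(3)] meas_slice[OF meas_w(4)] meas_slice[OF meas_w(5)]

lemma w_integrable:
  "integrable lborel (\<lambda>x. (w1 k (t, x) - A)\<^sup>2)" "integrable lborel (\<lambda>x. (w2 k (t, x))\<^sup>2)"
proof -
  have b: "bounded (box 0 (1 :: 'n rvec))" by simp
  have o: "w1 k (t, x) - A = 0" "w2 k (t, x) = 0" if "x \<notin> box 0 1" for x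
    using wbase[of "(t, x)" k] that by auto
  obtain B where B: "\<And>x. x \<in> box 0 (1 :: 'n rvec) \<Longrightarrow> norm x \<le> B" using b bounded_iff by metis
  have o': "w1 k (t, x) - A = 0" "w2 k (t, x) = 0" if "norm x > B" for x
    using o[of x] B[of x] that by force+
  have "continuous_on UNIV (\<lambda>x. (w1 k (t, x) - A)\<^sup>2)" "continuous_on UNIV (\<lambda>x. (w2 k (t, x))\<^sup>2)"
    by (intro continuous_intros continuous_slice cont)+
  then show "integrable lborel (\<lambda>x. (w1 k (t, x) - A)\<^sup>2)" "integrable lborel (\<lambda>x. (w2 k (t, x))\<^sup>2)"
    using o' by (auto intro!: integrable_continuous_support[where B = B])
qed

lemma w_deviation:
  "(LINT x|lborel. (w1 k (t, x) - A)\<^sup>2) + (LINT x|lborel. (w2 k (t, x))\<^sup>2) = c * t - defect (R11 k) (R22 k) t"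
  using deviation_defect[OF sub, of k t] w_integrable[of k t] by simp

lemma W_integrable:
  assumes "t \<in> {0<..L}"
  shows "integrable lborel (\<lambda>x. (W1 (t, x) - A)\<^sup>2)" "integrable lborel (\<lambda>x. (W2 (t, x))\<^sup>2)"
proof -
  obtain C where C: "converges_from C t"
    using conv[of t] assms by auto
  have i: "integrable lborel (\<lambda>x. (W1 (t, x) - w1 0 (t, x))\<^sup>2)" "integrable lborel (\<lambda>x. (W2 (t, x) - w2 0 (t, x))\<^sup>2)"
    using C assms by auto
  have sq: "norm ((a - b)\<^sup>2) \<le> norm (2 * (a - d)\<^sup>2 + 2 * (d - b)\<^sup>2)" for a b d :: real
  proof -
    have "(a - b)\<^sup>2 + ((a - d) - (d - b))\<^sup>2 = 2 * (a - d)\<^sup>2 + 2 * (d - b)\<^sup>2"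
      by (simp add: power2_eq_square algebra_simps)
    then have "(a - b)\<^sup>2 \<le> 2 * (a - d)\<^sup>2 + 2 * (d - b)\<^sup>2" using zero_le_power2[of "(a - d) - (d - b)"] by linarith
    then show ?thesis by simp
  qed
  show "integrable lborel (\<lambda>x. (W1 (t, x) - A)\<^sup>2)"
  proof (rule Bochner_Integration.integrable_bound)
    show "integrable lborel (\<lambda>x. 2 * (W1 (t, x) - w1 0 (t, x))\<^sup>2 + 2 * (w1 0 (t, x) - A)\<^sup>2)"
      using i w_integrable[of 0 t] by simp
  qed (use meas_slices sq in \<open>auto intro!: AE_I2\<close>)
  show "integrable lborel (\<lambda>x. (W2 (t, x))\<^sup>2)"
  proof (rule Bochner_Integration.integrable_bound)
    show "integrable lborel (\<lambda>x. 2 * (W2 (t, x) - w2 0 (t, x))\<^sup>2 + 2 * (w2 0 (t, x) - 0)\<^sup>2)"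
      using i w_integrable[of 0 t] by simp
    show "AE x in lborel. norm ((W2 (t, x))\<^sup>2) \<le> norm (2 * (W2 (t, x) - w2 0 (t, x))\<^sup>2 + 2 * (w2 0 (t, x) - 0)\<^sup>2)"
      using sq[of _ 0] by (intro AE_I2) (metis diff_zero)
  qed (use meas_slices in auto)
qed

text \<open>Young's inequality with weight s^k. Uniformity in t makes the pairings converge
  uniformly, hence to a continuous limit; the same bound carries the zero divergence over to the
  limit.\<close>

lemma weak_approx:
  assumes "\<tau> > 0"
  obtains C where "C \<ge> 0" "\<And>p1 p2 t k. p1 \<in> borel_measurable borel \<Longrightarrow> p2 \<in> borel_measurable borel \<Longrightarrow>
     integrable lborel (\<lambda>x. (p1 x)\<^sup>2) \<Longrightarrow> integrable lborel (\<lambda>x. (p2 x)\<^sup>2) \<Longrightarrow> t \<in> {\<tau>..L} \<Longrightarrow>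
     \<bar>(LINT x|lborel. (W1 (t, x) - A) * p1 x + W2 (t, x) * p2 x) - (LINT x|lborel. (w1 k (t, x) - A) * p1 x + w2 k (t, x) * p2 x)\<bar>
       \<le> (C + (LINT x|lborel. (p1 x)\<^sup>2) + (LINT x|lborel. (p2 x)\<^sup>2)) * s ^ k"
proof -
  obtain C where C0: "C \<ge> 0" and C: "converges_from C \<tau>"
    using conv[OF assms] by blast
  show ?thesis
  proof (rule that[OF C0])
    fix p1 p2 :: "'n rvec \<Rightarrow> real" and t :: real and k :: nat
    assume pm: "p1 \<in> borel_measurable borel" "p2 \<in> borel_measurable borel"
      and pi: "integrable lborel (\<lambda>x. (p1 x)\<^sup>2)" "integrable lborel (\<lambda>x. (p2 x)\<^sup>2)" and t: "t \<in> {\<tau>..L}"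
    have i: "integrable lborel (\<lambda>x. (W1 (t, x) - w1 k (t, x))\<^sup>2)" "integrable lborel (\<lambda>x. (W2 (t, x) - w2 k (t, x))\<^sup>2)"
      and b: "(LINT x|lborel. (W1 (t, x) - w1 k (t, x))\<^sup>2) \<le> C * (s ^ k)\<^sup>2" "(LINT x|lborel. (W2 (t, x) - w2 k (t, x))\<^sup>2) \<le> C * (s ^ k)\<^sup>2"
      using C t by blast+
    have am: "(\<lambda>x. W1 (t, x) - w1 k (t, x)) \<in> borel_measurable lborel" "(\<lambda>x. W2 (t, x) - w2 k (t, x)) \<in> borel_measurable lborel"
      "(\<lambda>x. w1 k (t, x) - A) \<in> borel_measurable lborel" "(\<lambda>x. w2 k (t, x)) \<in> borel_measurable lborel"
      "p1 \<in> borel_measurable lborel" "p2 \<in> borel_measurable lborel"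
      using meas_slices pm by auto
    have j: "integrable lborel (\<lambda>x. (W1 (t, x) - w1 k (t, x)) * p1 x)" "integrable lborel (\<lambda>x. (W2 (t, x) - w2 k (t, x)) * p2 x)"
      "integrable lborel (\<lambda>x. (w1 k (t, x) - A) * p1 x)" "integrable lborel (\<lambda>x. w2 k (t, x) * p2 x)"
      using am i pi w_integrable[of k t] by (auto intro: integrable_square_product)
    have half: "2 * \<bar>I\<bar> \<le> (C + P) * s ^ k" if "2 * \<bar>I\<bar> \<le> X / s ^ k + s ^ k * P" "X \<le> C * (s ^ k)\<^sup>2" for I X P
    proof -
      have "X / s ^ k \<le> C * (s ^ k)\<^sup>2 / s ^ k" using that(2) sk[of k] by (intro divide_right_mono) auto
      also have "\<dots> = C * s ^ k" using sk[of k] by (simp add: power2_eq_square)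
      finally show ?thesis using that(1) by (simp add: algebra_simps)
    qed
    have y1: "2 * \<bar>LINT x|lborel. (W1 (t, x) - w1 k (t, x)) * p1 x\<bar> \<le> (C + (LINT x|lborel. (p1 x)\<^sup>2)) * s ^ k"
      by (rule half[OF young_integral[OF am(1,5) i(1) pi(1) sk(1)] b(1)])
    have y2: "2 * \<bar>LINT x|lborel. (W2 (t, x) - w2 k (t, x)) * p2 x\<bar> \<le> (C + (LINT x|lborel. (p2 x)\<^sup>2)) * s ^ k"
      by (rule half[OF young_integral[OF am(2,6) i(2) pi(2) sk(1)] b(2)])
    have "(W1 (t, x) - A) * p1 x + W2 (t, x) * p2 x = ((W1 (t, x) - w1 k (t, x)) * p1 x + (W2 (t, x) - w2 k (t, x)) * p2 x)
        + ((w1 k (t, x) - A) * p1 x + w2 k (t, x) * p2 x)" for x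
      by (simp add: algebra_simps)
    then have "(LINT x|lborel. (W1 (t, x) - A) * p1 x + W2 (t, x) * p2 x)
      = (LINT x|lborel. ((W1 (t, x) - w1 k (t, x)) * p1 x + (W2 (t, x) - w2 k (t, x)) * p2 x)
        + ((w1 k (t, x) - A) * p1 x + w2 k (t, x) * p2 x))" by (simp only:)
    also have "\<dots> = (LINT x|lborel. (W1 (t, x) - w1 k (t, x)) * p1 x) + (LINT x|lborel. (W2 (t, x) - w2 k (t, x)) * p2 x)
        + (LINT x|lborel. (w1 k (t, x) - A) * p1 x + w2 k (t, x) * p2 x)"
      using j by (simp only: Bochner_Integration.integral_add Bochner_Integration.integrable_add)
    finally have EQ: "(LINT x|lborel. (W1 (t, x) - A) * p1 x + W2 (t, x) * p2 x)
      = (LINT x|lborel. (W1 (t, x) - w1 k (t, x)) * p1 x) + (LINT x|lborel. (W2 (t, x) - w2 k (t, x)) * p2 x)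
        + (LINT x|lborel. (w1 k (t, x) - A) * p1 x + w2 k (t, x) * p2 x)" .
    show "\<bar>(LINT x|lborel. (W1 (t, x) - A) * p1 x + W2 (t, x) * p2 x) - (LINT x|lborel. (w1 k (t, x) - A) * p1 x + w2 k (t, x) * p2 x)\<bar>
       \<le> (C + (LINT x|lborel. (p1 x)\<^sup>2) + (LINT x|lborel. (p2 x)\<^sup>2)) * s ^ k"
    proof -
      have avg: "2 * a \<le> x \<Longrightarrow> 2 * b \<le> y \<Longrightarrow> a + b \<le> (x + y) / 2" for a b x y :: real by simp
      have "\<bar>LINT x|lborel. (W1 (t, x) - w1 k (t, x)) * p1 x\<bar> + \<bar>LINT x|lborel. (W2 (t, x) - w2 k (t, x)) * p2 x\<bar>
          \<le> ((C + (LINT x|lborel. (p1 x)\<^sup>2)) * s ^ k + (C + (LINT x|lborel. (p2 x)\<^sup>2)) * s ^ k) / 2"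
        by (rule avg[OF y1 y2])
      moreover have "(LINT x|lborel. (p1 x)\<^sup>2) * s ^ k \<ge> 0" "(LINT x|lborel. (p2 x)\<^sup>2) * s ^ k \<ge> 0"
        using sk[of k] by (auto intro!: mult_nonneg_nonneg integral_nonneg_AE AE_I2)
      moreover have "\<bar>G - g\<bar> \<le> x + p + q" if "G = I1 + I2 + g" "\<bar>I1\<bar> + \<bar>I2\<bar> \<le> ((x + p) + (x + q)) / 2"
          "0 \<le> p" "0 \<le> q" for G g I1 I2 x p q :: real
        using that by (simp add: field_simps)
      ultimately show ?thesis
        using EQ unfolding distrib_right by blast
    qed
  qed
qed

text \<open>Strong convergence passes \<open>w_deviation\<close> to the limit: the defect disappears
  and the flow carries all of c t.\<close>

lemma slice_deviation:
  assumes t: "t \<in> {0<..L}"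
  shows "(LINT x|lborel. (W1 (t, x) - A)\<^sup>2 + (W2 (t, x))\<^sup>2) = c * t"
proof -
  obtain C where C0: "C \<ge> 0" and C: "converges_from C t"
    using conv[of t] t by auto
  let ?E = "(LINT x|lborel. (W1 (t, x) - A)\<^sup>2 + (W2 (t, x))\<^sup>2)"
  \<comment> \<open>The constant 5 C counts two squared errors, two error terms of Young's
    inequality and the defect; c t bounds the squared deviation of the approximation.\<close>
  have "\<bar>?E - c * t\<bar> \<le> (5 * C + c * t) * s ^ k" for k
  proof -
    let ?a1 = "\<lambda>x. W1 (t, x) - w1 k (t, x)" and ?a2 = "\<lambda>x. W2 (t, x) - w2 k (t, x)"
    let ?b1 = "\<lambda>x. w1 k (t, x) - A" and ?b2 = "\<lambda>x. w2 k (t, x)"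
    have D: "defect (R11 k) (R22 k) t \<le> C * (s ^ k)\<^sup>2" "defect (R11 k) (R22 k) t \<ge> 0"
      and i: "integrable lborel (\<lambda>x. (?a1 x)\<^sup>2)" "integrable lborel (\<lambda>x. (?a2 x)\<^sup>2)"
      and b: "(LINT x|lborel. (?a1 x)\<^sup>2) \<le> C * (s ^ k)\<^sup>2" "(LINT x|lborel. (?a2 x)\<^sup>2) \<le> C * (s ^ k)\<^sup>2"
      using C t defect_nonneg[OF sub, of t k] by auto
    have am: "?a1 \<in> borel_measurable lborel" "?a2 \<in> borel_measurable lborel"
      "?b1 \<in> borel_measurable lborel" "?b2 \<in> borel_measurable lborel"
      using meas_slices by auto
    note y1 = young_integral[OF am(1,3) i(1) w_integrable(1) sk(1), of k]
    note y2 = young_integral[OF am(2,4) i(2) w_integrable(2) sk(1), of k]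
    have j: "integrable lborel (\<lambda>x. ?a1 x * ?b1 x)" "integrable lborel (\<lambda>x. ?a2 x * ?b2 x)"
      using am i w_integrable[of k t] by (auto intro: integrable_square_product)
    have "?E = (LINT x|lborel. (?a1 x)\<^sup>2 + (?a2 x)\<^sup>2 + 2 * (?a1 x * ?b1 x) + 2 * (?a2 x * ?b2 x) + (?b1 x)\<^sup>2 + (?b2 x)\<^sup>2)"
      by (intro Bochner_Integration.integral_cong refl) (simp add: power2_eq_square algebra_simps)
    also have "\<dots> = (LINT x|lborel. (?a1 x)\<^sup>2) + (LINT x|lborel. (?a2 x)\<^sup>2) + 2 * (LINT x|lborel. ?a1 x * ?b1 x)
        + 2 * (LINT x|lborel. ?a2 x * ?b2 x) + (LINT x|lborel. (?b1 x)\<^sup>2) + (LINT x|lborel. (?b2 x)\<^sup>2)"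
    proof -
      have "(LINT x|lborel. f1 x + f2 x + 2 * f3 x + 2 * f4 x + f5 x + f6 x)
        = (LINT x|lborel. f1 x) + (LINT x|lborel. f2 x) + 2 * (LINT x|lborel. f3 x) + 2 * (LINT x|lborel. f4 x)
          + (LINT x|lborel. f5 x) + (LINT x|lborel. f6 x)"
        if "integrable lborel f1" "integrable lborel f2" "integrable lborel f3" "integrable lborel f4"
          "integrable lborel f5" "integrable lborel f6" for f1 f2 f3 f4 f5 f6 :: "'n rvec \<Rightarrow> real"
        using that by simp
      from this[OF i j w_integrable] show ?thesis .
    qed
    finally have E: "?E - c * t = (LINT x|lborel. (?a1 x)\<^sup>2) + (LINT x|lborel. (?a2 x)\<^sup>2) + 2 * (LINT x|lborel. ?a1 x * ?b1 x)
        + 2 * (LINT x|lborel. ?a2 x * ?b2 x) - defect (R11 k) (R22 k) t"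
      using w_deviation[of k t] by simp
    have ss: "(s ^ k)\<^sup>2 \<le> s ^ k" using sk[of k] by (simp add: power2_eq_square mult_left_le)
    then have Css: "C * (s ^ k)\<^sup>2 \<le> C * s ^ k" using C0 by (intro mult_left_mono)
    have dv: "X / s ^ k \<le> C * s ^ k" if "X \<le> C * (s ^ k)\<^sup>2" for X
    proof -
      have "X / s ^ k \<le> C * (s ^ k)\<^sup>2 / s ^ k" using that sk[of k] by (intro divide_right_mono) auto
      then show ?thesis using sk[of k] s(1) by (simp add: power2_eq_square)
    qed
    have sb: "s ^ k * (LINT x|lborel. (?b1 x)\<^sup>2) + s ^ k * (LINT x|lborel. (?b2 x)\<^sup>2) \<le> s ^ k * (c * t)"
    proof -
      have "(LINT x|lborel. (?b1 x)\<^sup>2) + (LINT x|lborel. (?b2 x)\<^sup>2) \<le> c * t" using w_deviation[of k t] D(2) by linarith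
      then show ?thesis using sk[of k] by (simp add: distrib_left[symmetric] mult_left_mono)
    qed
    have nn: "0 \<le> (LINT x|lborel. (?a1 x)\<^sup>2)" "0 \<le> (LINT x|lborel. (?a2 x)\<^sup>2)" by (auto intro!: integral_nonneg_AE AE_I2)
    have exp: "(5 * C + c * t) * s ^ k = 5 * (C * s ^ k) + s ^ k * (c * t)" by (simp add: algebra_simps)
    have C0s: "C * s ^ k \<ge> 0" using C0 sk[of k] by simp
    show ?thesis unfolding E exp using y1 y2 dv[OF b(1)] dv[OF b(2)] b D Css sb nn C0s by linarith
  qed
  then have "?E - c * t = 0" by (rule tendsto_geometric_bound[OF s])
  then show ?thesis by simp
qed

lemma Omega_outside: "x \<notin> Omega \<Longrightarrow> W1 (t, x) = A \<and> W2 (t, x) = 0" "x \<notin> Omega \<Longrightarrow> w1 k (t, x) = A" "x \<notin> Omega \<Longrightarrow> w2 k (t, x) = 0"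
  using base[of "(t, x)"] wbase[of "(t, x)" k] Omega_box(1) by auto

lemma slice_div:
  assumes t: "t \<in> {0<..L}" and \<psi>: "C1 \<psi> \<psi>'"
  shows "(LINT x|lborel. (W1 (t, x) - A) * \<psi>' x ef + W2 (t, x) * \<psi>' x el) = 0"
proof -
  \<comment> \<open>Truncated to \<open>Omega\<close>, the derivatives of the test function are
    square integrable; nothing is lost, as the deviations vanish outside.\<close>
  let ?p1 = "\<lambda>x. indicator Omega x * \<psi>' x ef" and ?p2 = "\<lambda>x. indicator Omega x * \<psi>' x el"
  have pm: "?p1 \<in> borel_measurable borel" "?p2 \<in> borel_measurable borel"
    using borel_measurable_continuous_onI[OF C1_continuous'[OF \<psi>]] by measurable
  have "integrable lborel (\<lambda>x. indicator Omega x * (\<psi>' x p)\<^sup>2)" for p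
    by (intro integrable_Omega continuous_intros C1_continuous'[OF \<psi>])
  moreover have "(indicator Omega x * \<psi>' x p)\<^sup>2 = indicator Omega x * (\<psi>' x p)\<^sup>2" for x p
    by (simp add: indicator_def)
  ultimately have pi: "integrable lborel (\<lambda>x. (?p1 x)\<^sup>2)" "integrable lborel (\<lambda>x. (?p2 x)\<^sup>2)" by simp_all
  obtain C where "\<And>p1 p2 t' k. p1 \<in> borel_measurable borel \<Longrightarrow> p2 \<in> borel_measurable borel \<Longrightarrow>
     integrable lborel (\<lambda>x. (p1 x)\<^sup>2) \<Longrightarrow> integrable lborel (\<lambda>x. (p2 x)\<^sup>2) \<Longrightarrow> t' \<in> {t..L} \<Longrightarrow>
     \<bar>(LINT x|lborel. (W1 (t', x) - A) * p1 x + W2 (t', x) * p2 x) - (LINT x|lborel. (w1 k (t', x) - A) * p1 x + w2 k (t', x) * p2 x)\<bar>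
       \<le> (C + (LINT x|lborel. (p1 x)\<^sup>2) + (LINT x|lborel. (p2 x)\<^sup>2)) * s ^ k"
    by (rule weak_approx[of t]) (use t in auto)
  from this[OF pm pi, of t] t have B: "\<bar>(LINT x|lborel. (W1 (t, x) - A) * ?p1 x + W2 (t, x) * ?p2 x)
      - (LINT x|lborel. (w1 k (t, x) - A) * ?p1 x + w2 k (t, x) * ?p2 x)\<bar>
       \<le> (C + (LINT x|lborel. (?p1 x)\<^sup>2) + (LINT x|lborel. (?p2 x)\<^sup>2)) * s ^ k" for k by simp
  have eW: "(W1 (t, x) - A) * ?p1 x + W2 (t, x) * ?p2 x = (W1 (t, x) - A) * \<psi>' x ef + W2 (t, x) * \<psi>' x el" for x
    using Omega_outside(1)[of x t] by (cases "x \<in> Omega") auto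
  have ew: "(w1 k (t, x) - A) * ?p1 x + w2 k (t, x) * ?p2 x = (w1 k (t, x) - A) * \<psi>' x ef + w2 k (t, x) * \<psi>' x el" for x k
    using Omega_outside(2,3)[of x k t] by (cases "x \<in> Omega") auto
  have 0: "(LINT x|lborel. (w1 k (t, x) - A) * \<psi>' x ef + w2 k (t, x) * \<psi>' x el) = 0" for k
    using sub[of k] \<psi> unfolding subsolution_def perturbation_def by blast
  show ?thesis
    using B unfolding eW ew 0 diff_zero by (rule tendsto_geometric_bound[OF s])
qed

lemma weak_continuity:
  assumes pm: "p1 \<in> borel_measurable borel" "p2 \<in> borel_measurable borel"
    and pi: "integrable lborel (\<lambda>x. (p1 x)\<^sup>2)" "integrable lborel (\<lambda>x. (p2 x)\<^sup>2)"
  shows "continuous_on {0..<L} (\<lambda>t. LINT x|lborel. (W1 (t, x) - A) * p1 x + W2 (t, x) * p2 x)"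
proof -
  let ?G = "\<lambda>t. LINT x|lborel. (W1 (t, x) - A) * p1 x + W2 (t, x) * p2 x"
  let ?g = "\<lambda>k t. LINT x|lborel. (w1 k (t, x) - A) * p1 x + w2 k (t, x) * p2 x"
  let ?P = "(LINT x|lborel. (p1 x)\<^sup>2) + (LINT x|lborel. (p2 x)\<^sup>2)"
  have Ip: "integrable lborel (\<lambda>x. indicator Omega x * p1 x)" "integrable lborel (\<lambda>x. indicator Omega x * p2 x)"
  proof -
    have "(\<lambda>x. (indicator Omega x :: real)\<^sup>2) = indicator (Omega :: 'n rvec set)"
      by (auto simp: indicator_def fun_eq_iff)
    then have "integrable lborel (\<lambda>x. (indicator (Omega :: 'n rvec set) x :: real)\<^sup>2)"
      using emeasure_Omega[where 'n = 'n] by simp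
    then show "integrable lborel (\<lambda>x. indicator Omega x * p1 x)" "integrable lborel (\<lambda>x. indicator Omega x * p2 x)"
      using pm pi by (auto intro!: integrable_square_product)
  qed
  \<comment> \<open>For fixed k the deviation is bounded and vanishes outside \<open>Omega\<close>,
    so dominated convergence along sequences of times applies.\<close>
  have gc: "continuous_on UNIV (?g k)" for k
  proof -
    obtain K where K1: "bounded K" and P: "perturbation K (\<lambda>z. w1 k z - A) (w2 k)
        (\<lambda>z. (w1 k z)\<^sup>2 + R11 k z - A\<^sup>2 - c * fst z / 2)
        (\<lambda>z. w1 k z * w2 k z + R12 k z) (\<lambda>z. (w2 k z)\<^sup>2 + R22 k z - c * fst z / 2)"
      using sub[of k] unfolding subsolution_def by blast
    have K: "bounded K" "\<And>z. z \<notin> K \<Longrightarrow> w1 k z - A = 0" "\<And>z. z \<notin> K \<Longrightarrow> w2 k z = 0"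
      using K1 P unfolding perturbation_def by blast+
    obtain B where B: "\<And>z. z \<in> K \<Longrightarrow> norm z \<le> B" using K(1) bounded_iff by metis
    have c1: "continuous_on UNIV (\<lambda>z. w1 k z - A)" by (intro continuous_intros cont)
    obtain M1 where M1: "M1 > 0" "\<And>z. norm z \<le> B \<Longrightarrow> \<bar>w1 k z - A\<bar> \<le> M1"
      using continuous_bounded_on_ball[OF c1] by blast
    obtain M2 where M2: "M2 > 0" "\<And>z. norm z \<le> B \<Longrightarrow> \<bar>w2 k z\<bar> \<le> M2"
      using continuous_bounded_on_ball[OF cont(2)] by blast
    have b1: "\<bar>w1 k z - A\<bar> \<le> M1" for z using M1 K(2)[of z] B[of z] by (cases "z \<in> K") auto
    have b2: "\<bar>w2 k z\<bar> \<le> M2" for z using M2 K(3)[of z] B[of z] by (cases "z \<in> K") auto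
    show ?thesis
      unfolding continuous_on_sequentially
    proof (intro ballI allI impI)
      fix \<sigma> :: "nat \<Rightarrow> real" and t assume "(\<forall>n. \<sigma> n \<in> UNIV) \<and> \<sigma> \<longlonglongrightarrow> t"
      then have \<sigma>: "\<sigma> \<longlonglongrightarrow> t" by simp
      have lim: "(\<lambda>n. f (\<sigma> n, x)) \<longlonglongrightarrow> f (t, x)" if "continuous_on UNIV f" for f :: "'n field" and x
      proof -
        have "(\<lambda>n. (\<sigma> n, x)) \<longlonglongrightarrow> (t, x)" using \<sigma> by (intro tendsto_intros)
        then show ?thesis using that continuous_on_tendsto_compose[OF that, of "\<lambda>n. (\<sigma> n, x)" "(t, x)"] by simp
      qed
      have "(\<lambda>n. ?g k (\<sigma> n)) \<longlonglongrightarrow> ?g k t"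
      proof (rule integral_dominated_convergence[where w = "\<lambda>x. M1 * \<bar>indicator Omega x * p1 x\<bar> + M2 * \<bar>indicator Omega x * p2 x\<bar>"])
        show "integrable lborel (\<lambda>x. M1 * \<bar>indicator Omega x * p1 x\<bar> + M2 * \<bar>indicator Omega x * p2 x\<bar>)"
          using Ip by simp
        show "AE x in lborel. (\<lambda>n. (w1 k (\<sigma> n, x) - A) * p1 x + w2 k (\<sigma> n, x) * p2 x)
            \<longlonglongrightarrow> (w1 k (t, x) - A) * p1 x + w2 k (t, x) * p2 x"
          by (intro AE_I2 tendsto_intros lim cont)
        show "AE x in lborel. norm ((w1 k (\<sigma> n, x) - A) * p1 x + w2 k (\<sigma> n, x) * p2 x)
          \<le> M1 * \<bar>indicator Omega x * p1 x\<bar> + M2 * \<bar>indicator Omega x * p2 x\<bar>" for n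
        proof (rule AE_I2)
          fix x
          show "norm ((w1 k (\<sigma> n, x) - A) * p1 x + w2 k (\<sigma> n, x) * p2 x)
            \<le> M1 * \<bar>indicator Omega x * p1 x\<bar> + M2 * \<bar>indicator Omega x * p2 x\<bar>"
          proof (cases "x \<in> Omega")
            case True
            have "\<bar>(w1 k (\<sigma> n, x) - A) * p1 x + w2 k (\<sigma> n, x) * p2 x\<bar>
              \<le> \<bar>w1 k (\<sigma> n, x) - A\<bar> * \<bar>p1 x\<bar> + \<bar>w2 k (\<sigma> n, x)\<bar> * \<bar>p2 x\<bar>"
              by (metis abs_mult abs_triangle_ineq)
            also have "\<dots> \<le> M1 * \<bar>p1 x\<bar> + M2 * \<bar>p2 x\<bar>"
              by (intro add_mono mult_right_mono b1 b2) auto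
            finally show ?thesis using True by simp
          qed (use Omega_outside(2,3)[of x k "\<sigma> n"] in simp)
        qed
      qed (use meas_slices pm in auto)
      then show "(?g k \<circ> \<sigma>) \<longlonglongrightarrow> ?g k t" by (simp add: o_def)
    qed
  qed
  have pos: "continuous_on {\<tau>..L} ?G" if \<tau>: "\<tau> > 0" for \<tau>
  proof -
    obtain C where "C \<ge> 0" and C: "\<And>p1 p2 t k. p1 \<in> borel_measurable borel \<Longrightarrow> p2 \<in> borel_measurable borel \<Longrightarrow>
     integrable lborel (\<lambda>x. (p1 x)\<^sup>2) \<Longrightarrow> integrable lborel (\<lambda>x. (p2 x)\<^sup>2) \<Longrightarrow> t \<in> {\<tau>..L} \<Longrightarrow>
     \<bar>(LINT x|lborel. (W1 (t, x) - A) * p1 x + W2 (t, x) * p2 x) - (LINT x|lborel. (w1 k (t, x) - A) * p1 x + w2 k (t, x) * p2 x)\<bar>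
       \<le> (C + (LINT x|lborel. (p1 x)\<^sup>2) + (LINT x|lborel. (p2 x)\<^sup>2)) * s ^ k"
      by (rule weak_approx[OF \<tau>]) blast
    have bd: "\<bar>?G t - ?g k t\<bar> \<le> (C + ?P) * s ^ k" if "t \<in> {\<tau>..L}" for t k
      using C[OF pm pi that, of k] by (simp add: add.assoc)
    have ul: "uniform_limit {\<tau>..L} ?g ?G sequentially"
    proof (rule uniform_limitI)
      fix e :: real assume e: "e > 0"
      have "(\<lambda>k. (C + ?P) * s ^ k) \<longlonglongrightarrow> (C + ?P) * 0" using s by (intro tendsto_intros LIMSEQ_realpow_zero) auto
      then have "\<forall>\<^sub>F k in sequentially. (C + ?P) * s ^ k < e" using e by (simp add: order_tendstoD(2))
      then show "\<forall>\<^sub>F k in sequentially. \<forall>t\<in>{\<tau>..L}. dist (?g k t) (?G t) < e"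
      proof (rule eventually_mono, intro ballI)
        fix k t assume k: "(C + ?P) * s ^ k < e" and t: "t \<in> {\<tau>..L}"
        show "dist (?g k t) (?G t) < e"
          by (subst dist_commute, unfold dist_real_def) (rule le_less_trans[OF bd[OF t] k])
      qed
    qed
    have "\<forall>\<^sub>F k in sequentially. continuous_on {\<tau>..L} (?g k)"
      by (intro always_eventually allI continuous_on_subset[OF gc]) auto
    from uniform_limit_theorem[OF this ul] show ?thesis by simp
  qed
  have G0: "?G 0 = 0" using base by simp
  show ?thesis
    unfolding continuous_on_eq_continuous_within
  proof
    fix t assume t: "t \<in> {0..<L}"
    show "continuous (at t within {0..<L}) ?G"
    proof (cases "t = 0")
      case True
      have "((\<lambda>t. ?G t) \<longlongrightarrow> 0) (at 0 within {0..<L})"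
      proof (rule Lim_null_comparison)
        show "\<forall>\<^sub>F t in at 0 within {0..<L}. norm (?G t) \<le> sqrt t * (c + ?P)"
          unfolding eventually_at
        proof (intro exI[of _ 1] conjI ballI impI)
          fix t assume "t \<in> {0..<L}" "t \<noteq> 0 \<and> dist t 0 < 1"
          then have t: "t \<in> {0<..L}" "t > 0" by auto
          have am: "(\<lambda>x. W1 (t, x) - A) \<in> borel_measurable lborel" "(\<lambda>x. W2 (t, x)) \<in> borel_measurable lborel"
            "p1 \<in> borel_measurable lborel" "p2 \<in> borel_measurable lborel"
            using meas_slices pm by auto
          \<comment> \<open>With weight sqrt t both terms of Young's inequality are of order sqrt t,
            since the squared deviation is c t.\<close>
          have st: "sqrt t > 0" using t by simp
          note y = young_integral[OF am(1,3) W_integrable(1)[OF t(1)] pi(1) st]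
            young_integral[OF am(2,4) W_integrable(2)[OF t(1)] pi(2) st]
          have "integrable lborel (\<lambda>x. (W1 (t, x) - A) * p1 x)" "integrable lborel (\<lambda>x. W2 (t, x) * p2 x)"
            using am W_integrable[OF t(1)] pi by (auto intro: integrable_square_product)
          then have G: "?G t = (LINT x|lborel. (W1 (t, x) - A) * p1 x) + (LINT x|lborel. W2 (t, x) * p2 x)" by simp
          have "(LINT x|lborel. (W1 (t, x) - A)\<^sup>2) + (LINT x|lborel. (W2 (t, x))\<^sup>2) = c * t"
            using slice_deviation[OF t(1)] W_integrable[OF t(1)] by simp
          then have "(LINT x|lborel. (W1 (t, x) - A)\<^sup>2) / sqrt t + (LINT x|lborel. (W2 (t, x))\<^sup>2) / sqrt t = c * t / sqrt t"
            by (simp add: add_divide_distrib[symmetric])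
          also have "\<dots> = c * sqrt t" using t by (simp only: times_divide_eq_right[symmetric] real_div_sqrt)
          finally have e: "(LINT x|lborel. (W1 (t, x) - A)\<^sup>2) / sqrt t + (LINT x|lborel. (W2 (t, x))\<^sup>2) / sqrt t = c * sqrt t" .
          have tri: "2 * \<bar>X + Y\<bar> \<le> d + (b1 + b2)" if "2 * \<bar>X\<bar> \<le> a1 + b1" "2 * \<bar>Y\<bar> \<le> a2 + b2" "a1 + a2 = d"
            for X Y a1 a2 b1 b2 d :: real using that abs_triangle_ineq[of X Y] by argo
          have "2 * \<bar>?G t\<bar> \<le> c * sqrt t + (sqrt t * (LINT x|lborel. (p1 x)\<^sup>2) + sqrt t * (LINT x|lborel. (p2 x)\<^sup>2))"
            unfolding G by (rule tri[OF y e])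
          then have "2 * \<bar>?G t\<bar> \<le> sqrt t * (c + ?P)" by (simp add: distrib_left mult.commute[of c])
          moreover have "0 \<le> \<bar>?G t\<bar>" by simp
          ultimately show "norm (?G t) \<le> sqrt t * (c + ?P)" unfolding real_norm_def by linarith
        qed simp
        have "((\<lambda>t. sqrt t * (c + ?P)) \<longlongrightarrow> sqrt 0 * (c + ?P)) (at 0 within {0..<L})"
          by (intro tendsto_intros)
        then show "((\<lambda>t. sqrt t * (c + ?P)) \<longlongrightarrow> 0) (at 0 within {0..<L})" by simp
      qed
      then show ?thesis unfolding True continuous_within G0 .
    next
      case False
      then have t': "t / 2 > 0" "t \<in> {t / 2..L}" using t by auto
      have "continuous (at t within {t / 2..L}) ?G"
        using pos[OF t'(1)] t'(2) by (simp add: continuous_on_eq_continuous_within)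
      moreover have "at t within {0..<L} = at t within {t / 2..L}"
        by (rule at_within_nhd[of _ "{t / 2<..<L}"]) (use t t' in auto)
      ultimately show ?thesis by simp
    qed
  qed
qed

end

lemma integrable_slab:
  fixes f :: "('n::{finite,linorder}) field"
  assumes f: "continuous_on UNIV f" and out: "\<And>z. fst z \<notin> {a..b} \<Longrightarrow> f z = 0"
  shows "integrable lborel (\<lambda>z. indicator Omega (snd z) * f z)"
proof -
  have bK: "bounded ({a..b} \<times> (Omega :: 'n rvec set))" by (intro bounded_Times Omega_bounded) auto
  then obtain B where B: "\<And>z. z \<in> {a..b} \<times> (Omega :: 'n rvec set) \<Longrightarrow> norm z \<le> B" using bounded_iff by metis
  obtain M where M: "M > 0" "\<And>z. norm z \<le> B \<Longrightarrow> \<bar>f z\<bar> \<le> M" using continuous_bounded_on_ball[OF f] by metis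
  have zero: "indicator Omega (snd z) * f z = 0" if "z \<notin> {a..b} \<times> Omega" for z
    using that out[of z] by (cases z) (auto simp: indicator_def)
  show ?thesis
  proof (rule integrable_bounded_support[where M = M and B = B])
    have "(\<lambda>z. indicator Omega (snd z) :: real) \<in> borel_measurable borel"
      by (rule measurable_compose[OF borel_measurable_continuous_onI[OF continuous_on_snd[OF continuous_on_id]]]) auto
    then show "(\<lambda>z. indicator Omega (snd z) * f z) \<in> borel_measurable borel"
      using borel_measurable_continuous_onI[OF f] by measurable
    show "\<bar>indicator Omega (snd z) * f z\<bar> \<le> M" for z
      using zero[of z] B[of z] M by (cases "z \<in> {a..b} \<times> Omega") (auto simp: indicator_def)
    show "indicator Omega (snd z) * f z = 0" if "norm z > B" for z
      using zero[of z] B[of z] that by force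
  qed
qed

lemma Omega_snd_measurable [measurable]:
  "(\<lambda>z :: real \<times> ('n::{finite,linorder}) rvec. indicator Omega (snd z) :: real) \<in> borel_measurable borel"
  by (rule measurable_compose[OF borel_measurable_continuous_onI[OF continuous_on_snd[OF continuous_on_id]]]) auto

text \<open>
  Bounds the difference of the fluxes of the limit and of an approximation, with \<open>a = W - w\<close>, \<open>b = w\<close>
  and weight \<open>\<sigma>\<close> in Young's inequality.
\<close>

lemma flux_difference_bound:
  fixes \<sigma> G :: real
  assumes \<sigma>: "0 < \<sigma>" "\<sigma> \<le> 1" and G: "G \<ge> 0"
    and g: "\<bar>h1\<bar> \<le> G" "\<bar>h2\<bar> \<le> G" "\<bar>h3\<bar> \<le> G" "\<bar>h4\<bar> \<le> 2 * G" "\<bar>h5\<bar> \<le> G"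
    and R: "posdef r11 r12 r22"
  shows "\<bar>(b1 + a1) * h1 + (b2 + a2) * h2 + (b1 + a1)\<^sup>2 * h3 + (b1 + a1) * (b2 + a2) * h4 + (b2 + a2)\<^sup>2 * h5
      - (b1 * h1 + b2 * h2 + (b1\<^sup>2 + r11) * h3 + (b1 * b2 + r12) * h4 + (b2\<^sup>2 + r22) * h5)\<bar>
    \<le> G * (5 * ((a1\<^sup>2 + a2\<^sup>2) / \<sigma>) + 2 * \<sigma> * (b1\<^sup>2 + b2\<^sup>2 + 1) + 2 * (r11 + r22))"
proof -
  have r: "r11 > 0" "r22 > 0" using posdef_pos[OF R] .
  \<comment> \<open>The iteration controls only the trace, so the off-diagonal entry is estimated by
    it.\<close>
  have r12: "2 * \<bar>r12\<bar> \<le> r11 + r22"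
  proof -
    have "r12\<^sup>2 \<le> r11 * r22" using R by (simp add: posdef_def)
    moreover have "4 * (r11 * r22) \<le> (r11 + r22)\<^sup>2"
      using zero_le_power2[of "r11 - r22"] by (simp add: power2_eq_square algebra_simps)
    ultimately have "(2 * \<bar>r12\<bar>)\<^sup>2 \<le> (r11 + r22)\<^sup>2" by (simp add: power_mult_distrib)
    then show ?thesis by (rule power2_le_imp_le) (use r in simp)
  qed
  have t: "\<bar>x * h\<bar> \<le> B * H" if "\<bar>x\<bar> \<le> B" "\<bar>h\<bar> \<le> H" for x h B H :: real
    using mult_mono[OF that] that by (simp add: abs_mult)
  let ?a = "(a1\<^sup>2 + a2\<^sup>2) / \<sigma>"
  have sq: "x\<^sup>2 \<le> x\<^sup>2 / \<sigma>" for x :: real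
    using \<sigma> mult_right_mono[of \<sigma> 1 "x\<^sup>2"] by (simp add: le_divide_eq mult.commute)
  have one: "2 * \<bar>x\<bar> \<le> x\<^sup>2 / \<sigma> + \<sigma>" for x using young_abs[OF \<sigma>(1), of x 1] by simp
  have prod: "2 * \<bar>x * y\<bar> \<le> x\<^sup>2 / \<sigma> + \<sigma> * y\<^sup>2" for x y by (rule young_abs[OF \<sigma>(1)])
  have aa: "2 * \<bar>a1 * a2\<bar> \<le> a1\<^sup>2 / \<sigma> + a2\<^sup>2 / \<sigma>"
    using young_abs[of 1 a1 a2] sq[of a1] sq[of a2] by simp
  define x1 where "x1 = (\<bar>a1\<bar>)"
  define x3 where "x3 = 2 * \<bar>a1 * b1\<bar> + a1\<^sup>2 + r11"
  define x4 where "x4 = \<bar>a1 * b2\<bar> + \<bar>a2 * b1\<bar> + \<bar>a1 * a2\<bar> + \<bar>r12\<bar>"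
  define x5 where "x5 = 2 * \<bar>a2 * b2\<bar> + a2\<^sup>2 + r22"
  have b3: "\<bar>2 * (a1 * b1) + a1\<^sup>2 - r11\<bar> \<le> x3"
    unfolding x3_def using r zero_le_power2[of a1] by linarith
  have b5: "\<bar>2 * (a2 * b2) + a2\<^sup>2 - r22\<bar> \<le> x5"
    unfolding x5_def using r zero_le_power2[of a2] by linarith
  have b4: "\<bar>a1 * b2 + a2 * b1 + a1 * a2 - r12\<bar> \<le> x4" unfolding x4_def by linarith
  have eq: "(b1 + a1) * h1 + (b2 + a2) * h2 + (b1 + a1)\<^sup>2 * h3 + (b1 + a1) * (b2 + a2) * h4 + (b2 + a2)\<^sup>2 * h5
      - (b1 * h1 + b2 * h2 + (b1\<^sup>2 + r11) * h3 + (b1 * b2 + r12) * h4 + (b2\<^sup>2 + r22) * h5)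
    = a1 * h1 + a2 * h2 + (2 * (a1 * b1) + a1\<^sup>2 - r11) * h3
      + (a1 * b2 + a2 * b1 + a1 * a2 - r12) * h4 + (2 * (a2 * b2) + a2\<^sup>2 - r22) * h5"
    by (simp add: power2_eq_square algebra_simps)
  have "\<bar>a1 * h1 + a2 * h2 + (2 * (a1 * b1) + a1\<^sup>2 - r11) * h3
      + (a1 * b2 + a2 * b1 + a1 * a2 - r12) * h4 + (2 * (a2 * b2) + a2\<^sup>2 - r22) * h5\<bar>
    \<le> \<bar>a1\<bar> * G + \<bar>a2\<bar> * G + x3 * G + x4 * (2 * G) + x5 * G"
    using t[OF order_refl g(1), of a1] t[OF order_refl g(2), of a2] t[OF b3 g(3)] t[OF b4 g(4)] t[OF b5 g(5)]
    by linarith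
  also have "\<dots> = G * (\<bar>a1\<bar> + \<bar>a2\<bar> + x3 + 2 * x4 + x5)" by (simp add: algebra_simps)
  also have "\<dots> \<le> G * (5 * ?a + 2 * \<sigma> * (b1\<^sup>2 + b2\<^sup>2 + 1) + 2 * (r11 + r22))"
  proof (rule mult_left_mono[OF _ G])
    have "\<bar>a1\<bar> + \<bar>a2\<bar> + x3 + 2 * x4 + x5 \<le> 5 * (a1\<^sup>2 / \<sigma> + a2\<^sup>2 / \<sigma>) + (2 * (\<sigma> * b1\<^sup>2) + 2 * (\<sigma> * b2\<^sup>2) + 2 * \<sigma>) + 2 * (r11 + r22)"
    proof -
      have lin: "y1 + y2 + (2 * y3 + q1 + r11) + 2 * (y4 + y5 + y6 + y7) + (2 * y8 + q2 + r22)
          \<le> 5 * (A1 + A2) + (2 * B1 + 2 * B2 + 2 * \<sigma>) + 2 * (r11 + r22)"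
        if "2 * y1 \<le> A1 + \<sigma>" "2 * y2 \<le> A2 + \<sigma>" "2 * y3 \<le> A1 + B1" "2 * y4 \<le> A1 + B2" "2 * y5 \<le> A2 + B1"
          "2 * y6 \<le> A1 + A2" "2 * y7 \<le> r11 + r22" "2 * y8 \<le> A2 + B2" "q1 \<le> A1" "q2 \<le> A2" "0 \<le> y1" "0 \<le> y2" "0 \<le> q1" "0 \<le> q2"
        for y1 y2 y3 y4 y5 y6 y7 y8 q1 q2 A1 A2 B1 B2 :: real
        using that \<sigma> by argo
      show ?thesis unfolding x3_def x4_def x5_def
        by (rule lin[OF one one prod prod prod aa r12 prod sq sq]) auto
    qed
    then show "\<bar>a1\<bar> + \<bar>a2\<bar> + x3 + 2 * x4 + x5 \<le> 5 * ?a + 2 * \<sigma> * (b1\<^sup>2 + b2\<^sup>2 + 1) + 2 * (r11 + r22)"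
      by (simp add: add_divide_distrib algebra_simps)
  qed
  finally show ?thesis unfolding eq .
qed

context wild_limit
begin

lemma energy_integrable:
  assumes S: "0 < S" "S \<le> L"
  shows "integrable lborel (\<lambda>z. indicator ({0<..<S} \<times> Omega) z * ((W1 z)\<^sup>2 + (W2 z)\<^sup>2))"
proof -
  \<comment> \<open>The deviation is square integrable on the whole space, the constant A on
    \<open>Omega\<close> only; hence \<open>W1\<close> is split into these two parts.\<close>
  let ?H = "\<lambda>z. indicator {0..S} (fst z) * (2 * ((W1 z - A)\<^sup>2 + (W2 z)\<^sup>2) + 2 * A\<^sup>2 * indicator Omega (snd z))"
  show ?thesis
  proof (rule integrable_slices[where H = ?H and a = 0 and b = S and B = "2 * (c * S) + 2 * A\<^sup>2", THEN conjunct1])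
    have ind: "indicator ({0<..<S} \<times> Omega) = (\<lambda>z. indicator {0<..<S} (fst z) * indicator Omega (snd z) :: real)"
      by (auto simp: indicator_def fun_eq_iff)
    have fm: "(\<lambda>z :: real \<times> 'n rvec. indicator X (fst z) :: real) \<in> borel_measurable borel" if "X \<in> sets borel" for X
      by (rule measurable_compose[OF borel_measurable_continuous_onI[OF continuous_on_fst[OF continuous_on_id]]]) (use that in auto)
    show "(\<lambda>z. indicator ({0<..<S} \<times> Omega) z * ((W1 z)\<^sup>2 + (W2 z)\<^sup>2)) \<in> borel_measurable borel"
      unfolding ind
      by (intro borel_measurable_times borel_measurable_add borel_measurable_power fm Omega_snd_measurable Wm) auto
    show "?H \<in> borel_measurable borel"
      by (intro borel_measurable_times borel_measurable_add borel_measurable_power borel_measurable_diff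
        borel_measurable_const fm Omega_snd_measurable Wm) auto
    show "\<bar>indicator ({0<..<S} \<times> Omega) z * ((W1 z)\<^sup>2 + (W2 z)\<^sup>2)\<bar> \<le> ?H z" for z
    proof -
      have "(W1 z)\<^sup>2 \<le> 2 * (W1 z - A)\<^sup>2 + 2 * A\<^sup>2"
        using zero_le_power2[of "W1 z - 2 * A"] by (simp add: power2_eq_square algebra_simps)
      then have "(W1 z)\<^sup>2 + (W2 z)\<^sup>2 \<le> 2 * ((W1 z - A)\<^sup>2 + (W2 z)\<^sup>2) + 2 * A\<^sup>2"
        unfolding distrib_left using zero_le_power2[of "W2 z"] by linarith
      then show ?thesis by (cases z) (auto simp: indicator_def)
    qed
    show "(\<integral>\<^sup>+x. ennreal (?H (t, x)) \<partial>lborel) \<le> ennreal (2 * (c * S) + 2 * A\<^sup>2)" if t: "t \<in> {0..S}" for t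
    proof (cases "t = 0")
      case True
      have "(\<integral>\<^sup>+x. ennreal (?H (t, x)) \<partial>lborel) = (\<integral>\<^sup>+x. ennreal (2 * A\<^sup>2) * indicator (Omega :: 'n rvec set) x \<partial>lborel)"
        using True base S by (intro nn_integral_cong) (auto simp: indicator_def)
      also have "\<dots> = ennreal (2 * A\<^sup>2) * emeasure lborel (Omega :: 'n rvec set)" by (simp add: nn_integral_cmult_indicator)
      also have "emeasure lborel (Omega :: 'n rvec set) = 1"
        using emeasure_eq_ennreal_measure[of lborel "Omega :: 'n rvec set"] emeasure_Omega[where 'n = 'n] measure_Omega[where 'n = 'n] by simp
      finally show ?thesis using c S by (simp add: ennreal_leI)
    next
      case False
      then have t': "t \<in> {0<..L}" using t S by auto
      have i: "integrable lborel (\<lambda>x. (W1 (t, x) - A)\<^sup>2 + (W2 (t, x))\<^sup>2)" "integrable lborel (\<lambda>x. indicator (Omega :: 'n rvec set) x :: real)"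
        using W_integrable[OF t'] emeasure_Omega[where 'n = 'n] by auto
      have "(\<integral>\<^sup>+x. ennreal (?H (t, x)) \<partial>lborel)
         = (\<integral>\<^sup>+x. ennreal (2 * ((W1 (t, x) - A)\<^sup>2 + (W2 (t, x))\<^sup>2) + 2 * A\<^sup>2 * indicator Omega x) \<partial>lborel)"
        using t by simp
      also have "\<dots> = ennreal (LINT x|lborel. 2 * ((W1 (t, x) - A)\<^sup>2 + (W2 (t, x))\<^sup>2) + 2 * A\<^sup>2 * indicator Omega x)"
        using i W_integrable[OF t'] by (intro nn_integral_eq_integral AE_I2) auto
      also have "(LINT x|lborel. 2 * ((W1 (t, x) - A)\<^sup>2 + (W2 (t, x))\<^sup>2) + 2 * A\<^sup>2 * indicator Omega x)
         = 2 * (c * t) + 2 * A\<^sup>2"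
        using i W_integrable[OF t'] slice_deviation[OF t'] measure_Omega[where 'n = 'n] by simp
      also have "ennreal (2 * (c * t) + 2 * A\<^sup>2) \<le> ennreal (2 * (c * S) + 2 * A\<^sup>2)"
        using t c by (intro ennreal_leI) auto
      finally show ?thesis .
    qed
  qed (use S c in auto)
qed

text \<open>A subsolution differs from the background A e1 with stress (c t / 2) I by a
  perturbation, whose tested equation holds on the whole space; \<open>B1\<close>, \<open>B2\<close>
  and \<open>B3\<close> are the background terms. The test functions stay away from t = 0, so one
  constant of \<open>conv\<close> serves for all times involved.\<close>

lemma momentum_limit:
  assumes g: "C1 g1 g1'" "C1 g2 g2'" and \<delta>: "\<delta> > 0"
    and out: "\<And>z p. fst z \<notin> {\<delta>..L - \<delta>} \<Longrightarrow> g1' z p = 0" "\<And>z p. fst z \<notin> {\<delta>..L - \<delta>} \<Longrightarrow> g2' z p = 0"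
    and B1: "(LINT z|lborel. indicator Omega (snd z) * g1' z dt) = 0"
    and B2: "(LINT z|lborel. indicator Omega (snd z) * ((A\<^sup>2 + c * fst z / 2) * g1' z df)) = 0"
    and B3: "(LINT z|lborel. indicator Omega (snd z) * (c * fst z / 2 * g2' z dl)) = 0"
  shows "(LINT z|lborel. indicator Omega (snd z) * (W1 z * g1' z dt + W2 z * g2' z dt + (W1 z)\<^sup>2 * g1' z df
      + W1 z * W2 z * (g1' z dl + g2' z df) + (W2 z)\<^sup>2 * g2' z dl)) = 0"
proof -
  let ?F = "\<lambda>z. indicator Omega (snd z) * (W1 z * g1' z dt + W2 z * g2' z dt + (W1 z)\<^sup>2 * g1' z df
      + W1 z * W2 z * (g1' z dl + g2' z df) + (W2 z)\<^sup>2 * g2' z dl)"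
  let ?f = "\<lambda>k z. indicator Omega (snd z) * (w1 k z * g1' z dt + w2 k z * g2' z dt + ((w1 k z)\<^sup>2 + R11 k z) * g1' z df
      + (w1 k z * w2 k z + R12 k z) * (g1' z dl + g2' z df) + ((w2 k z)\<^sup>2 + R22 k z) * g2' z dl)"
  define \<tau> where "\<tau> = min \<delta> L"
  have \<tau>: "\<tau> > 0" "\<tau> \<le> L" using \<delta> L by (auto simp: \<tau>_def)
  have out': "g1' z p = 0" "g2' z p = 0" if "fst z \<notin> {\<tau>..L}" for z p
  proof -
    have "{\<delta>..L - \<delta>} \<subseteq> {\<tau>..L}" using \<delta> by (auto simp: \<tau>_def)
    then show "g1' z p = 0" "g2' z p = 0" using out[of z p] that by blast+
  qed
  note cg = C1_continuous'[OF g(1)] C1_continuous'[OF g(2)]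
  have fint: "integrable lborel (?f k)" for k
    by (rule integrable_slab[where a = \<tau> and b = L])
      (use out' in \<open>auto intro!: continuous_intros cont cg\<close>)
  have f0: "(LINT z|lborel. ?f k z) = 0" for k
  proof -
    obtain K where K: "bounded K" "K \<subseteq> {0<..} \<times> box 0 1" and P: "perturbation K (\<lambda>z. w1 k z - A) (w2 k)
        (\<lambda>z. (w1 k z)\<^sup>2 + R11 k z - A\<^sup>2 - c * fst z / 2)
        (\<lambda>z. w1 k z * w2 k z + R12 k z) (\<lambda>z. (w2 k z)\<^sup>2 + R22 k z - c * fst z / 2)"
      using sub[of k] unfolding subsolution_def by blast
    let ?p = "\<lambda>z. (w1 k z - A) * g1' z dt + w2 k z * g2' z dt + ((w1 k z)\<^sup>2 + R11 k z - A\<^sup>2 - c * fst z / 2) * g1' z df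
      + (w1 k z * w2 k z + R12 k z) * (g1' z dl + g2' z df) + ((w2 k z)\<^sup>2 + R22 k z - c * fst z / 2) * g2' z dl"
    have p0: "(LINT z|lborel. ?p z) = 0" using P g unfolding perturbation_def by blast
    have o: "w1 k z - A = 0" "w2 k z = 0" "(w1 k z)\<^sup>2 + R11 k z - A\<^sup>2 - c * fst z / 2 = 0"
      "w1 k z * w2 k z + R12 k z = 0" "(w2 k z)\<^sup>2 + R22 k z - c * fst z / 2 = 0" if "z \<notin> K" for z
      using P that unfolding perturbation_def by blast+
    have pout: "?p z = 0" if "z \<notin> K" for z
      by (subst o(3)[OF that], subst o(4)[OF that], subst o(5)[OF that]) (simp add: o(1,2)[OF that])
    have pint: "integrable lborel ?p"
      by (rule integrable_field(1)[OF _ K(1) pout]) (auto intro!: continuous_intros cont cg)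
    have pO: "?p z = indicator Omega (snd z) * ?p z" for z
    proof (cases "z \<in> K")
      case True
      then have "snd z \<in> box 0 1" using K(2) by auto
      then have "snd z \<in> Omega" by (rule subsetD[OF Omega_box(1)])
      then show ?thesis by simp
    qed (use pout[of z] in simp)
    have j: "integrable lborel (\<lambda>z. indicator Omega (snd z) * g1' z dt)"
      "integrable lborel (\<lambda>z. indicator Omega (snd z) * ((A\<^sup>2 + c * fst z / 2) * g1' z df))"
      "integrable lborel (\<lambda>z. indicator Omega (snd z) * (c * fst z / 2 * g2' z dl))"
      by (rule integrable_slab[where a = \<tau> and b = L]; use out' in \<open>auto intro!: continuous_intros cg\<close>)+
    have "?f k z = indicator Omega (snd z) * ?p z + A * (indicator Omega (snd z) * g1' z dt)
        + indicator Omega (snd z) * ((A\<^sup>2 + c * fst z / 2) * g1' z df)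
        + indicator Omega (snd z) * (c * fst z / 2 * g2' z dl)" for z
      by (simp add: algebra_simps)
    then have "(LINT z|lborel. ?f k z) = (LINT z|lborel. ?p z + A * (indicator Omega (snd z) * g1' z dt)
        + indicator Omega (snd z) * ((A\<^sup>2 + c * fst z / 2) * g1' z df)
        + indicator Omega (snd z) * (c * fst z / 2 * g2' z dl))"
      unfolding pO[symmetric] by (simp only:)
    also have "\<dots> = (LINT z|lborel. ?p z) + A * (LINT z|lborel. indicator Omega (snd z) * g1' z dt)
        + (LINT z|lborel. indicator Omega (snd z) * ((A\<^sup>2 + c * fst z / 2) * g1' z df))
        + (LINT z|lborel. indicator Omega (snd z) * (c * fst z / 2 * g2' z dl))"
    proof -
      have "(LINT z|lborel. f1 z + a * f2 z + f3 z + f4 z)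
        = (LINT z|lborel. f1 z) + a * (LINT z|lborel. f2 z) + (LINT z|lborel. f3 z) + (LINT z|lborel. f4 z)"
        if "integrable lborel f1" "integrable lborel f2" "integrable lborel f3" "integrable lborel f4"
        for a and f1 f2 f3 f4 :: "'n field" using that by simp
      from this[OF pint j] show ?thesis .
    qed
    finally show ?thesis using p0 B1 B2 B3 by simp
  qed
  obtain G where G: "G > 0" "\<And>z. z \<in> {\<tau>..L} \<times> Omega \<Longrightarrow> \<bar>g1' z dt\<bar> \<le> G \<and> \<bar>g2' z dt\<bar> \<le> G \<and>
      \<bar>g1' z df\<bar> \<le> G \<and> \<bar>g1' z dl\<bar> \<le> G \<and> \<bar>g2' z df\<bar> \<le> G \<and> \<bar>g2' z dl\<bar> \<le> G"
  proof -
    have "bounded ({\<tau>..L} \<times> (Omega :: 'n rvec set))" by (intro bounded_Times Omega_bounded) auto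
    then obtain B where B: "\<And>z. z \<in> {\<tau>..L} \<times> (Omega :: 'n rvec set) \<Longrightarrow> norm z \<le> B" using bounded_iff by metis
    define gs where "gs z = \<bar>g1' z dt\<bar> + \<bar>g2' z dt\<bar> + \<bar>g1' z df\<bar> + \<bar>g1' z dl\<bar> + \<bar>g2' z df\<bar> + \<bar>g2' z dl\<bar>" for z
    have "continuous_on UNIV gs" unfolding gs_def by (intro continuous_intros cg)
    then obtain M where M: "M > 0" "\<And>z. norm z \<le> B \<Longrightarrow> \<bar>gs z\<bar> \<le> M" using continuous_bounded_on_ball by blast
    show ?thesis
    proof (rule that[OF M(1)])
      fix z :: "real \<times> 'n rvec" assume "z \<in> {\<tau>..L} \<times> Omega"
      then have "\<bar>gs z\<bar> \<le> M" using M(2) B by blast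
      then show "\<bar>g1' z dt\<bar> \<le> M \<and> \<bar>g2' z dt\<bar> \<le> M \<and>
        \<bar>g1' z df\<bar> \<le> M \<and> \<bar>g1' z dl\<bar> \<le> M \<and> \<bar>g2' z df\<bar> \<le> M \<and> \<bar>g2' z dl\<bar> \<le> M"
        unfolding gs_def by linarith
    qed
  qed
  obtain C where C0: "C \<ge> 0" and C: "converges_from C \<tau>"
    using conv[OF \<tau>(1)] by blast
  \<comment> \<open>A bound for the slice integral of the majorant in \<open>est\<close>, with s^k
    factored out: \<open>10 * C\<close> from the squared errors, the middle term from |w|^2 + 1 on
    \<open>Omega\<close>, and the last \<open>2 * C\<close> from the defect.\<close>
  define B where "B = G * (10 * C + 2 * (2 * (c * L) + 2 * A\<^sup>2 + 1) + 2 * C)"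
  have B0: "B \<ge> 0" unfolding B_def using G(1) C0 c L by (intro mult_nonneg_nonneg add_nonneg_nonneg) auto
  have est: "integrable lborel (\<lambda>z. ?F z - ?f k z) \<and> \<bar>LINT z|lborel. ?F z - ?f k z\<bar> \<le> B * s ^ k * (L - \<tau>)" for k
  proof -
    let ?h = "\<lambda>z. 5 * (((W1 z - w1 k z)\<^sup>2 + (W2 z - w2 k z)\<^sup>2) / s ^ k)
       + 2 * s ^ k * (2 * ((w1 k z - A)\<^sup>2 + (w2 k z)\<^sup>2) + indicator Omega (snd z) * (2 * A\<^sup>2 + 1))
       + 2 * (indicator Omega (snd z) * (R11 k z + R22 k z))"
    let ?H = "\<lambda>z. indicator {\<tau>..L} (fst z) * (G * ?h z)"
    have fm: "(\<lambda>z :: real \<times> 'n rvec. indicator {\<tau>..L} (fst z) :: real) \<in> borel_measurable borel"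
      by (rule measurable_compose[OF borel_measurable_continuous_onI[OF continuous_on_fst[OF continuous_on_id]]]) auto
    have mg: "(\<lambda>z. g1' z p) \<in> borel_measurable borel" "(\<lambda>z. g2' z p) \<in> borel_measurable borel" for p
      by (rule borel_measurable_continuous_onI[OF cg(1)], rule borel_measurable_continuous_onI[OF cg(2)])
    show ?thesis
    proof (rule integrable_slices[where H = ?H])
      show "(\<lambda>z. ?F z - ?f k z) \<in> borel_measurable borel"
        using Wm meas_w[of k] mg by measurable
      show "?H \<in> borel_measurable borel"
        using Wm meas_w[of k] fm by measurable
      show "\<bar>?F z - ?f k z\<bar> \<le> ?H z" for z
      proof (cases "z \<in> {\<tau>..L} \<times> Omega")
        case True
        then have z: "fst z \<in> {\<tau>..L}" "snd z \<in> Omega" by auto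
        have pd: "posdef (R11 k z) (R12 k z) (R22 k z)"
          using sub[of k] z(1) \<tau> unfolding subsolution_def by (cases z) auto
        note gb = G(2)[OF True]
        have g4: "\<bar>g1' z dl + g2' z df\<bar> \<le> 2 * G" using gb by linarith
        let ?X = "G * (5 * (((W1 z - w1 k z)\<^sup>2 + (W2 z - w2 k z)\<^sup>2) / s ^ k) + 2 * s ^ k * ((w1 k z)\<^sup>2 + (w2 k z)\<^sup>2 + 1) + 2 * (R11 k z + R22 k z))"
        have "\<bar>?F z - ?f k z\<bar> \<le> ?X"
          using flux_difference_bound[OF sk, of G "g1' z dt" "g2' z dt" "g1' z df" "g1' z dl + g2' z df" "g2' z dl"
              "R11 k z" "R12 k z" "R22 k z" "w1 k z" "W1 z - w1 k z" "w2 k z" "W2 z - w2 k z" k] gb g4 pd G(1) z(2)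
          by simp
        also have "?X \<le> G * ?h z"
        proof -
          have "(w1 k z)\<^sup>2 \<le> 2 * (w1 k z - A)\<^sup>2 + 2 * A\<^sup>2"
            using zero_le_power2[of "w1 k z - 2 * A"] by (simp add: power2_eq_square algebra_simps)
          then have "(w1 k z)\<^sup>2 + (w2 k z)\<^sup>2 + 1 \<le> 2 * ((w1 k z - A)\<^sup>2 + (w2 k z)\<^sup>2) + (2 * A\<^sup>2 + 1)"
            unfolding distrib_left using zero_le_power2[of "w2 k z"] by linarith
          then have "2 * s ^ k * ((w1 k z)\<^sup>2 + (w2 k z)\<^sup>2 + 1) \<le> 2 * s ^ k * (2 * ((w1 k z - A)\<^sup>2 + (w2 k z)\<^sup>2) + (2 * A\<^sup>2 + 1))"
            using sk[of k] by (intro mult_left_mono) auto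
          then show ?thesis using z(2) G(1) by (intro mult_left_mono) auto
        qed
        finally show ?thesis using z by simp
      next
        case False
        show ?thesis
        proof (cases "fst z \<in> {\<tau>..L}")
          case True
          then have zO: "snd z \<notin> Omega" using False by (cases z) auto
          then have e: "?h z = 5 * (((W1 z - w1 k z)\<^sup>2 + (W2 z - w2 k z)\<^sup>2) / s ^ k)
              + 2 * s ^ k * (2 * ((w1 k z - A)\<^sup>2 + (w2 k z)\<^sup>2))" by simp
          have nn: "0 \<le> 5 * (((W1 z - w1 k z)\<^sup>2 + (W2 z - w2 k z)\<^sup>2) / s ^ k)
              + 2 * s ^ k * (2 * ((w1 k z - A)\<^sup>2 + (w2 k z)\<^sup>2))"
            using sk[of k] by (intro mult_nonneg_nonneg add_nonneg_nonneg divide_nonneg_pos) auto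
          have "0 \<le> G * ?h z" unfolding e using G(1) by (intro mult_nonneg_nonneg[OF _ nn]) simp
          then show ?thesis using True zO by simp
        next
          case F: False
          show ?thesis using out'[OF F] F by simp
        qed
      qed
      show "?H (t, x) = 0" if "t \<notin> {\<tau>..L}" for t x using that by simp
      show "(\<integral>\<^sup>+x. ennreal (?H (t, x)) \<partial>lborel) \<le> ennreal (B * s ^ k)" if t: "t \<in> {\<tau>..L}" for t
      proof -
        have t': "t > 0" using t \<tau> by simp
        have D: "defect (R11 k) (R22 k) t \<le> C * (s ^ k)\<^sup>2" "defect (R11 k) (R22 k) t \<ge> 0"
          and i: "integrable lborel (\<lambda>x. (W1 (t, x) - w1 k (t, x))\<^sup>2)" "integrable lborel (\<lambda>x. (W2 (t, x) - w2 k (t, x))\<^sup>2)"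
          and b: "(LINT x|lborel. (W1 (t, x) - w1 k (t, x))\<^sup>2) \<le> C * (s ^ k)\<^sup>2" "(LINT x|lborel. (W2 (t, x) - w2 k (t, x))\<^sup>2) \<le> C * (s ^ k)\<^sup>2"
          using C t defect_nonneg[OF sub t', of k] by blast+
        have iO: "integrable lborel (\<lambda>x. indicator (Omega :: 'n rvec set) x * (2 * A\<^sup>2 + 1) :: real)"
          using emeasure_Omega[where 'n = 'n] by simp
        have iR: "integrable lborel (\<lambda>x. indicator Omega x * (R11 k (t, x) + R22 k (t, x)))"
          by (intro integrable_Omega continuous_intros continuous_slice cont)
        have lin: "integrable lborel (\<lambda>x. G * (5 * ((f1 x + f2 x) / s ^ k) + 2 * s ^ k * (2 * (f3 x + f4 x) + f5 x) + 2 * f6 x)) \<and>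
          (LINT x|lborel. G * (5 * ((f1 x + f2 x) / s ^ k) + 2 * s ^ k * (2 * (f3 x + f4 x) + f5 x) + 2 * f6 x))
          = G * (5 * (((LINT x|lborel. f1 x) + (LINT x|lborel. f2 x)) / s ^ k)
            + 2 * s ^ k * (2 * ((LINT x|lborel. f3 x) + (LINT x|lborel. f4 x)) + (LINT x|lborel. f5 x)) + 2 * (LINT x|lborel. f6 x))"
          if "integrable lborel f1" "integrable lborel f2" "integrable lborel f3" "integrable lborel f4"
            "integrable lborel f5" "integrable lborel f6" for f1 f2 f3 f4 f5 f6 :: "'n rvec \<Rightarrow> real"
          using that by simp
        note li = lin[OF i w_integrable[of k t] iO iR]
        have Rnn: "0 \<le> R11 k (t, x)" "0 \<le> R22 k (t, x)" for x
        proof -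
          have "posdef (R11 k (t, x)) (R12 k (t, x)) (R22 k (t, x))" using sub[of k] t' unfolding subsolution_def by blast
          then show "0 \<le> R11 k (t, x)" "0 \<le> R22 k (t, x)" using posdef_pos less_imp_le by blast+
        qed
        have "(\<integral>\<^sup>+x. ennreal (?H (t, x)) \<partial>lborel) = (\<integral>\<^sup>+x. ennreal (G * ?h (t, x)) \<partial>lborel)"
          using t by simp
        also have "\<dots> = ennreal (LINT x|lborel. G * ?h (t, x))"
        proof (rule nn_integral_eq_integral)
          show "integrable lborel (\<lambda>x. G * ?h (t, x))" using li by simp
          show "AE x in lborel. 0 \<le> G * ?h (t, x)"
            using G(1) sk[of k] Rnn by (intro AE_I2 mult_nonneg_nonneg add_nonneg_nonneg divide_nonneg_pos) auto
        qed
        also have "\<dots> \<le> ennreal (B * s ^ k)"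
        proof (rule ennreal_leI)
          have I5: "(LINT x|lborel. indicator (Omega :: 'n rvec set) x * (2 * A\<^sup>2 + 1)) = 2 * A\<^sup>2 + 1"
            by (simp add: measure_Omega)
          have "(LINT x|lborel. G * ?h (t, x)) = G * (5 * (((LINT x|lborel. (W1 (t, x) - w1 k (t, x))\<^sup>2) + (LINT x|lborel. (W2 (t, x) - w2 k (t, x))\<^sup>2)) / s ^ k)
            + 2 * s ^ k * (2 * (c * t - defect (R11 k) (R22 k) t) + (2 * A\<^sup>2 + 1)) + 2 * defect (R11 k) (R22 k) t)"
            using conjunct2[OF li] unfolding I5 w_deviation defect_def[symmetric] by simp
          also have "\<dots> \<le> G * (5 * (2 * (C * s ^ k)) + 2 * s ^ k * (2 * (c * L) + (2 * A\<^sup>2 + 1)) + 2 * (C * s ^ k))"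
          proof (rule mult_left_mono[OF _ less_imp_le[OF G(1)]], intro add_mono mult_left_mono)
            have "((LINT x|lborel. (W1 (t, x) - w1 k (t, x))\<^sup>2) + (LINT x|lborel. (W2 (t, x) - w2 k (t, x))\<^sup>2)) / s ^ k
                \<le> (C * (s ^ k)\<^sup>2 + C * (s ^ k)\<^sup>2) / s ^ k"
              using b sk[of k] by (intro divide_right_mono add_mono) auto
            also have "\<dots> = 2 * (C * s ^ k)" using sk[of k] s(1) by (simp add: power2_eq_square field_simps)
            finally show "((LINT x|lborel. (W1 (t, x) - w1 k (t, x))\<^sup>2) + (LINT x|lborel. (W2 (t, x) - w2 k (t, x))\<^sup>2)) / s ^ k
                \<le> 2 * (C * s ^ k)" .
            have "c * t \<le> c * L" using t c by simp
            then show "c * t - defect (R11 k) (R22 k) t \<le> c * L" using D(2) by linarith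
            have "(s ^ k)\<^sup>2 \<le> s ^ k" using sk[of k] by (simp add: power2_eq_square mult_left_le)
            then have "C * (s ^ k)\<^sup>2 \<le> C * s ^ k" using C0 by (intro mult_left_mono)
            then show "defect (R11 k) (R22 k) t \<le> C * s ^ k" using D(1) by linarith
          qed (use sk[of k] in auto)
          also have "\<dots> = B * s ^ k" by (simp add: B_def algebra_simps)
          finally show "(LINT x|lborel. G * ?h (t, x)) \<le> B * s ^ k" .
        qed
        finally show ?thesis .
      qed
      show "0 \<le> B * s ^ k" using B0 sk[of k] by simp
      show "\<tau> \<le> L" by (rule \<tau>(2))
    qed
  qed
  have Fint: "integrable lborel ?F"
  proof -
    have "integrable lborel (\<lambda>z. (?F z - ?f 0 z) + ?f 0 z)"
      using est[of 0] fint[of 0] by (intro Bochner_Integration.integrable_add) auto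
    then show ?thesis by simp
  qed
  have "\<bar>LINT z|lborel. ?F z\<bar> \<le> (B * (L - \<tau>)) * s ^ k" for k
  proof -
    have "(LINT z|lborel. ?F z - ?f k z) = (LINT z|lborel. ?F z) - (LINT z|lborel. ?f k z)"
      by (rule Bochner_Integration.integral_diff[OF Fint fint])
    then show ?thesis using conjunct2[OF est[of k]] f0[of k] by (simp add: mult_ac)
  qed
  then show ?thesis by (rule tendsto_geometric_bound[OF s])
qed

end

lemma wild_limit_exists:
  fixes A c L :: real
  assumes n: "CARD('n::{finite,linorder}) \<ge> 2" and c: "c > 0" and L: "L > 0"
  obtains s w1 w2 R11 R12 R22 and W1 W2 :: "('n::{finite,linorder}) field"
  where "wild_limit A c L s w1 w2 R11 R12 R22 W1 W2"
proof -
  define q where "q = rate CARD('n)"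
  define s where "s = sqrt q"
  have q: "0 < q" "q < 1" using rate_bounds[of "CARD('n)"] by (auto simp: q_def)
  have s: "0 < s" "s < 1" "(s ^ k)\<^sup>2 = q ^ k" for k
    using q by (auto simp: s_def power_mult[symmetric] mult.commute[of k 2]) (simp add: power_mult)
  define good :: "(nat \<Rightarrow> 'n field) \<Rightarrow> (nat \<Rightarrow> 'n field) \<Rightarrow> (nat \<Rightarrow> 'n field) \<Rightarrow> (nat \<Rightarrow> 'n field) \<Rightarrow> (nat \<Rightarrow> 'n field) \<Rightarrow> bool"
    where "good w1 w2 R11 R12 R22 \<longleftrightarrow> (\<forall>k. subsolution A c (w1 k) (w2 k) (R11 k) (R12 k) (R22 k)) \<and>
      (\<forall>\<tau>>0. \<exists>C\<ge>0. \<forall>t\<in>{\<tau>..L}. \<forall>k. defect (R11 k) (R22 k) t \<le> C * q ^ k \<and>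
       (LINT x|lborel. (w1 (Suc k) (t, x) - w1 k (t, x))\<^sup>2 + (w2 (Suc k) (t, x) - w2 k (t, x))\<^sup>2) \<le> C * q ^ k)"
    for w1 w2 R11 R12 R22
  have "\<exists>w1 w2 R11 R12 R22. good w1 w2 R11 R12 R22"
    by (rule subsolution_sequence[OF n c L, of A]) (unfold good_def q_def, blast)
  then obtain w1 w2 R11 R12 R22 where good: "good w1 w2 R11 R12 R22" by blast
  have sub: "subsolution A c (w1 k) (w2 k) (R11 k) (R12 k) (R22 k)" for k using good unfolding good_def by blast
  have dec: "\<exists>C\<ge>0. \<forall>t\<in>{\<tau>..L}. \<forall>k. defect (R11 k) (R22 k) t \<le> C * q ^ k \<and>
       (LINT x|lborel. (w1 (Suc k) (t, x) - w1 k (t, x))\<^sup>2 + (w2 (Suc k) (t, x) - w2 k (t, x))\<^sup>2) \<le> C * q ^ k" if "\<tau> > 0" for \<tau>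
    using good that unfolding good_def by blast
  have cont: "continuous_on UNIV (w1 k)" "continuous_on UNIV (w2 k)" for k
    using sub[of k] unfolding subsolution_def by blast+
  \<comment> \<open>One pointwise limit instead of an L2 limit for each time: this makes
    \<open>W1\<close> and \<open>W2\<close> jointly measurable, and exact at points where all
    approximations agree.\<close>
  define W1 where "W1 z = lim (\<lambda>k. w1 k z)" for z
  define W2 where "W2 z = lim (\<lambda>k. w2 k z)" for z
  have "wild_limit A c L s w1 w2 R11 R12 R22 W1 W2"
  proof
    show "W1 \<in> borel_measurable borel" "W2 \<in> borel_measurable borel"
      unfolding W1_def[abs_def] W2_def[abs_def]
      by (intro borel_measurable_lim_metric borel_measurable_continuous_onI cont)+
    show "W1 z = A \<and> W2 z = 0" if "z \<notin> {0<..} \<times> box 0 1" for z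
      using subsolution_base[OF sub that] by (simp add: W1_def W2_def)
    fix \<tau> :: real assume "\<tau> > 0"
    then obtain C where C0: "C \<ge> 0" and C: "\<And>t k. t \<in> {\<tau>..L} \<Longrightarrow> defect (R11 k) (R22 k) t \<le> C * q ^ k"
       "\<And>t k. t \<in> {\<tau>..L} \<Longrightarrow> (LINT x|lborel. (w1 (Suc k) (t, x) - w1 k (t, x))\<^sup>2 + (w2 (Suc k) (t, x) - w2 k (t, x))\<^sup>2) \<le> C * q ^ k"
      using dec[of \<tau>] by blast
    \<comment> \<open>The first summand serves the defect, the second the squared errors from
      \<open>L2_telescoping_limit\<close>.\<close>
    define C' where "C' = C + C / (1 - sqrt q)\<^sup>2"
    have C': "C \<le> C'" "C / (1 - sqrt q)\<^sup>2 \<le> C'" using C0 by (auto simp: C'_def)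
    have up: "x \<le> C' * (s ^ k)\<^sup>2" if "x \<le> D * q ^ k" "D \<le> C'" for x D k
    proof -
      have "D * q ^ k \<le> C' * q ^ k" using that(2) q by (intro mult_right_mono) auto
      then show ?thesis using that(1) s(3) by simp
    qed
    have "defect (R11 k) (R22 k) t \<le> C' * (s ^ k)\<^sup>2 \<and>
       integrable lborel (\<lambda>x. (W1 (t, x) - w1 k (t, x))\<^sup>2) \<and> (LINT x|lborel. (W1 (t, x) - w1 k (t, x))\<^sup>2) \<le> C' * (s ^ k)\<^sup>2 \<and>
       integrable lborel (\<lambda>x. (W2 (t, x) - w2 k (t, x))\<^sup>2) \<and> (LINT x|lborel. (W2 (t, x) - w2 k (t, x))\<^sup>2) \<le> C' * (s ^ k)\<^sup>2"
      if t: "t \<in> {\<tau>..L}" for t k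
    proof -
      obtain B where B: "\<And>x. x \<in> box 0 (1 :: 'n rvec) \<Longrightarrow> norm x \<le> B"
        using bounded_box[of 0 "1 :: 'n rvec"] bounded_iff by metis
      have d0: "w1 (Suc k) (t, x) - w1 k (t, x) = 0" "w2 (Suc k) (t, x) - w2 k (t, x) = 0" if "norm x > B" for x k
      proof -
        have "(t, x) \<notin> {0<..} \<times> box 0 1" using B[of x] that by auto
        then show "w1 (Suc k) (t, x) - w1 k (t, x) = 0" "w2 (Suc k) (t, x) - w2 k (t, x) = 0"
          using subsolution_base[OF sub] by simp_all
      qed
      have i: "integrable lborel (\<lambda>x. (w1 (Suc k) (t, x) - w1 k (t, x))\<^sup>2)"
        "integrable lborel (\<lambda>x. (w2 (Suc k) (t, x) - w2 k (t, x))\<^sup>2)" for k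
        by (rule integrable_continuous_support[where B = B];
            use d0 in \<open>auto intro!: continuous_intros continuous_slice cont\<close>)+
      have le: "(LINT x|lborel. (w1 (Suc k) (t, x) - w1 k (t, x))\<^sup>2) \<le> C * q ^ k"
        "(LINT x|lborel. (w2 (Suc k) (t, x) - w2 k (t, x))\<^sup>2) \<le> C * q ^ k" for k
      proof -
        have nn: "0 \<le> (LINT x|lborel. (w1 (Suc k) (t, x) - w1 k (t, x))\<^sup>2)" "0 \<le> (LINT x|lborel. (w2 (Suc k) (t, x) - w2 k (t, x))\<^sup>2)"
          by (auto intro!: integral_nonneg_AE AE_I2)
        have "(LINT x|lborel. (w1 (Suc k) (t, x) - w1 k (t, x))\<^sup>2) + (LINT x|lborel. (w2 (Suc k) (t, x) - w2 k (t, x))\<^sup>2) \<le> C * q ^ k"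
          using C(2)[OF t, of k] i by simp
        then show "(LINT x|lborel. (w1 (Suc k) (t, x) - w1 k (t, x))\<^sup>2) \<le> C * q ^ k"
          "(LINT x|lborel. (w2 (Suc k) (t, x) - w2 k (t, x))\<^sup>2) \<le> C * q ^ k" using nn by linarith+
      qed
      have m: "(\<lambda>x. w1 k (t, x)) \<in> borel_measurable lborel" "(\<lambda>x. w2 k (t, x)) \<in> borel_measurable lborel" for k
        using borel_measurable_continuous_onI[OF continuous_slice[OF cont(1)]]
          borel_measurable_continuous_onI[OF continuous_slice[OF cont(2)]] by auto
      show ?thesis
        unfolding W1_def W2_def
        using L2_telescoping_limit[OF m(1) i(1) le(1) q C0] L2_telescoping_limit[OF m(2) i(2) le(2) q C0]
        by (intro conjI up[OF C(1)[OF t] C'(1)]) (auto intro: up[OF _ C'(2)])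
    qed
    moreover have "C' \<ge> 0" using C0 C' by linarith
    ultimately show "\<exists>C\<ge>0. \<forall>t\<in>{\<tau>..L}. \<forall>k. defect (R11 k) (R22 k) t \<le> C * (s ^ k)\<^sup>2 \<and>
       integrable lborel (\<lambda>x. (W1 (t, x) - w1 k (t, x))\<^sup>2) \<and> (LINT x|lborel. (W1 (t, x) - w1 k (t, x))\<^sup>2) \<le> C * (s ^ k)\<^sup>2 \<and>
       integrable lborel (\<lambda>x. (W2 (t, x) - w2 k (t, x))\<^sup>2) \<and> (LINT x|lborel. (W2 (t, x) - w2 k (t, x))\<^sup>2) \<le> C * (s ^ k)\<^sup>2"
      by blast
  qed (use c L s(1,2) sub in auto)
  then show ?thesis by (rule that)
qed

section \<open>The periodic channel\<close>

lemma smooth_C1: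
  fixes f :: "'a::euclidean_space \<Rightarrow> real"
  assumes "smooth f" shows "C1 f (\<lambda>z. frechet_derivative f (at z))"
proof -
  have "Ck (Suc 0) f" using assms by (simp only: smooth_def)
  then show ?thesis by (auto simp: C1_def frechet_derivative_works[symmetric])
qed

lemma smooth_C1_component:
  fixes f :: "'a::euclidean_space \<Rightarrow> real ^ 'n"
  assumes "smooth f" shows "C1 (\<lambda>z. f z $ i) (\<lambda>z p. frechet_derivative f (at z) p $ i)"
proof -
  have "Ck (Suc 0) f" using assms by (simp only: smooth_def)
  then have "(f has_derivative frechet_derivative f (at z)) (at z)"
    "continuous_on UNIV (\<lambda>z. frechet_derivative f (at z) h)" for z h
    by (auto simp: frechet_derivative_works[symmetric])
  then show ?thesis unfolding C1_def
    by (auto intro!: continuous_intros bounded_linear.has_derivative[OF bounded_linear_vec_nth])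
qed

lemma C1_vanish:
  assumes g: "C1 g g'" and U: "open U" "\<And>z. z \<in> U \<Longrightarrow> g z = 0" and z: "z \<in> U"
  shows "g' z p = 0"
proof -
  have "(g has_derivative g' z) (at z)" using g C1_def by blast
  then have "((\<lambda>z. 0) has_derivative g' z) (at z)"
    using has_derivative_transform_within_open[of g "g' z" z UNIV U "\<lambda>_. 0"] U z by auto
  then have "g' z = (\<lambda>_. 0)" using has_derivative_unique has_derivative_const by metis
  then show ?thesis by simp
qed

text \<open>\<open>Omega\<close> without the condition on the first coordinate. Shifts along
  \<open>ef\<close> preserve it, and \<open>Omega\<close> is one period of it, as
  \<open>periodic_cell_shift\<close> requires.\<close>

definition cross_section :: "('n::{finite,linorder}) rvec set" where
  "cross_section = {x. \<forall>i. i \<noteq> first_ix \<longrightarrow> (if i = last_ix then 0 < x $ i \<and> x $ i < 1 else 0 \<le> x $ i \<and> x $ i < 1)}"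

text \<open>\<open>Omega\<close> without the walls, hence invariant under shifts along
  \<open>el\<close>.\<close>

definition strip :: "('n::{finite,linorder}) rvec set" where
  "strip = {x. \<forall>i. i \<noteq> last_ix \<longrightarrow> 0 \<le> x $ i \<and> x $ i < 1}"

lemma coordinate_sets [measurable]:
  "{x :: real ^ 'n. x $ i < 1} \<in> sets borel" "{x :: real ^ 'n. 0 < x $ i} \<in> sets borel" "{x :: real ^ 'n. 0 \<le> x $ i} \<in> sets borel"
proof -
  have "open {x :: real ^ 'n. x $ i < 1}" "open {x :: real ^ 'n. 0 < x $ i}" "closed {x :: real ^ 'n. 0 \<le> x $ i}"
    by (auto intro!: open_Collect_less closed_Collect_le continuous_intros)
  then show "{x :: real ^ 'n. x $ i < 1} \<in> sets borel" "{x :: real ^ 'n. 0 < x $ i} \<in> sets borel" "{x :: real ^ 'n. 0 \<le> x $ i} \<in> sets borel"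
    by auto
qed

lemma cross_section_borel: "(cross_section :: ('n::{finite,linorder}) rvec set) \<in> sets borel"
  and strip_borel: "(strip :: ('n::{finite,linorder}) rvec set) \<in> sets borel"
proof -
  have "(\<Inter>i\<in>UNIV. (if i = first_ix then UNIV else if i = last_ix then {x. 0 < x $ i} \<inter> {x. x $ i < 1}
      else {x :: 'n rvec. 0 \<le> x $ i} \<inter> {x. x $ i < 1})) \<in> sets borel"
    using coordinate_sets by (intro sets.finite_INT) (auto intro!: sets.Int)
  also have "(\<Inter>i\<in>UNIV. (if i = first_ix then UNIV else if i = last_ix then {x. 0 < x $ i} \<inter> {x. x $ i < 1}
      else {x :: 'n rvec. 0 \<le> x $ i} \<inter> {x. x $ i < 1})) = cross_section"
    by (auto simp: cross_section_def split: if_splits)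
  finally show "(cross_section :: 'n rvec set) \<in> sets borel" .
  have "(\<Inter>i\<in>UNIV. (if i = last_ix then UNIV else {x :: 'n rvec. 0 \<le> x $ i} \<inter> {x. x $ i < 1})) \<in> sets borel"
    using coordinate_sets by (intro sets.finite_INT) (auto intro!: sets.Int)
  also have "(\<Inter>i\<in>UNIV. (if i = last_ix then UNIV else {x :: 'n rvec. 0 \<le> x $ i} \<inter> {x. x $ i < 1})) = strip"
    by (auto simp: strip_def split: if_splits)
  finally show "(strip :: 'n rvec set) \<in> sets borel" .
qed

lemma Omega_cross_section:
  assumes "(first_ix :: 'n::{finite,linorder}) \<noteq> last_ix"
  shows "Omega = {x \<in> cross_section. 0 \<le> x $ first_ix \<and> x $ (first_ix :: 'n) < 1}"
proof (intro set_eqI iffI)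
  fix x :: "'n rvec"
  show "x \<in> Omega \<Longrightarrow> x \<in> {x \<in> cross_section. 0 \<le> x $ first_ix \<and> x $ first_ix < 1}"
    using assms by (auto simp: Omega_def cross_section_def)
  assume x: "x \<in> {x \<in> cross_section. 0 \<le> x $ first_ix \<and> x $ first_ix < 1}"
  have "0 \<le> x $ i \<and> x $ i < 1" if "i \<noteq> last_ix" for i
    using x that by (cases "i = first_ix") (auto simp: cross_section_def)
  moreover have "0 < x $ last_ix \<and> x $ last_ix < 1"
    using x assms by (auto simp: cross_section_def)
  ultimately show "x \<in> Omega" by (simp add: Omega_def)
qed

lemma cross_section_shift: "x + s *\<^sub>R ef \<in> cross_section \<longleftrightarrow> x \<in> cross_section"
  by (auto simp: cross_section_def ef_def axis_def)

lemma strip_shift: "x + s *\<^sub>R el \<in> strip \<longleftrightarrow> x \<in> strip"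
  by (auto simp: strip_def el_def axis_def)

lemma first_shift: "(x + s *\<^sub>R ef) $ first_ix = x $ first_ix + s"
  by (simp add: ef_def axis_def)

lemma snd_vimage_borel:
  fixes S :: "'b::euclidean_space set"
  assumes "S \<in> sets borel" shows "{z :: real \<times> 'b. snd z \<in> S} \<in> sets borel"
proof -
  have "snd \<in> borel_measurable (borel :: (real \<times> 'b) measure)"
    by (intro borel_measurable_continuous_onI continuous_on_snd continuous_on_id)
  from measurable_sets[OF this assms] show ?thesis by (simp add: vimage_def)
qed

text \<open>Removes the constant flow A e1 from the pairing that defines the normal trace: the flow
  is tangential, and its pairing integrates a derivative over a full period.\<close>

lemma torus_derivative_space:
  fixes \<psi> :: "('n::{finite,linorder}) rvec \<Rightarrow> real"
  assumes ne: "(first_ix :: 'n) \<noteq> last_ix" and \<psi>: "C1 \<psi> \<psi>'" and per: "horiz_periodic \<psi>"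
  shows "(LINT x|lborel. indicator Omega x * \<psi>' x ef) = 0"
proof -
  obtain B where B: "\<And>x. x \<in> (Omega :: 'n rvec set) \<Longrightarrow> norm x \<le> B" using Omega_bounded bounded_iff by metis
  have cf: "(\<lambda>x :: 'n rvec. x $ first_ix) \<in> borel_measurable borel"
    by (intro borel_measurable_continuous_onI continuous_intros)
  show ?thesis
  proof (rule integral_deriv_zero_set[OF \<psi> Omega_borel, of B])
    show "\<psi> (z + s *\<^sub>R ef) = 0" if "z \<in> Omega" "norm z > B" for z s using B[OF that(1)] that(2) by simp
    show "(LINT z|lborel. indicator Omega z * \<psi> (z + s *\<^sub>R ef)) = (LINT z|lborel. indicator Omega z * \<psi> z)"
      if "0 < s" "s \<le> 1" for s
    proof (rule periodic_cell_shift[OF cross_section_borel cross_section_shift cf first_shift Omega_cross_section[OF ne]])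
      show "\<psi> \<in> borel_measurable borel" using borel_measurable_continuous_onI[OF C1_continuous[OF \<psi>]] .
      show "\<psi> (z + ef) = \<psi> z" for z using per ne by (simp add: horiz_periodic_def ef_def)
      show "integrable lborel (\<lambda>z. indicator Omega z * \<psi> z)" by (rule integrable_Omega[OF C1_continuous[OF \<psi>]])
    qed (use that in auto)
  qed
qed

text \<open>Supplies \<open>B1\<close>, where the constant momentum meets a time derivative; the
  spatial domain does not change with time, so shifts in time preserve it.\<close>

lemma time_derivative_zero:
  fixes g :: "('n::{finite,linorder}) field"
  assumes g: "C1 g g'" and out: "\<And>z. fst z \<notin> {a..b} \<Longrightarrow> g z = 0"
  shows "(LINT z|lborel. indicator Omega (snd z) * g' z dt) = 0"
proof -
  let ?S = "{z :: real \<times> 'n rvec. snd z \<in> Omega}"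
  obtain B where B: "\<And>x. x \<in> (Omega :: 'n rvec set) \<Longrightarrow> norm x \<le> B" using Omega_bounded bounded_iff by metis
  have "(LINT z|lborel. indicator ?S z * g' z dt) = 0"
  proof (rule integral_deriv_zero_set[OF g snd_vimage_borel[OF Omega_borel], of "\<bar>a\<bar> + \<bar>b\<bar> + 1 + B"])
    fix z :: "real \<times> 'n rvec" and s :: real assume z: "z \<in> ?S" "norm z > \<bar>a\<bar> + \<bar>b\<bar> + 1 + B" and s: "0 \<le> s" "s \<le> 1"
    have "norm z \<le> norm (fst z) + norm (snd z)" by (metis norm_Pair_le prod.collapse)
    then have "\<bar>fst z\<bar> > \<bar>a\<bar> + \<bar>b\<bar> + 1" using z B[of "snd z"] by auto
    then have "fst (z + s *\<^sub>R dt) \<notin> {a..b}" using s by (auto simp: dt_def)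
    then show "g (z + s *\<^sub>R dt) = 0" by (rule out)
  next
    fix s :: real assume s: "0 < s" "s \<le> 1"
    have m: "(\<lambda>z. indicator ?S z * g z) \<in> borel_measurable borel"
      using snd_vimage_borel[OF Omega_borel] borel_measurable_continuous_onI[OF C1_continuous[OF g]]
      by (intro borel_measurable_times borel_measurable_indicator) auto
    have "indicator ?S (z + s *\<^sub>R dt) = (indicator ?S z :: real)" for z by (simp add: indicator_def dt_def)
    then show "(LINT z|lborel. indicator ?S z * g (z + s *\<^sub>R dt)) = (LINT z|lborel. indicator ?S z * g z)"
      using lborel_integral_translate[OF m, of "s *\<^sub>R dt"] by (simp only:)
  qed
  then show ?thesis by (simp add: indicator_def)
qed

text \<open>Supplies \<open>B2\<close>, with \<open>g\<close> the first component of the test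
  function times the background flux A^2 + c t / 2.\<close>

lemma torus_derivative_zero:
  fixes g :: "('n::{finite,linorder}) field"
  assumes ne: "(first_ix :: 'n) \<noteq> last_ix" and g: "C1 g g'" and out: "\<And>z. fst z \<notin> {a..b} \<Longrightarrow> g z = 0"
    and per: "\<And>z. g (z + df) = g z"
  shows "(LINT z|lborel. indicator Omega (snd z) * g' z df) = 0"
proof -
  let ?S = "{z :: real \<times> 'n rvec. snd z \<in> Omega}" and ?X = "{z :: real \<times> 'n rvec. snd z \<in> cross_section}"
  obtain B where B: "\<And>x. x \<in> (Omega :: 'n rvec set) \<Longrightarrow> norm x \<le> B" using Omega_bounded bounded_iff by metis
  have cf: "(\<lambda>z :: real \<times> 'n rvec. snd z $ first_ix) \<in> borel_measurable borel"
    by (intro borel_measurable_continuous_onI continuous_intros)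
  have sh: "snd (z + s *\<^sub>R df) = snd z + s *\<^sub>R ef" for z :: "real \<times> 'n rvec" and s by (simp add: df_def)
  have "(LINT z|lborel. indicator ?S z * g' z df) = 0"
  proof (rule integral_deriv_zero_set[OF g snd_vimage_borel[OF Omega_borel], of "\<bar>a\<bar> + \<bar>b\<bar> + 1 + B"])
    fix z :: "real \<times> 'n rvec" and s :: real assume z: "z \<in> ?S" "norm z > \<bar>a\<bar> + \<bar>b\<bar> + 1 + B" and s: "0 \<le> s" "s \<le> 1"
    have "norm z \<le> norm (fst z) + norm (snd z)" by (metis norm_Pair_le prod.collapse)
    then have "\<bar>fst z\<bar> > \<bar>a\<bar> + \<bar>b\<bar> + 1" using z B[of "snd z"] by auto
    then have "fst (z + s *\<^sub>R df) \<notin> {a..b}" by (auto simp: df_def)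
    then show "g (z + s *\<^sub>R df) = 0" by (rule out)
  next
    fix s :: real assume s: "0 < s" "s \<le> 1"
    show "(LINT z|lborel. indicator ?S z * g (z + s *\<^sub>R df)) = (LINT z|lborel. indicator ?S z * g z)"
    proof (rule periodic_cell_shift[of ?X df "\<lambda>z. snd z $ first_ix"])
      show "?X \<in> sets borel" by (rule snd_vimage_borel[OF cross_section_borel])
      show "z + s *\<^sub>R df \<in> ?X \<longleftrightarrow> z \<in> ?X" for z s by (simp only: mem_Collect_eq sh cross_section_shift)
      show "snd (z + s *\<^sub>R df) $ first_ix = snd z $ first_ix + s" for z :: "real \<times> 'n rvec" and s by (simp only: sh first_shift)
      show "?S = {z \<in> ?X. 0 \<le> snd z $ first_ix \<and> snd z $ first_ix < 1}"
        by (subst Omega_cross_section[OF ne]) auto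
      show "g \<in> borel_measurable borel" using borel_measurable_continuous_onI[OF C1_continuous[OF g]] .
      have "integrable lborel (\<lambda>z. indicator Omega (snd z) * g z)"
        by (rule integrable_slab[OF C1_continuous[OF g] out])
      then show "integrable lborel (\<lambda>z. indicator ?S z * g z)" by (simp add: indicator_def)
    qed (use s cf per in auto)
  qed
  then show ?thesis by (simp add: indicator_def)
qed

text \<open>Supplies \<open>B3\<close>. The background stress c t / 2 acts on the walls, but test
  functions vanish near them, so \<open>Omega\<close> may be replaced by the shift invariant
  \<open>strip\<close>.\<close>

lemma strip_derivative_zero:
  fixes g :: "('n::{finite,linorder}) field"
  assumes g: "C1 g g'" and \<delta>: "\<delta> > 0"
    and out: "\<And>z. fst z \<notin> {a..b} \<Longrightarrow> g z = 0" "\<And>z. snd z $ last_ix \<notin> {\<delta>..1 - \<delta>} \<Longrightarrow> g z = 0"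
  shows "(LINT z|lborel. indicator Omega (snd z) * g' z dl) = 0"
proof -
  let ?S = "{z :: real \<times> 'n rvec. snd z \<in> strip}"
  have sh: "snd (z + s *\<^sub>R dl) = snd z + s *\<^sub>R el" for z :: "real \<times> 'n rvec" and s by (simp add: dl_def)
  have "(LINT z|lborel. indicator ?S z * g' z dl) = 0"
  proof (rule integral_deriv_zero_set[OF g snd_vimage_borel[OF strip_borel], of "\<bar>a\<bar> + \<bar>b\<bar> + real CARD('n) * 2"])
    fix z :: "real \<times> 'n rvec" and s :: real
    assume z: "z \<in> ?S" "norm z > \<bar>a\<bar> + \<bar>b\<bar> + real CARD('n) * 2" and s: "0 \<le> s" "s \<le> 1"
    have nz: "norm z \<le> norm (fst z) + norm (snd z)" by (metis norm_Pair_le prod.collapse)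
    \<comment> \<open>The strip is unbounded in the last direction. Where that coordinate exceeds 2
      in modulus, a shift of length at most 1 cannot reach [\<delta>, 1 - \<delta>]; elsewhere the
      spatial part is bounded and time must leave [a, b].\<close>
    show "g (z + s *\<^sub>R dl) = 0"
    proof (cases "\<bar>snd z $ last_ix\<bar> \<le> 2")
      case True
      have "\<bar>snd z $ i\<bar> \<le> 2" for i using z(1) True by (cases "i = last_ix") (auto simp: strip_def)
      then have "norm (snd z) \<le> real CARD('n) * 2" by (rule norm_vec_le_card)
      then have "\<bar>fst z\<bar> > \<bar>a\<bar> + \<bar>b\<bar>" using nz z(2) by simp
      then have "fst (z + s *\<^sub>R dl) \<notin> {a..b}" by (auto simp: dl_def)
      then show ?thesis by (rule out(1))
    next
      case False
      moreover have "snd (z + s *\<^sub>R dl) $ last_ix = snd z $ last_ix + s"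
        by (simp only: sh) (simp add: el_def axis_def)
      ultimately have "snd (z + s *\<^sub>R dl) $ last_ix \<notin> {\<delta>..1 - \<delta>}"
        using s \<delta> by auto
      then show ?thesis by (rule out(2))
    qed
  next
    fix s :: real assume s: "0 < s" "s \<le> 1"
    have m: "(\<lambda>z. indicator ?S z * g z) \<in> borel_measurable borel"
      using snd_vimage_borel[OF strip_borel] borel_measurable_continuous_onI[OF C1_continuous[OF g]]
      by (intro borel_measurable_times borel_measurable_indicator) auto
    have "indicator ?S (z + s *\<^sub>R dl) = (indicator ?S z :: real)" for z by (simp only: indicator_def mem_Collect_eq sh strip_shift)
    then show "(LINT z|lborel. indicator ?S z * g (z + s *\<^sub>R dl)) = (LINT z|lborel. indicator ?S z * g z)"
      using lborel_integral_translate[OF m, of "s *\<^sub>R dl"] by (simp only:)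
  qed
  moreover have "indicator ?S z * g' z dl = indicator Omega (snd z) * g' z dl" for z
  proof (cases "snd z $ last_ix \<in> {\<delta>..1 - \<delta>}")
    case True
    then have "snd z \<in> strip \<longleftrightarrow> snd z \<in> Omega" using \<delta> by (auto simp: strip_def Omega_def)
    then show ?thesis by (simp add: indicator_def)
  next
    case False
    let ?U = "{z :: real \<times> 'n rvec. snd z $ last_ix < \<delta>} \<union> {z. 1 - \<delta> < snd z $ last_ix}"
    have "g' z dl = 0"
    proof (rule C1_vanish[OF g, of ?U])
      show "open ?U" by (intro open_Un open_Collect_less continuous_intros)
      show "g z = 0" if "z \<in> ?U" for z using that by (intro out(2)) auto
      show "z \<in> ?U" using False by auto
    qed
    then show ?thesis by simp
  qed
  ultimately show ?thesis by (simp only:)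
qed

lemma is_distribution_zero: "is_distribution T (\<lambda>_. 0)"
  unfolding is_distribution_def by (auto intro!: exI[of _ 0])

context wild_limit
begin

definition vel :: "real \<Rightarrow> 'n rvec \<Rightarrow> 'n rvec" where
  "vel t x = W1 (t, x) *\<^sub>R ef + W2 (t, x) *\<^sub>R el"

lemma vel_measurable: "(\<lambda>z. vel (fst z) (snd z)) \<in> borel_measurable borel"
  unfolding vel_def using Wm by simp

lemma W_integrable':
  assumes "t \<in> {0..L}"
  shows "integrable lborel (\<lambda>x. (W1 (t, x) - A)\<^sup>2)" "integrable lborel (\<lambda>x. (W2 (t, x))\<^sup>2)"
  using W_integrable[of t] base assms by (cases "t = 0"; simp)+

lemma W1_square_integrable:
  assumes "t \<in> {0..L}"
  shows "integrable lborel (\<lambda>x. indicator Omega x * ((W1 (t, x))\<^sup>2 + (W2 (t, x))\<^sup>2))"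
proof (rule Bochner_Integration.integrable_bound)
  show "integrable lborel (\<lambda>x. 2 * (W1 (t, x) - A)\<^sup>2 + (W2 (t, x))\<^sup>2 + 2 * A\<^sup>2 * indicator Omega x)"
    using W_integrable'[OF assms] emeasure_Omega[where 'n = 'n] by simp
  show "(\<lambda>x. indicator Omega x * ((W1 (t, x))\<^sup>2 + (W2 (t, x))\<^sup>2)) \<in> borel_measurable lborel"
    using meas_slices by measurable
  show "AE x in lborel. norm (indicator Omega x * ((W1 (t, x))\<^sup>2 + (W2 (t, x))\<^sup>2))
      \<le> norm (2 * (W1 (t, x) - A)\<^sup>2 + (W2 (t, x))\<^sup>2 + 2 * A\<^sup>2 * indicator Omega x)"
  proof (rule AE_I2)
    fix x
    have "(W1 (t, x))\<^sup>2 \<le> 2 * (W1 (t, x) - A)\<^sup>2 + 2 * A\<^sup>2"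
      using zero_le_power2[of "W1 (t, x) - 2 * A"] by (simp add: power2_eq_square algebra_simps)
    then show "norm (indicator Omega x * ((W1 (t, x))\<^sup>2 + (W2 (t, x))\<^sup>2))
      \<le> norm (2 * (W1 (t, x) - A)\<^sup>2 + (W2 (t, x))\<^sup>2 + 2 * A\<^sup>2 * indicator Omega x)"
      by (cases "x \<in> Omega") auto
  qed
qed

end

locale channel_limit = wild_limit A c L s w1 w2 R11 R12 R22 W1 W2
  for A c L s :: real and w1 w2 R11 R12 R22 :: "nat \<Rightarrow> ('n::{finite,linorder}) field" and W1 W2 :: "'n field" +
  assumes ne: "(first_ix :: 'n) \<noteq> last_ix"
begin

lemma frame_norm: "(norm (a *\<^sub>R ef + b *\<^sub>R (el :: 'n rvec)))\<^sup>2 = a\<^sup>2 + b\<^sup>2"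
  unfolding power2_norm_eq_inner
  by (simp add: inner_add_left inner_add_right frame_inner[OF ne] power2_eq_square)

lemma vel_norm: "(norm (vel t x))\<^sup>2 = (W1 (t, x))\<^sup>2 + (W2 (t, x))\<^sup>2"
  unfolding vel_def by (rule frame_norm)

lemma vel_deviation_norm: "(norm (vel t x - A *\<^sub>R e1))\<^sup>2 = (W1 (t, x) - A)\<^sup>2 + (W2 (t, x))\<^sup>2"
proof -
  have "vel t x - A *\<^sub>R e1 = (W1 (t, x) - A) *\<^sub>R ef + W2 (t, x) *\<^sub>R el"
    by (simp add: vel_def e1_def ef_def scaleR_left_diff_distrib)
  then show ?thesis by (simp only: frame_norm)
qed

lemma vel_L2_norm:
  assumes "0 < t" "t \<le> L"
  shows "(L2_norm (\<lambda>x. vel t x - A *\<^sub>R e1))\<^sup>2 = c * t"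
proof -
  have "(LINT x:Omega|lborel. (norm (vel t x - A *\<^sub>R e1))\<^sup>2) = (LINT x|lborel. (W1 (t, x) - A)\<^sup>2 + (W2 (t, x))\<^sup>2)"
    unfolding set_lebesgue_integral_def vel_deviation_norm
    using Omega_outside(1) by (intro Bochner_Integration.integral_cong refl) (auto simp: indicator_def)
  also have "\<dots> = c * t" using assms by (intro slice_deviation) auto
  finally show ?thesis unfolding L2_norm_def using assms c by simp
qed

lemma vel_in_L2:
  assumes "t \<in> {0..L}" shows "in_L2 (vel t)"
  unfolding in_L2_def
proof
  show "set_borel_measurable lborel Omega (vel t)"
    unfolding set_borel_measurable_def vel_def[abs_def] using meas_slices by simp
  show "set_integrable lborel Omega (\<lambda>x. (norm (vel t x))\<^sup>2)"
    unfolding set_integrable_def vel_norm using W1_square_integrable[OF assms] by simp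
qed

lemma vel_weakly_continuous: "weakly_continuous_L2 {0..<L} vel"
  unfolding weakly_continuous_L2_def
proof (intro conjI ballI allI impI)
  show "in_L2 (vel t)" if "t \<in> {0..<L}" for t using that by (intro vel_in_L2) auto
  fix w :: "'n rvec \<Rightarrow> 'n rvec" assume w: "in_L2 w"
  let ?p1 = "\<lambda>x. (indicator Omega x *\<^sub>R w x) \<bullet> ef" and ?p2 = "\<lambda>x. (indicator Omega x *\<^sub>R w x) \<bullet> el"
  have wm: "(\<lambda>x. indicator Omega x *\<^sub>R w x) \<in> borel_measurable borel"
    and wi: "integrable lborel (\<lambda>x. indicator Omega x *\<^sub>R (norm (w x))\<^sup>2)"
    using w unfolding in_L2_def set_borel_measurable_def set_integrable_def by auto
  have pm: "?p1 \<in> borel_measurable borel" "?p2 \<in> borel_measurable borel" using wm by measurable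
  have pb: "((indicator Omega x *\<^sub>R w x) \<bullet> e)\<^sup>2 \<le> indicator Omega x *\<^sub>R (norm (w x))\<^sup>2" if "e \<bullet> e = 1" for x e
  proof -
    have "norm e = 1" using that by (simp add: norm_eq_sqrt_inner)
    then have "\<bar>w x \<bullet> e\<bar> \<le> norm (w x)" using Cauchy_Schwarz_ineq2[of "w x" e] by simp
    then have "(w x \<bullet> e)\<^sup>2 \<le> (norm (w x))\<^sup>2" using power_mono[of "\<bar>w x \<bullet> e\<bar>" "norm (w x)" 2] by simp
    then show ?thesis by (cases "x \<in> Omega") auto
  qed
  have pi: "integrable lborel (\<lambda>x. (?p1 x)\<^sup>2)" "integrable lborel (\<lambda>x. (?p2 x)\<^sup>2)"
    by (rule Bochner_Integration.integrable_bound[OF wi];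
        use pm pb frame_inner[OF ne] in \<open>auto intro!: AE_I2 simp: borel_measurable_power\<close>)+
  \<comment> \<open>A e1 is split off since \<open>weak_continuity\<close> concerns the deviation;
    its contribution does not depend on time.\<close>
  have eq: "(LINT x:Omega|lborel. vel t x \<bullet> w x)
     = (LINT x|lborel. (W1 (t, x) - A) * ?p1 x + W2 (t, x) * ?p2 x) + A * (LINT x|lborel. ?p1 x)"
    if t: "t \<in> {0..<L}" for t
  proof -
    have am: "(\<lambda>x. W1 (t, x) - A) \<in> borel_measurable lborel" "(\<lambda>x. W2 (t, x)) \<in> borel_measurable lborel"
      "?p1 \<in> borel_measurable lborel" "?p2 \<in> borel_measurable lborel"
      using meas_slices pm by auto
    have t': "t \<in> {0..L}" using t by auto
    have "integrable lborel (\<lambda>x. (W1 (t, x) - A) * ?p1 x)" "integrable lborel (\<lambda>x. W2 (t, x) * ?p2 x)"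
      by (rule integrable_square_product[OF am(1,3) W_integrable'(1)[OF t'] pi(1)],
          rule integrable_square_product[OF am(2,4) W_integrable'(2)[OF t'] pi(2)])
    then have i: "integrable lborel (\<lambda>x. (W1 (t, x) - A) * ?p1 x + W2 (t, x) * ?p2 x)"
      by (rule Bochner_Integration.integrable_add)
    have io: "integrable lborel (\<lambda>x. (indicator (Omega :: 'n rvec set) x :: real)\<^sup>2)"
    proof -
      have "(\<lambda>x. (indicator Omega x :: real)\<^sup>2) = indicator (Omega :: 'n rvec set)"
        by (auto simp: indicator_def fun_eq_iff)
      then show ?thesis using emeasure_Omega[where 'n = 'n] by simp
    qed
    have "integrable lborel (\<lambda>x. indicator Omega x * ?p1 x)"
      using pm by (intro integrable_square_product io pi) auto
    moreover have "(\<lambda>x. indicator Omega x * ?p1 x) = ?p1" by (auto simp: indicator_def fun_eq_iff)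
    ultimately have j: "integrable lborel ?p1" by simp
    have "(LINT x:Omega|lborel. vel t x \<bullet> w x)
       = (LINT x|lborel. ((W1 (t, x) - A) * ?p1 x + W2 (t, x) * ?p2 x) + A * ?p1 x)"
      unfolding set_lebesgue_integral_def
      by (intro Bochner_Integration.integral_cong refl)
        (simp add: vel_def inner_add_left inner_commute algebra_simps)
    also have "\<dots> = (LINT x|lborel. (W1 (t, x) - A) * ?p1 x + W2 (t, x) * ?p2 x) + A * (LINT x|lborel. ?p1 x)"
      by (simp only: Bochner_Integration.integral_add[OF i integrable_mult_right[OF j]] integral_mult_right_zero)
    finally show ?thesis .
  qed
  have "continuous_on {0..<L} (\<lambda>t. (LINT x|lborel. (W1 (t, x) - A) * ?p1 x + W2 (t, x) * ?p2 x) + A * (LINT x|lborel. ?p1 x))"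
    by (intro continuous_on_add continuous_on_const weak_continuity[OF pm pi])
  then show "continuous_on {0..<L} (\<lambda>t. LINT x:Omega|lborel. vel t x \<bullet> w x)"
    by (rule continuous_on_eq) (simp only: eq)
qed

text \<open>The deviation from A e1 is zero outside the open unit cell and orthogonal to gradients
  on the whole space, so no boundary term appears even if the test function does not vanish at the
  walls. The constant flow is covered by periodicity.\<close>

lemma vel_zero_trace:
  assumes "t \<in> {0<..L}" shows "zero_normal_trace (vel t)"
  unfolding zero_normal_trace_def
proof (intro allI impI)
  fix \<psi> :: "'n rvec \<Rightarrow> real" assume sm: "smooth \<psi>" and per: "horiz_periodic \<psi>"
  let ?d = "\<lambda>x. frechet_derivative \<psi> (at x)"
  note \<psi> = smooth_C1[OF sm]
  have lin: "?d x (a *\<^sub>R ef + b *\<^sub>R el) = a * ?d x ef + b * ?d x el" for x a b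
    using C1_linear[OF \<psi>, of x] by (simp add: linear_add linear_scale)
  have t': "t \<in> {0..L}" using assms by auto
  have iO: "integrable lborel (\<lambda>x. indicator Omega x * ?d x ef)" by (rule integrable_Omega[OF C1_continuous'[OF \<psi>]])
  have i: "integrable lborel (\<lambda>x. (W1 (t, x) - A) * ?d x ef + W2 (t, x) * ?d x el)"
  proof -
    let ?p = "\<lambda>e x. indicator Omega x * ?d x e"
    have pm: "?p e \<in> borel_measurable lborel" for e
      using borel_measurable_continuous_onI[OF C1_continuous'[OF \<psi>]] by measurable
    have "integrable lborel (\<lambda>x. indicator Omega x * (?d x e)\<^sup>2)" for e
      by (intro integrable_Omega continuous_intros C1_continuous'[OF \<psi>])
    moreover have "(?p e x)\<^sup>2 = indicator Omega x * (?d x e)\<^sup>2" for x e by (simp add: indicator_def)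
    ultimately have pi: "integrable lborel (\<lambda>x. (?p e x)\<^sup>2)" for e by simp
    have am: "(\<lambda>x. W1 (t, x) - A) \<in> borel_measurable lborel" "(\<lambda>x. W2 (t, x)) \<in> borel_measurable lborel"
      using meas_slices by auto
    have "integrable lborel (\<lambda>x. (W1 (t, x) - A) * ?p ef x + W2 (t, x) * ?p el x)"
      by (intro Bochner_Integration.integrable_add integrable_square_product am pm pi W_integrable'[OF t'])
    moreover have "(W1 (t, x) - A) * ?p ef x + W2 (t, x) * ?p el x = (W1 (t, x) - A) * ?d x ef + W2 (t, x) * ?d x el" for x
      using Omega_outside(1)[of x t] by (cases "x \<in> Omega") auto
    ultimately show ?thesis by simp
  qed
  have "grad_pairing (vel t) \<psi> = (LINT x|lborel. ((W1 (t, x) - A) * ?d x ef + W2 (t, x) * ?d x el) + A * (indicator Omega x * ?d x ef))"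
    unfolding grad_pairing_def set_lebesgue_integral_def vel_def lin
  proof (intro Bochner_Integration.integral_cong refl)
    fix x
    show "indicat_real Omega x *\<^sub>R (W1 (t, x) * ?d x ef + W2 (t, x) * ?d x el)
      = ((W1 (t, x) - A) * ?d x ef + W2 (t, x) * ?d x el) + A * (indicator Omega x * ?d x ef)"
      using Omega_outside(1)[of x t] by (cases "x \<in> Omega") (auto simp: algebra_simps)
  qed
  also have "\<dots> = (LINT x|lborel. (W1 (t, x) - A) * ?d x ef + W2 (t, x) * ?d x el) + A * (LINT x|lborel. indicator Omega x * ?d x ef)"
    by (simp only: Bochner_Integration.integral_add[OF i integrable_mult_right[OF iO]] integral_mult_right_zero)
  finally show "grad_pairing (vel t) \<psi> = 0"
    using slice_div[OF assms \<psi>] torus_derivative_space[OF ne \<psi> per] by simp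
qed

text \<open>Zero pressure is enough because the background stress (c t / 2) I is constant in space:
  its divergence vanishes, so it drops out of the tested equation.\<close>

lemma vel_momentum: "momentum_equation L vel (\<lambda>_. 0)"
  unfolding momentum_equation_def
proof
  fix \<phi> :: "real \<times> 'n rvec \<Rightarrow> 'n rvec" assume "\<phi> \<in> test_fns L"
  then obtain \<delta> where \<delta>: "\<delta> > 0" and sm: "smooth \<phi>" and per: "\<And>t. horiz_periodic (\<lambda>x. \<phi> (t, x))"
    and supp: "\<And>t x. \<phi> (t, x) \<noteq> 0 \<Longrightarrow> \<delta> \<le> t \<and> t \<le> L - \<delta> \<and> \<delta> \<le> x $ last_ix \<and> x $ last_ix \<le> 1 - \<delta>"
    unfolding test_fns_def test_fns_on_def by auto
  define g1 where "g1 z = \<phi> z $ first_ix" for z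
  define g2 where "g2 z = \<phi> z $ last_ix" for z
  define g1' where "g1' z p = frechet_derivative \<phi> (at z) p $ first_ix" for z p
  define g2' where "g2' z p = frechet_derivative \<phi> (at z) p $ last_ix" for z p
  have g: "C1 g1 g1'" "C1 g2 g2'"
    unfolding g1_def[abs_def] g2_def[abs_def] g1'_def[abs_def] g2'_def[abs_def] by (rule smooth_C1_component[OF sm])+
  have zero: "\<phi> z = 0" if "fst z \<notin> {\<delta>..L - \<delta>} \<or> snd z $ last_ix \<notin> {\<delta>..1 - \<delta>}" for z
  proof (rule ccontr)
    assume "\<phi> z \<noteq> 0"
    then have "\<phi> (fst z, snd z) \<noteq> 0" by simp
    then show False using supp[of "fst z" "snd z"] that by auto
  qed
  have o1: "g1 z = 0" "g2 z = 0" if "fst z \<notin> {\<delta>..L - \<delta>}" for z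
    using zero[of z] that by (auto simp: g1_def g2_def)
  have o2: "g1 z = 0" "g2 z = 0" if "snd z $ last_ix \<notin> {\<delta>..1 - \<delta>}" for z
    using zero[of z] that by (auto simp: g1_def g2_def)
  let ?U = "{z :: real \<times> 'n rvec. fst z < \<delta>} \<union> {z. L - \<delta> < fst z}"
  have U: "open ?U" by (intro open_Un open_Collect_less continuous_intros)
  have o': "g1' z p = 0" "g2' z p = 0" if "fst z \<notin> {\<delta>..L - \<delta>}" for z p
  proof -
    have z: "z \<in> ?U" using that by auto
    have "g1 y = 0" "g2 y = 0" if "y \<in> ?U" for y using that by (intro o1; auto)+
    then show "g1' z p = 0" "g2' z p = 0" using C1_vanish[OF g(1) U _ z] C1_vanish[OF g(2) U _ z] by blast+
  qed
  have B1: "(LINT z|lborel. indicator Omega (snd z) * g1' z dt) = 0"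
    by (rule time_derivative_zero[OF g(1) o1(1)])
  \<comment> \<open>The coefficient depends on time alone, so its product with \<open>g1\<close> is
    still periodic and the derivative along \<open>df\<close> falls on \<open>g1\<close>
    only.\<close>
  have B2: "(LINT z|lborel. indicator Omega (snd z) * ((A\<^sup>2 + c * fst z / 2) * g1' z df)) = 0"
  proof -
    have "C1 (\<lambda>z :: real \<times> 'n rvec. A\<^sup>2 + c * fst z / 2) (\<lambda>z p. c * fst p / 2)"
      unfolding C1_def by (auto intro!: derivative_eq_intros continuous_intros)
    from C1_mult[OF this g(1)]
    have C: "C1 (\<lambda>z. (A\<^sup>2 + c * fst z / 2) * g1 z) (\<lambda>z p. (A\<^sup>2 + c * fst z / 2) * g1' z p + c * fst p / 2 * g1 z)" .
    have "g1 (z + df) = g1 z" for z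
    proof -
      have "\<phi> (fst z, snd z + axis first_ix 1) = \<phi> (fst z, snd z)" using per[of "fst z"] ne unfolding horiz_periodic_def by blast
      then show ?thesis by (cases z) (simp add: g1_def df_def ef_def)
    qed
    then have "(A\<^sup>2 + c * fst (z + df) / 2) * g1 (z + df) = (A\<^sup>2 + c * fst z / 2) * g1 z" for z by (simp add: df_def)
    from torus_derivative_zero[OF ne C _ this, of \<delta> "L - \<delta>"] o1(1) show ?thesis by (simp add: df_def)
  qed
  have B3: "(LINT z|lborel. indicator Omega (snd z) * (c * fst z / 2 * g2' z dl)) = 0"
  proof -
    have "C1 (\<lambda>z :: real \<times> 'n rvec. c * fst z / 2) (\<lambda>z p. c * fst p / 2)"
      unfolding C1_def by (auto intro!: derivative_eq_intros continuous_intros)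
    from C1_mult[OF this g(2)]
    have C: "C1 (\<lambda>z. c * fst z / 2 * g2 z) (\<lambda>z p. c * fst z / 2 * g2' z p + c * fst p / 2 * g2 z)" .
    from strip_derivative_zero[OF C \<delta>, of \<delta> "L - \<delta>"] o1(2) o2(2) show ?thesis by (simp add: dl_def)
  qed
  have lin: "frechet_derivative \<phi> (at z) (0, a *\<^sub>R ef + b *\<^sub>R el) = a *\<^sub>R frechet_derivative \<phi> (at z) df + b *\<^sub>R frechet_derivative \<phi> (at z) dl" for z a b
  proof -
    have "\<phi> differentiable (at z)" using sm unfolding smooth_def by (metis Ck.simps(2))
    then have "linear (frechet_derivative \<phi> (at z))" by (rule linear_frechet_derivative)
    moreover have "(0, a *\<^sub>R ef + b *\<^sub>R el) = a *\<^sub>R df + b *\<^sub>R (dl :: real \<times> 'n rvec)" by (simp add: df_def dl_def)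
    ultimately show ?thesis by (simp only: linear_add linear_scale)
  qed
  have comp: "y \<bullet> ef = y $ first_ix" "y \<bullet> el = y $ last_ix" "ef \<bullet> y = y $ first_ix" "el \<bullet> y = y $ last_ix" for y :: "'n rvec"
    by (simp_all add: ef_def el_def inner_axis inner_axis')
  have integrand: "vel t x \<bullet> time_deriv \<phi> (t, x) + vel t x \<bullet> space_deriv \<phi> (t, x) (vel t x)
    = W1 (t, x) * g1' (t, x) dt + W2 (t, x) * g2' (t, x) dt + (W1 (t, x))\<^sup>2 * g1' (t, x) df
      + W1 (t, x) * W2 (t, x) * (g1' (t, x) dl + g2' (t, x) df) + (W2 (t, x))\<^sup>2 * g2' (t, x) dl" for t x
    unfolding time_deriv_def space_deriv_def vel_def lin
    by (simp add: inner_add_left inner_add_right comp g1'_def g2'_def dt_def power2_eq_square algebra_simps)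
  have "(LINT (t, x):{0<..<L} \<times> Omega|lborel. vel t x \<bullet> time_deriv \<phi> (t, x) + vel t x \<bullet> space_deriv \<phi> (t, x) (vel t x))
    = (LINT z|lborel. indicator Omega (snd z) * (W1 z * g1' z dt + W2 z * g2' z dt + (W1 z)\<^sup>2 * g1' z df
      + W1 z * W2 z * (g1' z dl + g2' z df) + (W2 z)\<^sup>2 * g2' z dl))"
    unfolding set_lebesgue_integral_def
  proof (intro Bochner_Integration.integral_cong refl)
    fix z :: "real \<times> 'n rvec"
    obtain t x where z: "z = (t, x)" by (cases z)
    \<comment> \<open>The restriction to times in (0, L) may be dropped: outside
      [\<delta>, L - \<delta>] the derivatives of the test function vanish.\<close>
    show "indicat_real ({0<..<L} \<times> Omega) z *\<^sub>R (case z of (t, x) \<Rightarrow> vel t x \<bullet> time_deriv \<phi> (t, x) + vel t x \<bullet> space_deriv \<phi> (t, x) (vel t x))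
      = indicator Omega (snd z) * (W1 z * g1' z dt + W2 z * g2' z dt + (W1 z)\<^sup>2 * g1' z df
      + W1 z * W2 z * (g1' z dl + g2' z df) + (W2 z)\<^sup>2 * g2' z dl)"
    proof (cases "t \<in> {\<delta>..L - \<delta>}")
      case True
      then have "t \<in> {0<..<L}" using \<delta> by auto
      then show ?thesis by (simp add: z integrand indicator_def)
    next
      case False
      then show ?thesis using o'[of z] by (simp add: z integrand)
    qed
  qed
  also have "\<dots> = 0" by (rule momentum_limit[OF g \<delta> o' B1 B2 B3])
  finally show "(LINT (t, x):{0<..<L} \<times> Omega|lborel. vel t x \<bullet> time_deriv \<phi> (t, x) + vel t x \<bullet> space_deriv \<phi> (t, x) (vel t x)) + 0 = 0"
    by simp
qed

lemma vel_solution: "euler_weak_solution L (\<lambda>x. A *\<^sub>R e1) vel"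
  unfolding euler_weak_solution_def
proof (intro conjI allI impI ballI)
  have "{0<..<L} \<times> (Omega :: 'n rvec set) = {z. fst z \<in> {0<..<L}} \<inter> {z. snd z \<in> Omega}" by auto
  moreover have "{z :: real \<times> 'n rvec. fst z \<in> {0<..<L}} \<in> sets borel"
  proof -
    have "fst \<in> borel_measurable (borel :: (real \<times> 'n rvec) measure)"
      by (intro borel_measurable_continuous_onI continuous_on_fst continuous_on_id)
    from measurable_sets[OF this, of "{0<..<L}"] show ?thesis by (simp add: vimage_def)
  qed
  ultimately have sb: "{0<..<L} \<times> (Omega :: 'n rvec set) \<in> sets borel"
    using snd_vimage_borel[OF Omega_borel] by auto
  have "(\<lambda>(t, x). vel t x) = (\<lambda>z. vel (fst z) (snd z))" by auto
  then show "set_borel_measurable lborel ({0<..<L} \<times> Omega) (\<lambda>(t, x). vel t x)"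
    unfolding set_borel_measurable_def using vel_measurable sb by simp
  show "set_integrable lborel ({0<..<S} \<times> Omega) (\<lambda>(t, x). (norm (vel t x))\<^sup>2)" if "0 < S \<and> S < L" for S
    using energy_integrable[of S] that unfolding set_integrable_def vel_norm by (simp add: case_prod_unfold)
  show "weakly_continuous_L2 {0..<L} vel" by (rule vel_weakly_continuous)
  show "AE x in lborel. x \<in> Omega \<longrightarrow> vel 0 x = A *\<^sub>R e1"
    using base by (simp add: vel_def e1_def ef_def)
  fix t assume t: "t \<in> {0<..<L}"
  then show "zero_normal_trace (vel t)" by (intro vel_zero_trace) auto
  then show "div_free (vel t)" unfolding zero_normal_trace_def div_free_def by blast
next
  show "\<exists>P. is_distribution L P \<and> momentum_equation L vel P"
    using is_distribution_zero vel_momentum by blast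
qed

end

theorem proposition1p1:
  fixes A C :: real
  assumes "CARD('n::{finite,linorder}) \<in> {2, 3}"
    and "A > 0"
    and "0 < C" and "C < 2"
  shows "\<exists>v :: real \<Rightarrow> 'n rvec \<Rightarrow> 'n rvec.
    euler_weak_solution (1 / (2 * A)) (\<lambda>x. A *\<^sub>R e1) v \<and>
    (\<forall>T. 0 < T \<and> T < 1 / (2 * A) \<longrightarrow>
      (L2_norm (\<lambda>x. v T x - A *\<^sub>R e1))\<^sup>2 = C * A ^ 3 * T)"
proof -
  have n: "CARD('n) \<ge> 2" using assms(1) by auto
  have "C * A ^ 3 > 0" "1 / (2 * A) > 0" using assms by auto
  then obtain s w1 w2 R11 R12 R22 and W1 W2 :: "'n field"
    where "wild_limit A (C * A ^ 3) (1 / (2 * A)) s w1 w2 R11 R12 R22 W1 W2"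
    using wild_limit_exists[OF n] by metis
  then interpret wild_limit A "C * A ^ 3" "1 / (2 * A)" s w1 w2 R11 R12 R22 W1 W2 .
  interpret channel_limit A "C * A ^ 3" "1 / (2 * A)" s w1 w2 R11 R12 R22 W1 W2
    by unfold_locales (rule first_neq_last[OF n])
  show ?thesis using vel_solution vel_L2_norm by (intro exI[of _ vel]) auto
qed

end
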